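(* For every $\epsilon>0$ there exists a randomized algorithm that, given an integer $k$ and an instance $(A,B,D,\delta,W)$ of the circuit switch scheduling problem, returns a feasible schedule whose value, in expectation, is at least $\left(1-\frac1e-\epsilon\right)$ times the maximum value of a feasible schedule that uses at most $k$ matchings (configurations). Moreover, the running time of the algorithm is polynomial in $\frac{n}{\epsilon^k}$, where $n$ is the size of the instance.
   Context: Circuit switch scheduling problem: $A,B$ finite disjoint sets, $E=A\times B$ the edges of the complete bipartite graph on $A\cup B$, $D\in\mathbb{R}_{\geq0}^{A\times B}$ a demand matrix, $\delta\geq0$ a switching delay, $W\geq 0$ a time window. A matching is a set of pairwise vertex-disjoint edges. A configuration is a pair $(M,\alpha)$ with $M$ a matching and $\alpha\in\mathbb{R}_{\geq0}$; a schedule is a finite set $S$ of configurations, feasible if $\sum_{(M,\alpha)\in S}(\alpha+\delta)\leq W$; its value is $f(S)=\sum_{e\in E}\min(D_e,\sum_{(M,\alpha)\in S: e\in M}\alpha)$. *)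

theory Defs
  imports "HOL-Probability.Probability" "HOL-Computational_Algebra.Polynomial"
begin

section \<open>Circuit switch scheduling\<close>

record 'v switch_instance =
  left :: "'v set"
  right :: "'v set"
  demand :: "'v \<times> 'v \<Rightarrow> real"
  delay :: real
  window :: real

type_synonym 'v configuration = "('v \<times> 'v) set \<times> real"
type_synonym 'v schedule = "'v configuration set"

definition edges :: "'v switch_instance \<Rightarrow> ('v \<times> 'v) set" where
  "edges I = left I \<times> right I"

definition valid_instance :: "'v switch_instance \<Rightarrow> bool" where
  "valid_instance I \<longleftrightarrow>
     finite (left I) \<and> finite (right I) \<and> left I \<inter> right I = {} \<and>
     (\<forall>e\<in>edges I. 0 \<le> demand I e) \<and> 0 \<le> delay I \<and> 0 \<le> window I"

definition is_matching :: "'v switch_instance \<Rightarrow> ('v \<times> 'v) set \<Rightarrow> bool" where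
  "is_matching I M \<longleftrightarrow> M \<subseteq> edges I \<and>
     (\<forall>e\<in>M. \<forall>f\<in>M. e \<noteq> f \<longrightarrow> {fst e, snd e} \<inter> {fst f, snd f} = {})"

definition is_schedule :: "'v switch_instance \<Rightarrow> 'v schedule \<Rightarrow> bool" where
  "is_schedule I S \<longleftrightarrow> finite S \<and> (\<forall>(M, \<alpha>)\<in>S. is_matching I M \<and> 0 \<le> \<alpha>)"

definition feasible :: "'v switch_instance \<Rightarrow> 'v schedule \<Rightarrow> bool" where
  "feasible I S \<longleftrightarrow> is_schedule I S \<and> (\<Sum>(M, \<alpha>)\<in>S. \<alpha> + delay I) \<le> window I"

definition schedule_value :: "'v switch_instance \<Rightarrow> 'v schedule \<Rightarrow> real" where
  "schedule_value I S =
     (\<Sum>e\<in>edges I. min (demand I e) (\<Sum>(M, \<alpha>)\<in>{(M, \<alpha>). (M, \<alpha>) \<in> S \<and> e \<in> M}. \<alpha>))"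

definition opt :: "nat \<Rightarrow> 'v switch_instance \<Rightarrow> real" where
  "opt k I = Sup (schedule_value I ` {S. feasible I S \<and> card S \<le> k})"

lemma opt_set_nonempty:
  assumes "valid_instance I"
  shows "schedule_value I ` {S. feasible I S \<and> card S \<le> k} \<noteq> {}"
proof -
  have "feasible I {}"
    using assms by (simp add: feasible_def is_schedule_def valid_instance_def)
  then show ?thesis by (metis (mono_tags, lifting) card.empty empty_iff image_is_empty le0 mem_Collect_eq)
qed

lemma opt_set_bdd_above: "bdd_above (schedule_value I ` {S. feasible I S \<and> card S \<le> k})"
  by (rule bdd_aboveI[of _ "\<Sum>e\<in>edges I. demand I e"])
     (auto simp: schedule_value_def intro!: sum_mono)


section \<open>Randomized real RAM\<close>

text \<open>
  The instances carry arbitrary real data, so the machine is a real RAM: every elementary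
  instruction on reals, including a comparison, costs one step. There is no rounding
  instruction and no multiplication of natural numbers, since either one at unit cost would
  allow packing long computations into single numbers. All constants in a program are integers.
  Arguments of instructions are register or array names; arrays are indexed by the contents of
  a register.
\<close>

record machine_state =
  nreg :: "nat \<Rightarrow> nat"
  rreg :: "nat \<Rightarrow> real"
  narr :: "nat \<Rightarrow> nat \<Rightarrow> nat"
  rarr :: "nat \<Rightarrow> nat \<Rightarrow> real"

datatype instr =
    NConst nat nat
  | NAdd nat nat nat
  | NSub nat nat nat
  | NLoad nat nat nat
  | NStore nat nat nat
  | RConst nat int
  | RAdd nat nat nat
  | RSub nat nat nat
  | RMul nat nat nat
  | RDiv nat nat nat
  | RNat nat nat
  | RLoad nat nat nat
  | RStore nat nat nat

datatype test = NLess nat nat | NLe nat nat | RLess nat nat | RLe nat nat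

datatype program =
    Skip
  | Instr instr
  | Flip nat
  | Seq program program
  | Branch test program program
  | Loop test program

definition set_nreg :: "nat \<Rightarrow> nat \<Rightarrow> machine_state \<Rightarrow> machine_state" where
  "set_nreg i x s = s\<lparr>nreg := (nreg s)(i := x)\<rparr>"

definition set_rreg :: "nat \<Rightarrow> real \<Rightarrow> machine_state \<Rightarrow> machine_state" where
  "set_rreg i x s = s\<lparr>rreg := (rreg s)(i := x)\<rparr>"

fun exec :: "instr \<Rightarrow> machine_state \<Rightarrow> machine_state" where
  "exec (NConst i c) s = set_nreg i c s"
| "exec (NAdd i j l) s = set_nreg i (nreg s j + nreg s l) s"
| "exec (NSub i j l) s = set_nreg i (nreg s j - nreg s l) s"
| "exec (NLoad i a j) s = set_nreg i (narr s a (nreg s j)) s"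
| "exec (NStore a j i) s = s\<lparr>narr := (narr s)(a := (narr s a)(nreg s j := nreg s i))\<rparr>"
| "exec (RConst i c) s = set_rreg i (of_int c) s"
| "exec (RAdd i j l) s = set_rreg i (rreg s j + rreg s l) s"
| "exec (RSub i j l) s = set_rreg i (rreg s j - rreg s l) s"
| "exec (RMul i j l) s = set_rreg i (rreg s j * rreg s l) s"
| "exec (RDiv i j l) s = set_rreg i (rreg s j / rreg s l) s"
| "exec (RNat i j) s = set_rreg i (real (nreg s j)) s"
| "exec (RLoad i a j) s = set_rreg i (rarr s a (nreg s j)) s"
| "exec (RStore a j i) s = s\<lparr>rarr := (rarr s)(a := (rarr s a)(nreg s j := rreg s i))\<rparr>"

fun holds :: "test \<Rightarrow> machine_state \<Rightarrow> bool" where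
  "holds (NLess i j) s \<longleftrightarrow> nreg s i < nreg s j"
| "holds (NLe i j) s \<longleftrightarrow> nreg s i \<le> nreg s j"
| "holds (RLess i j) s \<longleftrightarrow> rreg s i < rreg s j"
| "holds (RLe i j) s \<longleftrightarrow> rreg s i \<le> rreg s j"

text \<open>
  One step of a program; \<open>Skip\<close> is the halted program. A flip stores an independent fair
  random bit in a register.
\<close>

primrec step :: "program \<Rightarrow> machine_state \<Rightarrow> (program \<times> machine_state) pmf" where
  "step Skip s = return_pmf (Skip, s)"
| "step (Instr c) s = return_pmf (Skip, exec c s)"
| "step (Flip i) s =
     map_pmf (\<lambda>b. (Skip, set_nreg i (if b then 1 else 0) s)) (bernoulli_pmf (1/2))"
| "step (Seq p q) s =
     (if p = Skip then return_pmf (q, s)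
      else map_pmf (\<lambda>(p', s'). (Seq p' q, s')) (step p s))"
| "step (Branch b p q) s = return_pmf (if holds b s then p else q, s)"
| "step (Loop b p) s = return_pmf (if holds b s then Seq p (Loop b p) else Skip, s)"

primrec run :: "nat \<Rightarrow> program \<times> machine_state \<Rightarrow> (program \<times> machine_state) pmf" where
  "run 0 c = return_pmf c"
| "run (Suc t) c = bind_pmf (step (fst c) (snd c)) (run t)"

definition halts_within :: "nat \<Rightarrow> program \<Rightarrow> machine_state \<Rightarrow> bool" where
  "halts_within t p s \<longleftrightarrow> (\<forall>c\<in>set_pmf (run t (p, s)). fst c = Skip)"

definition terminates :: "program \<Rightarrow> machine_state \<Rightarrow> bool" where
  "terminates p s \<longleftrightarrow> (\<exists>t. halts_within t p s)"

text \<open>Running time in the worst case over the coin flips; meaningful only if \<open>terminates p s\<close>.\<close>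

definition running_time :: "program \<Rightarrow> machine_state \<Rightarrow> nat" where
  "running_time p s = (LEAST t. halts_within t p s)"

definition final_state :: "program \<Rightarrow> machine_state \<Rightarrow> machine_state pmf" where
  "final_state p s = map_pmf snd (run (running_time p s) (p, s))"


section \<open>Input and output\<close>

definition array_of :: "'a::zero list \<Rightarrow> nat \<Rightarrow> 'a" where
  "array_of xs i = (if i < length xs then xs ! i else 0)"

text \<open>
  Vertices are named by natural numbers. The input consists of \<open>k\<close>, the lists of left and right
  vertices with their lengths, the delay, the window and the demand matrix in row-major order.
\<close>

definition input_state :: "nat \<Rightarrow> nat switch_instance \<Rightarrow> machine_state" where
  "input_state k I =
     (let as = sorted_list_of_set (left I); bs = sorted_list_of_set (right I) in
      \<lparr>nreg = array_of [k, length as, length bs],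
       rreg = array_of [delay I, window I],
       narr = (\<lambda>_ _. 0)(0 := array_of as, 1 := array_of bs),
       rarr = (\<lambda>_ _. 0)(0 := array_of (map (demand I) (List.product as bs)))\<rparr>)"

text \<open>
  The number of vertices, demands and real parameters of the instance (each number has size one
  in the real RAM model).
\<close>

definition instance_size :: "'v switch_instance \<Rightarrow> nat" where
  "instance_size I = card (left I) + card (right I) + card (edges I) + 2"

text \<open>
  Register 0 holds the number of configurations, and array entry \<open>rarr s 0 c\<close> the duration of
  configuration \<open>c\<close>. Register 1 holds the length of a list of triples, the \<open>t\<close>-th of which,
  \<open>(narr s 0 t, narr s 1 t, narr s 2 t) = (c, u, v)\<close>, puts edge \<open>(u, v)\<close> into the matching of
  configuration \<open>c\<close>.
\<close>

definition output_schedule :: "machine_state \<Rightarrow> nat schedule" where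
  "output_schedule s =
     (\<lambda>c. ({(narr s 1 t, narr s 2 t) | t. t < nreg s 1 \<and> narr s 0 t = c}, rarr s 0 c))
       ` {..<nreg s 0}"

definition returned_schedule :: "program \<Rightarrow> nat \<Rightarrow> nat switch_instance \<Rightarrow> nat schedule pmf" where
  "returned_schedule p k I = map_pmf output_schedule (final_state p (input_state k I))"

end

theory Submission
  imports Defs
begin

text \<open>
  For \<open>\<epsilon> \<ge> 1 - 1/e\<close> the empty schedule suffices. Otherwise let \<open>r = \<lceil>4/\<epsilon>\<rceil>\<close>; a deterministic program
  does the following for every \<open>m \<le> k\<close>, where \<open>L = W - m \<delta>\<close> is the time left for transmission.

  It guesses the \<open>m\<close> durations of an optimal schedule up to a factor \<open>1 - 2/r\<close>, on a grid of width
  \<open>L/(r m)\<close>. If the optimal durations are sorted decreasingly, the one with index \<open>i\<close> is at most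
  \<open>L/(i+1)\<close>, so that it has \<open>O(r m/(i+1))\<close> candidates, and the number of guesses is at most
  \<open>(3 r)\<^sup>m m\<^sup>m/m! \<le> (9 r)\<^sup>m\<close>.

  For fixed durations the matchings are chosen by the tabular greedy algorithm for a partition
  matroid: a table with \<open>r\<close> colours holds one matching for each configuration and colour, and its
  entries are filled colour by colour, each maximising the sum of the values of the \<open>r\<^sup>m\<close> schedules
  obtained by picking one colour per configuration. As the value is a sum over edges, the marginal
  gain of an entry is the weight of a matching. By concavity, the gain of one colour is at least
  \<open>(1 - 1/r)/r\<close> times the remaining deficit, which leaves a deficit of at most \<open>1/e + 2/r\<close> of the
  optimum after all \<open>r\<close> colours; the best of the \<open>r\<^sup>m\<close> schedules is as good as their average.

  Matchings of weight at least \<open>1 - 1/r\<close> times the maximum are found by an auction whose price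
  increment is \<open>1/(a r)\<close> of the largest weight, where \<open>a\<close> is the number of left vertices.
\<close>


section \<open>Deterministic executions\<close>

text \<open>Fixing the durations first removes the time constraint from the choice of matchings:
  what remains is one matching per duration, a partition matroid. The colours are there because the
  plain greedy algorithm guarantees only 1/2 on such a matroid. The program never flips a coin:
  guesses and colour vectors are few enough to be enumerated, so the expectation is that of a point
  mass. The time bound has no room for a factor like \<open>k^k\<close>, and constants to the power
  \<open>k\<close> are harmless only if 1/\<epsilon> stays away from 1. This is why large \<epsilon>
  is treated separately: what remains has 1/\<epsilon> > 3/2, and a fixed power of
  \<open>1/\<epsilon>^k\<close> absorbs \<open>45^k\<close>. Of the loss 4/r, one half comes from
  rounding durations, the other from the greedy algorithm with approximate matchings. For the
  running time, the algorithm is written in a small language whose loops have bounds fixed on entry.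
  A single number \<open>B = n * (9 * r) ^ k\<close> bounds all loops, and since the program text
  depends on \<epsilon> only through the constant \<open>r\<close>, its time is a polynomial in
  \<open>B\<close> that does not depend on \<epsilon>.\<close>

inductive dsteps :: "nat \<Rightarrow> program \<times> machine_state \<Rightarrow> program \<times> machine_state \<Rightarrow> bool" where
  dsteps_refl: "dsteps 0 c c"
| dsteps_step: "p \<noteq> Skip \<Longrightarrow> step p s = return_pmf c \<Longrightarrow> dsteps t c c' \<Longrightarrow> dsteps (Suc t) (p, s) c'"

lemma dsteps_trans: "dsteps t c c' \<Longrightarrow> dsteps t' c' c'' \<Longrightarrow> dsteps (t + t') c c''"
  by (induction rule: dsteps.induct) (auto intro: dsteps_step)

text \<open>Relies on \<open>p \<noteq> Skip\<close> in \<open>dsteps_step\<close>: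
  \<open>Seq Skip q\<close> moves on to \<open>q\<close> and does not imitate the idle step of
  \<open>Skip\<close>.\<close>

lemma dsteps_Seq: "dsteps t c c' \<Longrightarrow> dsteps t (Seq (fst c) q, snd c) (Seq (fst c') q, snd c')"
proof (induction rule: dsteps.induct)
  case (dsteps_step p s c t c')
  then show ?case
    by (intro dsteps.dsteps_step[of _ _ "(Seq (fst c) q, snd c)"]) (auto simp: case_prod_beta)
qed (simp add: dsteps_refl)

lemma dsteps_run: "dsteps t c c' \<Longrightarrow> run t c = return_pmf c'"
  by (induction rule: dsteps.induct) (auto simp: bind_return_pmf)

lemma run_add: "run (t + t') c = bind_pmf (run t c) (run t')"
  by (induction t arbitrary: c) (simp_all add: bind_return_pmf bind_assoc_pmf fun_eq_iff cong: bind_pmf_cong)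

lemma run_Skip: "fst c = Skip \<Longrightarrow> run t c = return_pmf c"
  by (cases c) (induction t, auto simp: bind_return_pmf)

lemma run_after_halt:
  assumes "halts_within t p s" "t \<le> t'"
  shows "run t' (p, s) = run t (p, s)"
proof -
  have "run t' (p, s) = bind_pmf (run t (p, s)) (run (t' - t))"
    using run_add[of t "t' - t"] assms(2) by simp
  also have "\<dots> = bind_pmf (run t (p, s)) return_pmf"
    using assms(1) by (intro bind_pmf_cong) (auto simp: halts_within_def run_Skip)
  finally show ?thesis by (simp add: bind_return_pmf')
qed

text \<open>Total correctness with a time budget. As \<open>T\<close> is only an upper bound,
  budgets can be added along the program structure without exact step counts.\<close>

definition achieves :: "program \<Rightarrow> machine_state \<Rightarrow> nat \<Rightarrow> (machine_state \<Rightarrow> bool) \<Rightarrow> bool" where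
  "achieves p s T Q \<longleftrightarrow> (\<exists>t\<le>T. \<exists>s'. dsteps t (p, s) (Skip, s') \<and> Q s')"

lemma achieves_final:
  assumes "achieves p s T Q"
  obtains s' where "terminates p s" "running_time p s \<le> T" "final_state p s = return_pmf s'" "Q s'"
proof -
  obtain t s' where t: "t \<le> T" "dsteps t (p, s) (Skip, s')" "Q s'"
    using assms by (auto simp: achieves_def)
  have run: "run t (p, s) = return_pmf (Skip, s')"
    using dsteps_run[OF t(2)] .
  then have h: "halts_within t p s"
    by (simp add: halts_within_def)
  then have rt: "halts_within (running_time p s) p s" "running_time p s \<le> t"
    unfolding running_time_def by (auto intro: LeastI Least_le)
  \<comment> \<open>It does not matter whether \<open>t\<close> is the least halting time: once
    every outcome has halted, the distribution no longer changes.\<close>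
  have "final_state p s = return_pmf s'"
    using run_after_halt[OF rt, symmetric] run by (simp add: final_state_def)
  with h rt t show ?thesis by (intro that) (auto simp: terminates_def)
qed

lemma achieves_mono:
  "achieves p s T Q \<Longrightarrow> T \<le> T' \<Longrightarrow> (\<And>s'. Q s' \<Longrightarrow> Q' s') \<Longrightarrow> achieves p s T' Q'"
  unfolding achieves_def by (meson le_trans)

lemma achieves_Skip: "Q s \<Longrightarrow> achieves Skip s T Q"
  unfolding achieves_def by (auto intro: dsteps_refl)

lemma achieves_Instr: "Q (exec c s) \<Longrightarrow> 1 \<le> T \<Longrightarrow> achieves (Instr c) s T Q"
  unfolding achieves_def
  by (rule exI[of _ 1]) (auto intro!: exI[of _ "exec c s"] dsteps_step[where t = 0] dsteps_refl)

lemma achieves_Seq: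
  assumes "achieves p s T1 (\<lambda>s'. achieves q s' T2 Q)" "T1 + T2 + 1 \<le> T"
  shows "achieves (Seq p q) s T Q"
proof -
  obtain t1 s1 where 1: "t1 \<le> T1" "dsteps t1 (p, s) (Skip, s1)" "achieves q s1 T2 Q"
    using assms(1) unfolding achieves_def by blast
  obtain t2 s2 where 2: "t2 \<le> T2" "dsteps t2 (q, s1) (Skip, s2)" "Q s2"
    using 1(3) unfolding achieves_def by blast
  have "dsteps (t1 + Suc t2) (Seq p q, s) (Skip, s2)"
    using dsteps_Seq[OF 1(2), of q] 2(2)
    by (intro dsteps_trans[of t1 _ "(Seq Skip q, s1)"] dsteps_step[of _ _ "(q, s1)"]) auto
  with 1 2 assms(2) show ?thesis unfolding achieves_def
    by (intro exI[of _ "t1 + Suc t2"]) auto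
qed

lemma achieves_Branch:
  assumes "achieves (if holds b s then p else q) s T1 Q" "T1 + 1 \<le> T"
  shows "achieves (Branch b p q) s T Q"
proof -
  obtain t s' where 1: "t \<le> T1" "dsteps t (if holds b s then p else q, s) (Skip, s')" "Q s'"
    using assms(1) unfolding achieves_def by blast
  then have "dsteps (Suc t) (Branch b p q, s) (Skip, s')"
    by (auto intro!: dsteps_step)
  with 1 assms(2) show ?thesis unfolding achieves_def
    by (intro exI[of _ "Suc t"]) auto
qed

lemma achieves_Loop_unfold:
  assumes "holds b s" "achieves (Seq p (Loop b p)) s T1 Q" "T1 + 1 \<le> T"
  shows "achieves (Loop b p) s T Q"
proof -
  obtain t s' where 1: "t \<le> T1" "dsteps t (Seq p (Loop b p), s) (Skip, s')" "Q s'"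
    using assms(2) unfolding achieves_def by blast
  then have "dsteps (Suc t) (Loop b p, s) (Skip, s')"
    using assms(1) by (auto intro!: dsteps_step)
  with 1 assms(3) show ?thesis unfolding achieves_def
    by (intro exI[of _ "Suc t"]) auto
qed

lemma achieves_Loop_exit: "\<not> holds b s \<Longrightarrow> Q s \<Longrightarrow> 1 \<le> T \<Longrightarrow> achieves (Loop b p) s T Q"
  unfolding achieves_def
  by (rule exI[of _ 1]) (auto intro!: exI[of _ s] dsteps_step[where t = 0] dsteps_refl)

text \<open>The invariant is indexed by the number of completed rounds. Each round pays two steps
  besides its body, one for the test and one for leaving the finished \<open>Skip\<close>; the final
  \<open>+ 1\<close> is the failing test.\<close>

lemma achieves_Loop:
  assumes "\<And>j s. j < n \<Longrightarrow> P j s \<Longrightarrow> holds b s \<and> achieves p s T (P (Suc j))"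
    and "\<And>s. P n s \<Longrightarrow> \<not> holds b s \<and> Q s"
    and "P 0 s" "n * (T + 2) + 1 \<le> T'"
  shows "achieves (Loop b p) s T' Q"
proof -
  have "achieves (Loop b p) s ((n - j) * (T + 2) + 1) Q" if "j \<le> n" "P j s" for j s
    using that
  proof (induction "n - j" arbitrary: j s)
    case 0
    then show ?case using assms(2) by (intro achieves_Loop_exit) auto
  next
    case (Suc x)
    then have j: "j < n" "x = n - Suc j" "n - j = Suc (n - Suc j)" by auto
    have "achieves p s T (\<lambda>s'. achieves (Loop b p) s' ((n - Suc j) * (T + 2) + 1) Q)"
      using assms(1)[OF j(1) Suc.prems(2)] Suc.hyps(1)[OF j(2)] j(1)
      by (auto elim!: achieves_mono)
    moreover have "holds b s" using assms(1)[OF j(1) Suc.prems(2)] by blast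
    ultimately show ?case unfolding j(3)
      by (intro achieves_Loop_unfold[OF _ achieves_Seq[OF _ order.refl]]) auto
  qed
  from this[of 0 s] assms(3,4) show ?thesis by (auto elim: achieves_mono)
qed


section \<open>A structured language with bounded loops\<close>

datatype nexp =
    NC nat
  | NV nat
  | NPlus nexp nexp
  | NMinus nexp nexp
  | NTimes nexp nexp
  | NDiv nexp nexp
  | NGet nat nexp

datatype rop = Plus | Minus | Times | Divide

datatype rexp =
    RC int
  | RV nat
  | RBin rop rexp rexp
  | RMin rexp rexp
  | ROf nexp
  | RGet nat nexp

datatype bexp = NLt nexp nexp | NLeq nexp nexp | RLt rexp rexp | RLeq rexp rexp

text \<open>\<open>FOR\<close> evaluates its bound once and assigns its counter afresh in each
  round, so the body cannot influence the number of rounds and every command terminates.\<close>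

datatype cmd =
    NOP
  | NSet nat nexp
  | RSet nat rexp
  | NPut nat nexp nexp
  | RPut nat nexp rexp
  | SEQ cmd cmd (infixr \<open>;;\<close> 60)
  | IF bexp cmd cmd
  | FOR nat nexp cmd

primrec neval :: "nexp \<Rightarrow> machine_state \<Rightarrow> nat" where
  "neval (NC c) s = c"
| "neval (NV i) s = nreg s i"
| "neval (NPlus a b) s = neval a s + neval b s"
| "neval (NMinus a b) s = neval a s - neval b s"
| "neval (NTimes a b) s = neval a s * neval b s"
| "neval (NDiv a b) s = neval a s div neval b s"
| "neval (NGet x a) s = narr s x (neval a s)"

primrec rop_eval :: "rop \<Rightarrow> real \<Rightarrow> real \<Rightarrow> real" where
  "rop_eval Plus x y = x + y"
| "rop_eval Minus x y = x - y"
| "rop_eval Times x y = x * y"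
| "rop_eval Divide x y = x / y"

primrec reval :: "rexp \<Rightarrow> machine_state \<Rightarrow> real" where
  "reval (RC c) s = of_int c"
| "reval (RV i) s = rreg s i"
| "reval (RBin f a b) s = rop_eval f (reval a s) (reval b s)"
| "reval (RMin a b) s = min (reval a s) (reval b s)"
| "reval (ROf a) s = real (neval a s)"
| "reval (RGet x a) s = rarr s x (neval a s)"

primrec beval :: "bexp \<Rightarrow> machine_state \<Rightarrow> bool" where
  "beval (NLt a b) s \<longleftrightarrow> neval a s < neval b s"
| "beval (NLeq a b) s \<longleftrightarrow> neval a s \<le> neval b s"
| "beval (RLt a b) s \<longleftrightarrow> reval a s < reval b s"
| "beval (RLeq a b) s \<longleftrightarrow> reval a s \<le> reval b s"

definition put_narr :: "nat \<Rightarrow> nat \<Rightarrow> nat \<Rightarrow> machine_state \<Rightarrow> machine_state" where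
  "put_narr a j x s = s\<lparr>narr := (narr s)(a := (narr s a)(j := x))\<rparr>"

definition put_rarr :: "nat \<Rightarrow> nat \<Rightarrow> real \<Rightarrow> machine_state \<Rightarrow> machine_state" where
  "put_rarr a j x s = s\<lparr>rarr := (rarr s)(a := (rarr s a)(j := x))\<rparr>"

primrec sem :: "cmd \<Rightarrow> machine_state \<Rightarrow> machine_state" where
  "sem NOP s = s"
| "sem (NSet i e) s = set_nreg i (neval e s) s"
| "sem (RSet i e) s = set_rreg i (reval e s) s"
| "sem (NPut a i e) s = put_narr a (neval i s) (neval e s) s"
| "sem (RPut a i e) s = put_rarr a (neval i s) (reval e s) s"
| "sem (c ;; d) s = sem d (sem c s)"
| "sem (IF b c d) s = (if beval b s then sem c s else sem d s)"
| "sem (FOR i e c) s = fold (\<lambda>j s. sem c (set_nreg i j s)) [0..<neval e s] s"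

text \<open>
  Products and quotients are compiled to loops of additions and subtractions. \<open>ok B c s\<close> says
  that every loop entered when running \<open>c\<close> from \<open>s\<close> makes at most \<open>B\<close> rounds.
\<close>

primrec nok :: "nat \<Rightarrow> nexp \<Rightarrow> machine_state \<Rightarrow> bool" where
  "nok B (NC c) s \<longleftrightarrow> True"
| "nok B (NV i) s \<longleftrightarrow> True"
| "nok B (NPlus a b) s \<longleftrightarrow> nok B a s \<and> nok B b s"
| "nok B (NMinus a b) s \<longleftrightarrow> nok B a s \<and> nok B b s"
| "nok B (NTimes a b) s \<longleftrightarrow> nok B a s \<and> nok B b s \<and> neval b s \<le> B"
| "nok B (NDiv a b) s \<longleftrightarrow> nok B a s \<and> nok B b s \<and> neval a s \<le> B \<and> 0 < neval b s"
| "nok B (NGet x a) s \<longleftrightarrow> nok B a s"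

primrec rok :: "nat \<Rightarrow> rexp \<Rightarrow> machine_state \<Rightarrow> bool" where
  "rok B (RC c) s \<longleftrightarrow> True"
| "rok B (RV i) s \<longleftrightarrow> True"
| "rok B (RBin f a b) s \<longleftrightarrow> rok B a s \<and> rok B b s"
| "rok B (RMin a b) s \<longleftrightarrow> rok B a s \<and> rok B b s"
| "rok B (ROf a) s \<longleftrightarrow> nok B a s"
| "rok B (RGet x a) s \<longleftrightarrow> nok B a s"

primrec bok :: "nat \<Rightarrow> bexp \<Rightarrow> machine_state \<Rightarrow> bool" where
  "bok B (NLt a b) s \<longleftrightarrow> nok B a s \<and> nok B b s"
| "bok B (NLeq a b) s \<longleftrightarrow> nok B a s \<and> nok B b s"
| "bok B (RLt a b) s \<longleftrightarrow> rok B a s \<and> rok B b s"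
| "bok B (RLeq a b) s \<longleftrightarrow> rok B a s \<and> rok B b s"

primrec ok :: "nat \<Rightarrow> cmd \<Rightarrow> machine_state \<Rightarrow> bool" where
  "ok B NOP s \<longleftrightarrow> True"
| "ok B (NSet i e) s \<longleftrightarrow> nok B e s"
| "ok B (RSet i e) s \<longleftrightarrow> rok B e s"
| "ok B (NPut a i e) s \<longleftrightarrow> nok B i s \<and> nok B e s"
| "ok B (RPut a i e) s \<longleftrightarrow> nok B i s \<and> rok B e s"
| "ok B (c ;; d) s \<longleftrightarrow> ok B c s \<and> ok B d (sem c s)"
| "ok B (IF b c d) s \<longleftrightarrow> bok B b s \<and> (if beval b s then ok B c s else ok B d s)"
| "ok B (FOR i e c) s \<longleftrightarrow> nok B e s \<and> neval e s \<le> B \<and>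
     (\<forall>j<neval e s. ok B c (set_nreg i j (fold (\<lambda>j s. sem c (set_nreg i j s)) [0..<j] s)))"

text \<open>The registers from \<open>temp\<close> on are reserved for the compiler.\<close>

definition temp :: nat where "temp = 64"

primrec nwf :: "nexp \<Rightarrow> bool" where
  "nwf (NC c) \<longleftrightarrow> True"
| "nwf (NV i) \<longleftrightarrow> i < temp"
| "nwf (NPlus a b) \<longleftrightarrow> nwf a \<and> nwf b"
| "nwf (NMinus a b) \<longleftrightarrow> nwf a \<and> nwf b"
| "nwf (NTimes a b) \<longleftrightarrow> nwf a \<and> nwf b"
| "nwf (NDiv a b) \<longleftrightarrow> nwf a \<and> nwf b"
| "nwf (NGet x a) \<longleftrightarrow> nwf a"

primrec rwf :: "rexp \<Rightarrow> bool" where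
  "rwf (RC c) \<longleftrightarrow> True"
| "rwf (RV i) \<longleftrightarrow> i < temp"
| "rwf (RBin f a b) \<longleftrightarrow> rwf a \<and> rwf b"
| "rwf (RMin a b) \<longleftrightarrow> rwf a \<and> rwf b"
| "rwf (ROf a) \<longleftrightarrow> nwf a"
| "rwf (RGet x a) \<longleftrightarrow> nwf a"

primrec bwf :: "bexp \<Rightarrow> bool" where
  "bwf (NLt a b) \<longleftrightarrow> nwf a \<and> nwf b"
| "bwf (NLeq a b) \<longleftrightarrow> nwf a \<and> nwf b"
| "bwf (RLt a b) \<longleftrightarrow> rwf a \<and> rwf b"
| "bwf (RLeq a b) \<longleftrightarrow> rwf a \<and> rwf b"

primrec wf_cmd :: "cmd \<Rightarrow> bool" where
  "wf_cmd NOP \<longleftrightarrow> True"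
| "wf_cmd (NSet i e) \<longleftrightarrow> i < temp \<and> nwf e"
| "wf_cmd (RSet i e) \<longleftrightarrow> i < temp \<and> rwf e"
| "wf_cmd (NPut a i e) \<longleftrightarrow> nwf i \<and> nwf e"
| "wf_cmd (RPut a i e) \<longleftrightarrow> nwf i \<and> rwf e"
| "wf_cmd (c ;; d) \<longleftrightarrow> wf_cmd c \<and> wf_cmd d"
| "wf_cmd (IF b c d) \<longleftrightarrow> bwf b \<and> wf_cmd c \<and> wf_cmd d"
| "wf_cmd (FOR i e c) \<longleftrightarrow> i < temp \<and> nwf e \<and> wf_cmd c"


section \<open>Compilation\<close>

definition nmove :: "nat \<Rightarrow> nat \<Rightarrow> program" where
  "nmove i j = Seq (Instr (NConst i 0)) (Instr (NAdd i i j))"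

definition rmove :: "nat \<Rightarrow> nat \<Rightarrow> program" where
  "rmove i j = Seq (Instr (RConst i 0)) (Instr (RAdd i i j))"

definition nincr :: "nat \<Rightarrow> nat \<Rightarrow> program" where
  "nincr i tmp = Seq (Instr (NConst tmp 1)) (Instr (NAdd i i tmp))"

text \<open>Registers from \<open>d\<close> upwards serve as a stack: the result is left in
  \<open>d\<close>, and nothing below \<open>d\<close> is touched. In the loops \<open>d + 4\<close>
  only holds the constant 1 for the increment.\<close>

primrec ncomp :: "nat \<Rightarrow> nexp \<Rightarrow> program" where
  "ncomp d (NC c) = Instr (NConst d c)"
| "ncomp d (NV i) = nmove d i"
| "ncomp d (NPlus a b) = Seq (ncomp d a) (Seq (ncomp (d + 1) b) (Instr (NAdd d d (d + 1))))"
| "ncomp d (NMinus a b) = Seq (ncomp d a) (Seq (ncomp (d + 1) b) (Instr (NSub d d (d + 1))))"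
| "ncomp d (NTimes a b) = Seq (ncomp d a) (Seq (ncomp (d + 1) b)
     (Seq (Instr (NConst (d + 2) 0)) (Seq (Instr (NConst (d + 3) 0))
     (Seq (Loop (NLess (d + 2) (d + 1)) (Seq (Instr (NAdd (d + 3) (d + 3) d)) (nincr (d + 2) (d + 4))))
     (nmove d (d + 3))))))"
| "ncomp d (NDiv a b) = Seq (ncomp d a) (Seq (ncomp (d + 1) b)
     (Seq (Instr (NConst (d + 2) 0))
     (Seq (Loop (NLe (d + 1) d) (Seq (Instr (NSub d d (d + 1))) (nincr (d + 2) (d + 4))))
     (nmove d (d + 2)))))"
| "ncomp d (NGet x a) = Seq (ncomp d a) (Instr (NLoad d x d))"

text \<open>The 7 is the price of one round of the multiplication or division loop: five steps for
  the body, two for the loop itself.\<close>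

primrec ntime :: "nat \<Rightarrow> nexp \<Rightarrow> nat" where
  "ntime B (NC c) = 1"
| "ntime B (NV i) = 3"
| "ntime B (NPlus a b) = ntime B a + ntime B b + 3"
| "ntime B (NMinus a b) = ntime B a + ntime B b + 3"
| "ntime B (NTimes a b) = ntime B a + ntime B b + 7 * B + 13"
| "ntime B (NDiv a b) = ntime B a + ntime B b + 7 * B + 13"
| "ntime B (NGet x a) = ntime B a + 2"

primrec rop_instr :: "rop \<Rightarrow> nat \<Rightarrow> nat \<Rightarrow> nat \<Rightarrow> instr" where
  "rop_instr Plus = RAdd"
| "rop_instr Minus = RSub"
| "rop_instr Times = RMul"
| "rop_instr Divide = RDiv"

primrec rcomp :: "nat \<Rightarrow> nat \<Rightarrow> rexp \<Rightarrow> program" where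
  "rcomp n d (RC c) = Instr (RConst d c)"
| "rcomp n d (RV i) = rmove d i"
| "rcomp n d (RBin f a b) = Seq (rcomp n d a) (Seq (rcomp n (d + 1) b) (Instr (rop_instr f d d (d + 1))))"
| "rcomp n d (RMin a b) = Seq (rcomp n d a) (Seq (rcomp n (d + 1) b)
     (Branch (RLess (d + 1) d) (rmove d (d + 1)) Skip))"
| "rcomp n d (ROf a) = Seq (ncomp n a) (Instr (RNat d n))"
| "rcomp n d (RGet x a) = Seq (ncomp n a) (Instr (RLoad d x n))"

primrec rtime :: "nat \<Rightarrow> rexp \<Rightarrow> nat" where
  "rtime B (RC c) = 1"
| "rtime B (RV i) = 3"
| "rtime B (RBin f a b) = rtime B a + rtime B b + 3"
| "rtime B (RMin a b) = rtime B a + rtime B b + 6"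
| "rtime B (ROf a) = ntime B a + 2"
| "rtime B (RGet x a) = ntime B a + 2"

primrec bcomp :: "nat \<Rightarrow> bexp \<Rightarrow> program" where
  "bcomp n (NLt a b) = Seq (ncomp n a) (ncomp (n + 1) b)"
| "bcomp n (NLeq a b) = Seq (ncomp n a) (ncomp (n + 1) b)"
| "bcomp n (RLt a b) = Seq (rcomp n temp a) (rcomp n (temp + 1) b)"
| "bcomp n (RLeq a b) = Seq (rcomp n temp a) (rcomp n (temp + 1) b)"

primrec btest :: "nat \<Rightarrow> bexp \<Rightarrow> test" where
  "btest n (NLt a b) = NLess n (n + 1)"
| "btest n (NLeq a b) = NLe n (n + 1)"
| "btest n (RLt a b) = RLess temp (temp + 1)"
| "btest n (RLeq a b) = RLe temp (temp + 1)"

primrec btime :: "nat \<Rightarrow> bexp \<Rightarrow> nat" where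
  "btime B (NLt a b) = ntime B a + ntime B b + 1"
| "btime B (NLeq a b) = ntime B a + ntime B b + 1"
| "btime B (RLt a b) = rtime B a + rtime B b + 1"
| "btime B (RLeq a b) = rtime B a + rtime B b + 1"

text \<open>A loop keeps its bound in \<open>n\<close> and its counter in \<open>n + 1\<close>; the
  body is compiled with \<open>n + 2\<close>, so nested loops occupy disjoint registers.\<close>

primrec compile :: "nat \<Rightarrow> cmd \<Rightarrow> program" where
  "compile n NOP = Skip"
| "compile n (NSet i e) = Seq (ncomp n e) (nmove i n)"
| "compile n (RSet i e) = Seq (rcomp n temp e) (rmove i temp)"
| "compile n (NPut a i e) = Seq (ncomp n i) (Seq (ncomp (n + 1) e) (Instr (NStore a n (n + 1))))"
| "compile n (RPut a i e) = Seq (ncomp n i) (Seq (rcomp (n + 1) temp e) (Instr (RStore a n temp)))"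
| "compile n (c ;; d) = Seq (compile n c) (compile n d)"
| "compile n (IF b c d) = Seq (bcomp n b) (Branch (btest n b) (compile n c) (compile n d))"
| "compile n (FOR i e c) = Seq (ncomp n e) (Seq (Instr (NConst (n + 1) 0))
     (Loop (NLess (n + 1) n)
       (Seq (nmove i (n + 1)) (Seq (compile (n + 2) c) (nincr (n + 1) (n + 2))))))"

primrec ctime :: "nat \<Rightarrow> cmd \<Rightarrow> nat" where
  "ctime B NOP = 0"
| "ctime B (NSet i e) = ntime B e + 4"
| "ctime B (RSet i e) = rtime B e + 4"
| "ctime B (NPut a i e) = ntime B i + ntime B e + 3"
| "ctime B (RPut a i e) = ntime B i + rtime B e + 3"
| "ctime B (c ;; d) = ctime B c + ctime B d + 1"
| "ctime B (IF b c d) = btime B b + ctime B c + ctime B d + 2"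
| "ctime B (FOR i e c) = ntime B e + B * (ctime B c + 10) + 4"

definition same :: "nat \<Rightarrow> nat \<Rightarrow> machine_state \<Rightarrow> machine_state \<Rightarrow> bool" where
  "same n d s t \<longleftrightarrow> (\<forall>i<n. nreg t i = nreg s i) \<and> (\<forall>i<d. rreg t i = rreg s i) \<and>
     narr t = narr s \<and> rarr t = rarr s"

lemma same_refl: "same n d s s"
  by (simp add: same_def)

lemma same_trans: "same n d s t \<Longrightarrow> same n' d' t u \<Longrightarrow> n \<le> n' \<Longrightarrow> d \<le> d' \<Longrightarrow> same n d s u"
  by (auto simp: same_def)

lemma same_mono: "same n' d' s t \<Longrightarrow> n \<le> n' \<Longrightarrow> d \<le> d' \<Longrightarrow> same n d s t"
  by (auto simp: same_def)

lemma neval_same: "nwf e \<Longrightarrow> same temp temp s t \<Longrightarrow> neval e t = neval e s"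
  by (induction e) (auto simp: same_def)

lemma reval_same: "rwf e \<Longrightarrow> same temp temp s t \<Longrightarrow> reval e t = reval e s"
  by (induction e) (simp_all add: neval_same, auto simp: same_def)

lemma beval_same: "bwf e \<Longrightarrow> same temp temp s t \<Longrightarrow> beval e t = beval e s"
  by (cases e) (auto simp: neval_same reval_same)

lemma nok_same: "nwf e \<Longrightarrow> same temp temp s t \<Longrightarrow> nok B e t = nok B e s"
  by (induction e) (auto simp: neval_same)

lemma rok_same: "rwf e \<Longrightarrow> same temp temp s t \<Longrightarrow> rok B e t = rok B e s"
  by (induction e) (auto simp: nok_same)

lemma bok_same: "bwf e \<Longrightarrow> same temp temp s t \<Longrightarrow> bok B e t = bok B e s"
  by (cases e) (auto simp: nok_same rok_same)


lemma nreg_set_nreg [simp]: "nreg (set_nreg i x s) = (nreg s)(i := x)"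
  and rreg_set_nreg [simp]: "rreg (set_nreg i x s) = rreg s"
  and narr_set_nreg [simp]: "narr (set_nreg i x s) = narr s"
  and rarr_set_nreg [simp]: "rarr (set_nreg i x s) = rarr s"
  by (simp_all add: set_nreg_def)

lemma nreg_set_rreg [simp]: "nreg (set_rreg i y s) = nreg s"
  and rreg_set_rreg [simp]: "rreg (set_rreg i y s) = (rreg s)(i := y)"
  and narr_set_rreg [simp]: "narr (set_rreg i y s) = narr s"
  and rarr_set_rreg [simp]: "rarr (set_rreg i y s) = rarr s"
  by (simp_all add: set_rreg_def)

lemma nreg_put_narr [simp]: "nreg (put_narr a j x s) = nreg s"
  and rreg_put_narr [simp]: "rreg (put_narr a j x s) = rreg s"
  and narr_put_narr [simp]: "narr (put_narr a j x s) = (narr s)(a := (narr s a)(j := x))"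
  and rarr_put_narr [simp]: "rarr (put_narr a j x s) = rarr s"
  by (simp_all add: put_narr_def)

lemma nreg_put_rarr [simp]: "nreg (put_rarr a j y s) = nreg s"
  and rreg_put_rarr [simp]: "rreg (put_rarr a j y s) = rreg s"
  and narr_put_rarr [simp]: "narr (put_rarr a j y s) = narr s"
  and rarr_put_rarr [simp]: "rarr (put_rarr a j y s) = (rarr s)(a := (rarr s a)(j := y))"
  by (simp_all add: put_rarr_def)

lemma achieves_nmove:
  "i \<noteq> j \<Longrightarrow> Q (set_nreg i (nreg s j) s) \<Longrightarrow> 3 \<le> T \<Longrightarrow> achieves (nmove i j) s T Q"
  unfolding nmove_def
  by (rule achieves_Seq[where ?T1.0 = 1 and ?T2.0 = 1])
     (auto intro!: achieves_Instr simp: set_nreg_def)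

lemma achieves_rmove:
  "i \<noteq> j \<Longrightarrow> Q (set_rreg i (rreg s j) s) \<Longrightarrow> 3 \<le> T \<Longrightarrow> achieves (rmove i j) s T Q"
  unfolding rmove_def
  by (rule achieves_Seq[where ?T1.0 = 1 and ?T2.0 = 1])
     (auto intro!: achieves_Instr simp: set_rreg_def)

lemma achieves_nincr:
  "i \<noteq> j \<Longrightarrow> Q (set_nreg i (nreg s i + 1) (set_nreg j 1 s)) \<Longrightarrow> 3 \<le> T \<Longrightarrow> achieves (nincr i j) s T Q"
  unfolding nincr_def
  by (rule achieves_Seq[where ?T1.0 = 1 and ?T2.0 = 1])
     (auto intro!: achieves_Instr simp: set_nreg_def)

text \<open>The quantification over \<open>d'\<close> says that no real register changes at all,
  which lets code for natural expressions be embedded in code for real ones.\<close>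

definition computes :: "nat \<Rightarrow> program \<Rightarrow> machine_state \<Rightarrow> nat \<Rightarrow> nat \<Rightarrow> bool" where
  "computes d p s T x \<longleftrightarrow> achieves p s T (\<lambda>t. nreg t d = x \<and> (\<forall>d'. same d d' s t))"

lemma computes_pair:
  assumes "computes d p s T1 x"
    and "\<And>t. same temp temp s t \<Longrightarrow> computes (d + 1) p' t T2 x'"
    and "\<And>t. nreg t d = x \<Longrightarrow> nreg t (d + 1) = x' \<Longrightarrow> (\<And>d'. same d d' s t) \<Longrightarrow> achieves q t T3 Q"
    and "temp \<le> d" "T1 + T2 + T3 + 2 \<le> T"
  shows "achieves (Seq p (Seq p' q)) s T Q"
proof (rule achieves_Seq)
  show "T1 + (T2 + T3 + 1) + 1 \<le> T" using assms(5) by simp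
  show "achieves p s T1 (\<lambda>t. achieves (Seq p' q) t (T2 + T3 + 1) Q)"
    using assms(1) unfolding computes_def
  proof (rule achieves_mono[OF _ order.refl], elim conjE)
    fix t assume t: "nreg t d = x" "\<forall>d'. same d d' s t"
    then have "same temp temp s t" using \<open>temp \<le> d\<close> by (auto intro: same_mono)
    from assms(2)[OF this] show "achieves (Seq p' q) t (T2 + T3 + 1) Q"
      unfolding computes_def
    proof (intro achieves_Seq[OF _ order.refl], elim achieves_mono[OF _ order.refl], elim conjE)
      fix u assume u: "nreg u (d + 1) = x'" "\<forall>d'. same (d + 1) d' t u"
      show "achieves q u T3 Q"
      proof (rule assms(3))
        show "nreg u d = x" using t(1) u(2) by (auto simp: same_def)
        show "nreg u (d + 1) = x'" by fact
        show "same d d' s u" for d'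
          using t(2) u(2) by (metis same_trans le_add1 order.refl)
      qed
    qed
  qed
qed

lemma ncomp_correct:
  assumes "nwf e" "nok B e s" "temp \<le> d"
  shows "computes d (ncomp d e) s (ntime B e) (neval e s)"
  using assms
proof (induction e arbitrary: d s)
  case (NC c)
  then show ?case by (auto simp: computes_def same_def intro!: achieves_Instr)
next
  case (NV i)
  then show ?case by (auto simp: computes_def same_def intro!: achieves_nmove)
next
  case (NPlus a b)
  show ?case unfolding computes_def ncomp.simps
  proof (rule computes_pair[where ?T3.0 = 1 and x' = "neval b s", OF NPlus.IH(1)])
    fix t assume "same temp temp s t"
    with NPlus.prems show "computes (d + 1) (ncomp (d + 1) b) t (ntime B b) (neval b s)"
      using NPlus.IH(2)[of t "d + 1"] by (simp add: nok_same neval_same)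
  qed (use NPlus.prems in \<open>auto simp: same_def intro!: achieves_Instr\<close>)
next
  case (NMinus a b)
  show ?case unfolding computes_def ncomp.simps
  proof (rule computes_pair[where ?T3.0 = 1 and x' = "neval b s", OF NMinus.IH(1)])
    fix t assume "same temp temp s t"
    with NMinus.prems show "computes (d + 1) (ncomp (d + 1) b) t (ntime B b) (neval b s)"
      using NMinus.IH(2)[of t "d + 1"] by (simp add: nok_same neval_same)
  qed (use NMinus.prems in \<open>auto simp: same_def intro!: achieves_Instr\<close>)
next
  case (NTimes a b)
  let ?x = "neval a s" and ?y = "neval b s"
  show ?case unfolding computes_def ncomp.simps
  proof (rule computes_pair[where ?T3.0 = "7 * B + 11" and x' = ?y, OF NTimes.IH(1)])
    fix t assume "same temp temp s t"
    with NTimes.prems show "computes (d + 1) (ncomp (d + 1) b) t (ntime B b) ?y"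
      using NTimes.IH(2)[of t "d + 1"] by (simp add: nok_same neval_same)
  next
    fix t assume t: "nreg t d = ?x" "nreg t (d + 1) = ?y" "\<And>d'. same d d' s t"
    let ?P = "\<lambda>j u. nreg u (d + 2) = j \<and> nreg u (d + 3) = j * ?x \<and> nreg u d = ?x \<and>
      nreg u (d + 1) = ?y \<and> (\<forall>d'. same d d' s u)"
    let ?L = "Loop (NLess (d + 2) (d + 1)) (Seq (Instr (NAdd (d + 3) (d + 3) d)) (nincr (d + 2) (d + 4)))"
    have loop: "achieves ?L u (7 * B + 1) (\<lambda>u. nreg u (d + 3) = ?x * ?y \<and> (\<forall>d'. same d d' s u))"
      if "?P 0 u" for u
      by (rule achieves_Loop[where P = ?P and n = ?y and T = 5])
         (use that NTimes.prems in \<open>auto simp: same_def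
            intro!: achieves_Seq[where ?T1.0 = 1 and ?T2.0 = 3] achieves_nincr achieves_Instr\<close>)
    show "achieves (Seq (Instr (NConst (d + 2) 0)) (Seq (Instr (NConst (d + 3) 0)) (Seq ?L
       (nmove d (d + 3))))) t (7 * B + 11) (\<lambda>t. nreg t d = neval (NTimes a b) s \<and> (\<forall>d'. same d d' s t))"
      apply (rule achieves_Seq[where ?T1.0 = 1 and ?T2.0 = "7 * B + 9"], rule achieves_Instr)
        apply (rule achieves_Seq[where ?T1.0 = 1 and ?T2.0 = "7 * B + 7"], rule achieves_Instr)
          apply (rule achieves_Seq[where ?T1.0 = "7 * B + 1" and ?T2.0 = "3"])
           apply (rule achieves_mono[OF loop])
      using t by (auto simp: same_def intro!: achieves_nmove)
  qed (use NTimes.prems in auto)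
next
  case (NDiv a b)
  let ?x = "neval a s" and ?y = "neval b s"
  show ?case unfolding computes_def ncomp.simps
  proof (rule computes_pair[where ?T3.0 = "7 * B + 11" and x' = ?y, OF NDiv.IH(1)])
    fix t assume "same temp temp s t"
    with NDiv.prems show "computes (d + 1) (ncomp (d + 1) b) t (ntime B b) ?y"
      using NDiv.IH(2)[of t "d + 1"] by (simp add: nok_same neval_same)
  next
    fix t assume t: "nreg t d = ?x" "nreg t (d + 1) = ?y" "\<And>d'. same d d' s t"
    let ?P = "\<lambda>j u. nreg u (d + 2) = j \<and> nreg u d = ?x - j * ?y \<and>
      nreg u (d + 1) = ?y \<and> (\<forall>d'. same d d' s u)"
    let ?L = "Loop (NLe (d + 1) d) (Seq (Instr (NSub d d (d + 1))) (nincr (d + 2) (d + 4)))"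
    have y: "0 < ?y" "?x \<le> B" using NDiv.prems by auto
    have "?x div ?y \<le> B" using y(2) div_le_dividend le_trans by blast
    \<comment> \<open>Subtraction on naturals truncates, so it has to be excluded that the loop test
      fails before the quotient is reached.\<close>
    have le: "?y \<le> ?x - j * ?y" if "j < ?x div ?y" for j
    proof -
      have "(j + 1) * ?y \<le> ?x div ?y * ?y" using that by (intro mult_right_mono) auto
      also have "\<dots> \<le> ?x" by simp
      finally show ?thesis by simp
    qed
    have gt: "?x - ?x div ?y * ?y < ?y"
      using y by (simp add: minus_div_mult_eq_mod)
    have loop: "achieves ?L u (7 * B + 1) (\<lambda>u. nreg u (d + 2) = ?x div ?y \<and> (\<forall>d'. same d d' s u))"
      if "?P 0 u" for u
      by (rule achieves_Loop[where P = ?P and n = "?x div ?y" and T = 5])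
         (use that NDiv.prems gt \<open>?x div ?y \<le> B\<close> in \<open>auto simp: same_def dest!: le
            intro!: achieves_Seq[where ?T1.0 = 1 and ?T2.0 = 3] achieves_nincr achieves_Instr\<close>)
    show "achieves (Seq (Instr (NConst (d + 2) 0)) (Seq ?L
       (nmove d (d + 2)))) t (7 * B + 11) (\<lambda>t. nreg t d = neval (NDiv a b) s \<and> (\<forall>d'. same d d' s t))"
      apply (rule achieves_Seq[where ?T1.0 = 1 and ?T2.0 = "7 * B + 9"], rule achieves_Instr)
        apply (rule achieves_Seq[where ?T1.0 = "7 * B + 1" and ?T2.0 = "3"])
         apply (rule achieves_mono[OF loop])
      using t by (auto simp: same_def intro!: achieves_nmove)
  qed (use NDiv.prems in auto)
next
  case (NGet x a)
  show ?case unfolding computes_def ncomp.simps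
  proof (rule achieves_Seq[where ?T2.0 = 1, OF achieves_mono[OF NGet.IH[unfolded computes_def]]])
    show "achieves (Instr (NLoad d x d)) t 1
        (\<lambda>t. nreg t d = neval (NGet x a) s \<and> (\<forall>d'. same d d' s t))"
      if "nreg t d = neval a s \<and> (\<forall>d'. same d d' s t)" for t
      using that by (auto simp: same_def intro!: achieves_Instr)
  qed (use NGet.prems in auto)
qed

definition rcomputes :: "nat \<Rightarrow> nat \<Rightarrow> program \<Rightarrow> machine_state \<Rightarrow> nat \<Rightarrow> real \<Rightarrow> bool" where
  "rcomputes n d p s T x \<longleftrightarrow> achieves p s T (\<lambda>t. rreg t d = x \<and> same n d s t)"

lemma rcomputes_pair:
  assumes "rcomputes n d p s T1 x"
    and "\<And>t. same temp temp s t \<Longrightarrow> rcomputes n (d + 1) p' t T2 x'"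
    and "\<And>t. rreg t d = x \<Longrightarrow> rreg t (d + 1) = x' \<Longrightarrow> same n d s t \<Longrightarrow> achieves q t T3 Q"
    and "temp \<le> n" "temp \<le> d" "T1 + T2 + T3 + 2 \<le> T"
  shows "achieves (Seq p (Seq p' q)) s T Q"
proof (rule achieves_Seq)
  show "T1 + (T2 + T3 + 1) + 1 \<le> T" using assms(6) by simp
  show "achieves p s T1 (\<lambda>t. achieves (Seq p' q) t (T2 + T3 + 1) Q)"
    using assms(1) unfolding rcomputes_def
  proof (rule achieves_mono[OF _ order.refl], elim conjE)
    fix t assume t: "rreg t d = x" "same n d s t"
    then have "same temp temp s t" using assms(4,5) by (auto intro: same_mono)
    from assms(2)[OF this] show "achieves (Seq p' q) t (T2 + T3 + 1) Q"
      unfolding rcomputes_def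
    proof (intro achieves_Seq[OF _ order.refl], elim achieves_mono[OF _ order.refl], elim conjE)
      fix u assume u: "rreg u (d + 1) = x'" "same n (d + 1) t u"
      show "achieves q u T3 Q"
      proof (rule assms(3))
        show "rreg u d = x" using t(1) u(2) by (auto simp: same_def)
        show "rreg u (d + 1) = x'" by fact
        show "same n d s u" using t(2) u(2) by (metis same_trans le_add1 order.refl)
      qed
    qed
  qed
qed

lemma exec_rop_instr: "exec (rop_instr f i j l) s = set_rreg i (rop_eval f (rreg s j) (rreg s l)) s"
  by (cases f) simp_all

lemma rcomp_correct:
  assumes "rwf e" "rok B e s" "temp \<le> n" "temp \<le> d"
  shows "rcomputes n d (rcomp n d e) s (rtime B e) (reval e s)"
  using assms
proof (induction e arbitrary: d s)
  case (RC c)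
  then show ?case by (auto simp: rcomputes_def same_def intro!: achieves_Instr)
next
  case (RV i)
  then show ?case by (auto simp: rcomputes_def same_def intro!: achieves_rmove)
next
  case (RBin f a b)
  show ?case unfolding rcomputes_def rcomp.simps
  proof (rule rcomputes_pair[where ?T3.0 = 1 and x' = "reval b s", OF RBin.IH(1)])
    fix t assume "same temp temp s t"
    with RBin.prems show "rcomputes n (d + 1) (rcomp n (d + 1) b) t (rtime B b) (reval b s)"
      using RBin.IH(2)[of t "d + 1"] by (simp add: rok_same reval_same)
  qed (use RBin.prems in \<open>auto simp: exec_rop_instr same_def intro!: achieves_Instr\<close>)
next
  case (RMin a b)
  show ?case unfolding rcomputes_def rcomp.simps
  proof (rule rcomputes_pair[where ?T3.0 = 4 and x' = "reval b s", OF RMin.IH(1)])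
    fix t assume "same temp temp s t"
    with RMin.prems show "rcomputes n (d + 1) (rcomp n (d + 1) b) t (rtime B b) (reval b s)"
      using RMin.IH(2)[of t "d + 1"] by (simp add: rok_same reval_same)
  qed (use RMin.prems in \<open>auto simp: same_def intro!: achieves_Branch[where ?T1.0 = 3] achieves_rmove achieves_Skip\<close>)
next
  case (ROf a)
  show ?case unfolding rcomputes_def rcomp.simps
  proof (rule achieves_Seq[where ?T2.0 = 1, OF achieves_mono[OF ncomp_correct[unfolded computes_def]]])
    show "achieves (Instr (RNat d n)) t 1
        (\<lambda>t. rreg t d = reval (ROf a) s \<and> same n d s t)"
      if "nreg t n = neval a s \<and> (\<forall>d'. same n d' s t)" for t
      using that by (auto simp: same_def intro!: achieves_Instr)
  qed (use ROf.prems in auto)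
next
  case (RGet x a)
  show ?case unfolding rcomputes_def rcomp.simps
  proof (rule achieves_Seq[where ?T2.0 = 1, OF achieves_mono[OF ncomp_correct[unfolded computes_def]]])
    show "achieves (Instr (RLoad d x n)) t 1
        (\<lambda>t. rreg t d = reval (RGet x a) s \<and> same n d s t)"
      if "nreg t n = neval a s \<and> (\<forall>d'. same n d' s t)" for t
      using that by (auto simp: same_def intro!: achieves_Instr)
  qed (use RGet.prems in auto)
qed

lemma bcomp_correct:
  assumes "bwf e" "bok B e s" "temp \<le> n"
  shows "achieves (bcomp n e) s (btime B e) (\<lambda>t. holds (btest n e) t = beval e s \<and> same n temp s t)"
proof -
  have nn: "achieves (Seq (ncomp n a) (ncomp (n + 1) b)) s (ntime B a + ntime B b + 1)
     (\<lambda>t. nreg t n = neval a s \<and> nreg t (n + 1) = neval b s \<and> same n temp s t)"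
    if ab: "nwf a" "nwf b" "nok B a s" "nok B b s" for a b
  proof (rule achieves_Seq[OF achieves_mono[OF ncomp_correct[unfolded computes_def]]])
    fix t assume t: "nreg t n = neval a s \<and> (\<forall>d'. same n d' s t)"
    then have st: "same temp temp s t" using assms(3) by (auto intro: same_mono)
    show "achieves (ncomp (n + 1) b) t (ntime B b)
       (\<lambda>t. nreg t n = neval a s \<and> nreg t (n + 1) = neval b s \<and> same n temp s t)"
      by (rule achieves_mono[OF ncomp_correct[unfolded computes_def]])
         (use t st ab assms(3) in \<open>auto simp: neval_same nok_same, auto simp: same_def\<close>)
  qed (use that assms(3) in auto)
  have rr: "achieves (Seq (rcomp n temp a) (rcomp n (temp + 1) b)) s (rtime B a + rtime B b + 1)
     (\<lambda>t. rreg t temp = reval a s \<and> rreg t (temp + 1) = reval b s \<and> same n temp s t)"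
    if ab: "rwf a" "rwf b" "rok B a s" "rok B b s" for a b
  proof (rule achieves_Seq[OF achieves_mono[OF rcomp_correct[unfolded rcomputes_def]]])
    fix t assume t: "rreg t temp = reval a s \<and> same n temp s t"
    then have st: "same temp temp s t" using assms(3) by (auto intro: same_mono)
    show "achieves (rcomp n (temp + 1) b) t (rtime B b)
       (\<lambda>t. rreg t temp = reval a s \<and> rreg t (temp + 1) = reval b s \<and> same n temp s t)"
      by (rule achieves_mono[OF rcomp_correct[unfolded rcomputes_def]])
         (use t st ab assms(3) in \<open>auto simp: reval_same rok_same, auto simp: same_def\<close>)
  qed (use that assms(3) in auto)
  show ?thesis
    using assms(1,2) by (cases e) (auto intro!: achieves_mono[OF nn[simplified]] achieves_mono[OF rr[simplified]])
qed

text \<open>A simulation in which the abstract state \<open>s\<close> and the machine state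
  \<open>t\<close> agree below \<open>temp\<close>. The second part of the postcondition protects
  the bounds and counters of enclosing loops, which live between \<open>temp\<close> and
  \<open>n\<close>.\<close>

lemma compile_correct:
  assumes "wf_cmd c" "ok B c s" "same temp temp s t" "temp \<le> n"
  shows "achieves (compile n c) t (ctime B c)
    (\<lambda>t'. same temp temp (sem c s) t' \<and> (\<forall>i. temp \<le> i \<and> i < n \<longrightarrow> nreg t' i = nreg t i))"
  using assms
proof (induction c arbitrary: n s t)
  case NOP
  then show ?case by (auto intro: achieves_Skip)
next
  case (NSet i e)
  have e: "computes n (ncomp n e) t (ntime B e) (neval e s)"
    using NSet.prems ncomp_correct[of e B t n] by (simp add: nok_same neval_same)
  show ?case unfolding compile.simps
  proof (rule achieves_Seq[where ?T2.0 = 3, OF achieves_mono[OF e[unfolded computes_def] order.refl]], elim conjE)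
    fix u assume u1: "nreg u n = neval e s" "\<forall>d'. same n d' t u"
    have "same n temp t u" using u1 by auto
    with u1(1) NSet.prems show "achieves (nmove i n) u 3 (\<lambda>t'. same temp temp (sem (NSet i e) s) t' \<and>
        (\<forall>i. temp \<le> i \<and> i < n \<longrightarrow> nreg t' i = nreg t i))"
      by (auto simp: same_def intro!: achieves_nmove)
  qed simp
next
  case (RSet i e)
  have e: "rcomputes n temp (rcomp n temp e) t (rtime B e) (reval e s)"
    using RSet.prems rcomp_correct[of e B t n temp] by (simp add: rok_same reval_same)
  show ?case unfolding compile.simps
    by (rule achieves_Seq[where ?T2.0 = 3, OF achieves_mono[OF e[unfolded rcomputes_def] order.refl]])
       (use RSet.prems in \<open>auto simp: same_def intro!: achieves_rmove\<close>)
next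
  case (NPut a i e)
  show ?case unfolding compile.simps
  proof (rule computes_pair[where ?T3.0 = 1 and x = "neval i s" and x' = "neval e s"])
    show "computes n (ncomp n i) t (ntime B i) (neval i s)"
      using NPut.prems ncomp_correct[of i B t n] by (simp add: nok_same neval_same)
    show "computes (n + 1) (ncomp (n + 1) e) u (ntime B e) (neval e s)" if "same temp temp t u" for u
      using NPut.prems ncomp_correct[of e B u "n + 1"] that by (simp add: nok_same neval_same)
  next
    fix u assume "nreg u n = neval i s" "nreg u (n + 1) = neval e s" and u: "\<And>d'. same n d' t u"
    with u[of temp] NPut.prems show "achieves (Instr (NStore a n (n + 1))) u 1 (\<lambda>t'. same temp temp (sem (NPut a i e) s) t' \<and>
        (\<forall>i. temp \<le> i \<and> i < n \<longrightarrow> nreg t' i = nreg t i))"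
      by (auto simp: same_def intro!: achieves_Instr)
  qed (use NPut.prems in auto)
next
  case (RPut a i e)
  have i: "computes n (ncomp n i) t (ntime B i) (neval i s)"
    using RPut.prems ncomp_correct[of i B t n] by (simp add: nok_same neval_same)
  show ?case unfolding compile.simps
  proof (rule achieves_Seq[OF achieves_mono[OF i[unfolded computes_def] order.refl]], elim conjE)
    fix u assume u1: "nreg u n = neval i s" "\<forall>d'. same n d' t u"
    have u2: "same n temp t u" using u1 by auto
    have u3: "same temp temp s u" using u2 RPut.prems by (auto simp: same_def)
    have u4: "rcomputes (n + 1) temp (rcomp (n + 1) temp e) u (rtime B e) (reval e s)"
      using RPut.prems rcomp_correct[of e B u "n + 1" temp] u3 by (simp add: rok_same reval_same)
    show "achieves (Seq (rcomp (n + 1) temp e) (Instr (RStore a n temp))) u (rtime B e + 1 + 1)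
      (\<lambda>t'. same temp temp (sem (RPut a i e) s) t' \<and>
        (\<forall>i. temp \<le> i \<and> i < n \<longrightarrow> nreg t' i = nreg t i))"
      by (rule achieves_Seq[OF achieves_mono[OF u4[unfolded rcomputes_def] order.refl] order.refl])
         (use u1(1) u2 RPut.prems in \<open>auto simp: same_def intro!: achieves_Instr\<close>)
  qed simp
next
  case (SEQ c d)
  show ?case unfolding compile.simps
    by (rule achieves_Seq[OF achieves_mono[OF SEQ.IH(1) order.refl achieves_mono[OF SEQ.IH(2)]]])
       (use SEQ.prems in auto)
next
  case (IF b c d)
  have b: "bok B b t" "bwf b" "beval b t = beval b s" "temp \<le> n" "wf_cmd c" "wf_cmd d"
    using IF.prems by (auto simp: bok_same beval_same)
  show ?case unfolding compile.simps
  proof (rule achieves_Seq[OF achieves_mono[OF bcomp_correct[OF b(2,1,4)] order.refl]], elim conjE)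
    fix u assume u: "holds (btest n b) u = beval b t" "same n temp t u"
    then have u': "same temp temp s u" using IF.prems by (auto simp: same_def)
    show "achieves (Branch (btest n b) (compile n c) (compile n d)) u (ctime B c + ctime B d + 1)
       (\<lambda>t'. same temp temp (sem (IF b c d) s) t' \<and> (\<forall>i. temp \<le> i \<and> i < n \<longrightarrow> nreg t' i = nreg t i))"
      by (rule achieves_Branch[OF _ order.refl], cases "beval b s")
         (use IF.prems u b in \<open>auto simp: same_def
           intro!: achieves_mono[OF IF.IH(1)[OF b(5) _ u' b(4)]] achieves_mono[OF IF.IH(2)[OF b(6) _ u' b(4)]]\<close>)
  qed simp
next
  case (FOR i e c)
  define N where "N = neval e s"
  define \<sigma> where "\<sigma> j = fold (\<lambda>j s. sem c (set_nreg i j s)) [0..<j] s" for j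
  have e: "computes n (ncomp n e) t (ntime B e) N"
    using FOR.prems ncomp_correct[of e B t n] by (simp add: nok_same neval_same N_def)
  have ok: "N \<le> B" "\<And>j. j < N \<Longrightarrow> ok B c (set_nreg i j (\<sigma> j))" "wf_cmd c" "i < temp" "temp \<le> n"
    using FOR.prems by (auto simp: N_def \<sigma>_def)
  have \<sigma>_Suc: "\<sigma> (Suc j) = sem c (set_nreg i j (\<sigma> j))" for j
    by (simp add: \<sigma>_def)
  let ?P = "\<lambda>j u. same temp temp (\<sigma> j) u \<and> nreg u n = N \<and> nreg u (n + 1) = j \<and>
    (\<forall>i. temp \<le> i \<and> i < n \<longrightarrow> nreg u i = nreg t i)"
  let ?body = "Seq (nmove i (n + 1)) (Seq (compile (n + 2) c) (nincr (n + 1) (n + 2)))"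
  have body: "achieves ?body u (ctime B c + 8) (?P (Suc j))" if j: "j < N" "?P j u" for j u
  proof (rule achieves_Seq[where ?T1.0 = 3, OF achieves_nmove])
    let ?u = "set_nreg i (nreg u (n + 1)) u"
    have same: "same temp temp (set_nreg i j (\<sigma> j)) ?u" using j by (auto simp: same_def)
    show "achieves (Seq (compile (n + 2) c) (nincr (n + 1) (n + 2))) ?u (ctime B c + 3 + 1) (?P (Suc j))"
    proof (rule achieves_Seq[OF achieves_mono[OF FOR.IH[OF ok(3) ok(2)[OF j(1)] same]]])
      fix u' assume "same temp temp (sem c (set_nreg i j (\<sigma> j))) u' \<and>
         (\<forall>ia. temp \<le> ia \<and> ia < n + 2 \<longrightarrow> nreg u' ia = nreg ?u ia)"
      then show "achieves (nincr (n + 1) (n + 2)) u' 3 (?P (Suc j))"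
        using j(2) ok by (intro achieves_nincr) (auto simp: \<sigma>_Suc same_def)
    qed (use ok in auto)
  qed (use ok in auto)
  have loop: "achieves (Loop (NLess (n + 1) n) ?body) u (B * (ctime B c + 10) + 1) (?P N)" if "?P 0 u" for u
    by (rule achieves_Loop[where P = ?P and n = N and T = "ctime B c + 8"])
       (use that body ok(1) in \<open>auto intro!: mult_le_mono\<close>)
  show ?case unfolding compile.simps
  proof (rule achieves_Seq[OF achieves_mono[OF e[unfolded computes_def] order.refl]], elim conjE)
    fix u assume u1: "nreg u n = N" and u2: "\<forall>d'. same n d' t u"
    have u3: "same n temp t u" using u2 by auto
    have u4: "?P 0 (exec (NConst (n + 1) 0) u)" using u1 u3 FOR.prems by (auto simp: \<sigma>_def same_def)
    have "achieves (Seq (Instr (NConst (n + 1) 0)) (Loop (NLess (n + 1) n) ?body)) u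
        (1 + (B * (ctime B c + 10) + 1) + 1) (?P N)"
      by (rule achieves_Seq[OF _ order.refl], rule achieves_Instr, rule loop[OF u4]) simp
    then show "achieves (Seq (Instr (NConst (n + 1) 0)) (Loop (NLess (n + 1) n) ?body)) u
        (B * (ctime B c + 10) + 3)
        (\<lambda>t'. same temp temp (sem (FOR i e c) s) t' \<and> (\<forall>i. temp \<le> i \<and> i < n \<longrightarrow> nreg t' i = nreg t i))"
      by (rule achieves_mono) (auto simp: \<sigma>_def N_def)
  qed simp
qed

section \<open>Running time as a polynomial in the common loop bound\<close>

definition poly_bounded :: "(nat \<Rightarrow> nat) \<Rightarrow> bool" where
  "poly_bounded f \<longleftrightarrow> (\<exists>K d. \<forall>B\<ge>1. f B \<le> K * B ^ d)"

lemma poly_bounded_add: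
  assumes "poly_bounded f" "poly_bounded g"
  shows "poly_bounded (\<lambda>B. f B + g B)"
proof -
  obtain K d K' d' where 1: "\<And>B. B \<ge> 1 \<Longrightarrow> f B \<le> K * B ^ d" "\<And>B. B \<ge> 1 \<Longrightarrow> g B \<le> K' * B ^ d'"
    using assms unfolding poly_bounded_def by blast
  have "f B + g B \<le> (K + K') * B ^ (d + d')" if "B \<ge> 1" for B
  proof -
    have "K * B ^ d \<le> K * B ^ (d + d')" "K' * B ^ d' \<le> K' * B ^ (d + d')"
      using that by (intro mult_left_mono power_increasing; simp)+
    with 1[OF that] show ?thesis unfolding distrib_right by linarith
  qed
  then show ?thesis unfolding poly_bounded_def by blast
qed

lemma poly_bounded_times:
  assumes "poly_bounded f"
  shows "poly_bounded (\<lambda>B. B * f B)"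
proof -
  obtain K d where 1: "\<And>B. B \<ge> 1 \<Longrightarrow> f B \<le> K * B ^ d" using assms unfolding poly_bounded_def by blast
  have "B * f B \<le> K * B ^ Suc d" if "B \<ge> 1" for B
    using mult_left_mono[OF 1[OF that], of B] by (simp add: algebra_simps)
  then show ?thesis unfolding poly_bounded_def by blast
qed

lemma poly_bounded_const: "poly_bounded (\<lambda>B. c)"
  unfolding poly_bounded_def by (rule exI[of _ c], rule exI[of _ 0]) simp

lemma poly_bounded_linear: "poly_bounded (\<lambda>B. c * B)"
  unfolding poly_bounded_def by (rule exI[of _ c], rule exI[of _ 1]) simp

lemma poly_bounded_Suc: "poly_bounded f \<Longrightarrow> poly_bounded (\<lambda>B. Suc (f B))"
  using poly_bounded_add[OF _ poly_bounded_const[of 1]] by simp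

lemmas poly_bounded_intros = poly_bounded_const poly_bounded_linear poly_bounded_Suc
  poly_bounded_times poly_bounded_add

text \<open>Each nested loop contributes one factor \<open>B\<close>, and the nesting depth of a
  fixed command is fixed.\<close>

lemma ctime_poly: "poly_bounded (\<lambda>B. ctime B c)"
proof -
  have n: "poly_bounded (\<lambda>B. ntime B e)" for e
    by (induction e) (simp_all add: poly_bounded_intros)
  have r: "poly_bounded (\<lambda>B. rtime B e)" for e
    by (induction e) (simp_all add: poly_bounded_intros n)
  have b: "poly_bounded (\<lambda>B. btime B e)" for e
    by (cases e) (simp_all add: poly_bounded_intros n r)
  show ?thesis
    by (induction c) (simp_all add: poly_bounded_intros n r b)
qed


section \<open>Reasoning about structured programs\<close>

datatype loc = NReg nat | RReg nat | NArr nat | RArr nat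

primrec written :: "cmd \<Rightarrow> loc set" where
  "written NOP = {}"
| "written (NSet i e) = {NReg i}"
| "written (RSet i e) = {RReg i}"
| "written (NPut a i e) = {NArr a}"
| "written (RPut a i e) = {RArr a}"
| "written (c ;; d) = written c \<union> written d"
| "written (IF b c d) = written c \<union> written d"
| "written (FOR i e c) = insert (NReg i) (written c)"

definition frame :: "cmd \<Rightarrow> machine_state \<Rightarrow> machine_state \<Rightarrow> bool" where
  "frame c s t \<longleftrightarrow>
     (\<forall>i. NReg i \<notin> written c \<longrightarrow> nreg t i = nreg s i) \<and>
     (\<forall>i. RReg i \<notin> written c \<longrightarrow> rreg t i = rreg s i) \<and>
     (\<forall>i. NArr i \<notin> written c \<longrightarrow> narr t i = narr s i) \<and>
     (\<forall>i. RArr i \<notin> written c \<longrightarrow> rarr t i = rarr s i)"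

lemma frame_simps:
  "frame c s t \<Longrightarrow> NReg i \<notin> written c \<Longrightarrow> nreg t i = nreg s i"
  "frame c s t \<Longrightarrow> RReg i \<notin> written c \<Longrightarrow> rreg t i = rreg s i"
  "frame c s t \<Longrightarrow> NArr i \<notin> written c \<Longrightarrow> narr t i = narr s i"
  "frame c s t \<Longrightarrow> RArr i \<notin> written c \<Longrightarrow> rarr t i = rarr s i"
  by (auto simp: frame_def)

lemma frame_sem: "frame c s (sem c s)"
proof (induction c arbitrary: s)
  case (FOR i e c)
  have "frame (FOR i e c) s (fold (\<lambda>j s. sem c (set_nreg i j s)) [0..<n] s)" for n
  proof (induction n)
    case (Suc n)
    let ?t = "fold (\<lambda>j s. sem c (set_nreg i j s)) [0..<n] s"
    from Suc.IH FOR.IH[of "set_nreg i n ?t"] show ?case by (simp add: frame_def)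
  qed (simp add: frame_def)
  then show ?case by simp
qed (auto simp: frame_def)

text \<open>The body may assume that whatever the loop does not write still has its initial value,
  so invariants need to mention only what changes.\<close>

lemma for_rule:
  assumes "nok B e s" "neval e s = n" "n \<le> B" "I 0 s"
    and "\<And>j t. j < n \<Longrightarrow> I j t \<Longrightarrow> frame (FOR i e c) s t \<Longrightarrow>
      ok B c (set_nreg i j t) \<and> I (Suc j) (sem c (set_nreg i j t))"
  shows "ok B (FOR i e c) s \<and> I n (sem (FOR i e c) s)"
proof -
  define \<sigma> where "\<sigma> j = fold (\<lambda>j s. sem c (set_nreg i j s)) [0..<j] s" for j
  have \<sigma>_Suc: "\<sigma> (Suc j) = sem c (set_nreg i j (\<sigma> j))" for j
    by (simp add: \<sigma>_def)
  have fr: "frame (FOR i e c) s (\<sigma> j)" for j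
  proof (induction j)
    case (Suc j)
    from Suc frame_sem[of c "set_nreg i j (\<sigma> j)"] show ?case by (simp add: frame_def \<sigma>_Suc)
  qed (simp add: \<sigma>_def frame_def)
  have I: "I j (\<sigma> j)" if "j \<le> n" for j
    using that
  proof (induction j)
    case (Suc j)
    with assms(5)[OF _ _ fr, of j] show ?case by (simp add: \<sigma>_Suc)
  qed (simp add: \<sigma>_def assms)
  have "ok B c (set_nreg i j (\<sigma> j))" if "j < n" for j
    using assms(5)[OF that I fr] that by simp
  with I[of n] assms show ?thesis by (simp add: \<sigma>_def)
qed


section \<open>Mixed radix digits\<close>

text \<open>With \<open>dig\<close>, this decodes a number whose base varies with the position,
  least significant digit first. A single counter can thus enumerate all guesses of durations (bases
  \<open>radix r m i\<close>) or all colour vectors (constant base \<open>r\<close>).\<close>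

primrec quo :: "(nat \<Rightarrow> nat) \<Rightarrow> nat \<Rightarrow> nat \<Rightarrow> nat" where
  "quo rad x 0 = x"
| "quo rad x (Suc i) = quo rad x i div rad i"

definition dig :: "(nat \<Rightarrow> nat) \<Rightarrow> nat \<Rightarrow> nat \<Rightarrow> nat" where
  "dig rad x i = quo rad x i mod rad i"

lemma quo_le: "quo rad x i \<le> x"
  by (induction i) (auto intro: le_trans[OF div_le_dividend])

lemma quo_shift: "quo rad x (Suc i) = quo (\<lambda>i. rad (Suc i)) (x div rad 0) i"
  by (induction i) auto

lemma dig_shift: "dig rad x (Suc i) = dig (\<lambda>i. rad (Suc i)) (x div rad 0) i"
  unfolding dig_def quo_shift ..

lemma dig_less: "0 < rad i \<Longrightarrow> dig rad x i < rad i"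
  by (simp add: dig_def)

lemma digits_exist:
  assumes "\<And>i. i < m \<Longrightarrow> v i < rad i"
  shows "\<exists>x<\<Prod>i<m. rad i. \<forall>i<m. dig rad x i = v i"
  using assms
proof (induction m arbitrary: v rad)
  case (Suc m)
  obtain x where x: "x < (\<Prod>i<m. rad (Suc i))" "\<And>i. i < m \<Longrightarrow> dig (\<lambda>i. rad (Suc i)) x i = v (Suc i)"
    using Suc.IH[of "\<lambda>i. v (Suc i)" "\<lambda>i. rad (Suc i)"] Suc.prems by auto
  have v0: "v 0 < rad 0" using Suc.prems by auto
  let ?x = "v 0 + rad 0 * x"
  have "?x < rad 0 * Suc x" using v0 by simp
  also have "\<dots> \<le> rad 0 * (\<Prod>i<m. rad (Suc i))" using x(1) by (intro mult_left_mono) auto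
  also have "\<dots> = (\<Prod>i<Suc m. rad i)" by (simp only: prod.lessThan_Suc_shift)
  finally have "?x < (\<Prod>i<Suc m. rad i)" .
  moreover have "dig rad ?x i = v i" if "i < Suc m" for i
  proof (cases i)
    case 0
    then show ?thesis using v0 by (simp add: dig_def)
  next
    case (Suc j)
    then show ?thesis using v0 x(2) that by (simp add: dig_shift)
  qed
  ultimately show ?case by blast
qed simp

lemma digits_unique:
  assumes "x < (\<Prod>i<m. rad i)" "y < (\<Prod>i<m. rad i)" "\<And>i. i < m \<Longrightarrow> dig rad x i = dig rad y i"
  shows "x = y"
  using assms
proof (induction m arbitrary: x y rad)
  case (Suc m)
  have 0: "x mod rad 0 = y mod rad 0" using Suc.prems(3)[of 0] by (simp add: dig_def)
  have "x div rad 0 < (\<Prod>i<m. rad (Suc i))" "y div rad 0 < (\<Prod>i<m. rad (Suc i))"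
    using Suc.prems(1,2) by (simp_all add: prod.lessThan_Suc_shift less_mult_imp_div_less mult.commute del: prod.lessThan_Suc)
  then have "x div rad 0 = y div rad 0"
    using Suc.IH[of _ "\<lambda>i. rad (Suc i)"] Suc.prems(3)[of "Suc _"] by (simp add: dig_shift)
  with 0 show ?case by (metis mult_div_mod_eq)
qed simp

definition digit_vectors :: "nat \<Rightarrow> nat \<Rightarrow> (nat \<Rightarrow> nat) set" where
  "digit_vectors C m = PiE {..<m} (\<lambda>_. {..<C})"

lemma finite_digit_vectors: "finite (digit_vectors C m)"
  unfolding digit_vectors_def by (intro finite_PiE) auto

lemma card_digit_vectors: "card (digit_vectors C m) = C ^ m"
  unfolding digit_vectors_def by (simp add: card_PiE)

text \<open>Decoding is a bijection onto the vectors of length \<open>m\<close>. The second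
  assumption is needed because \<open>dig\<close> is a total function and has to be cut off at
  \<open>m\<close> to be such a vector.\<close>

lemma sum_digits:
  assumes "0 < C" "\<And>v v'. (\<And>i. i < m \<Longrightarrow> v i = v' i) \<Longrightarrow> h v = h v'"
  shows "(\<Sum>x<C ^ m. h (dig (\<lambda>_. C) x)) = (\<Sum>v\<in>digit_vectors C m. h v)"
proof -
  have "(\<Sum>x<C ^ m. h (dig (\<lambda>_. C) x)) = (\<Sum>x<C ^ m. h (restrict (dig (\<lambda>_. C) x) {..<m}))"
    by (intro sum.cong refl assms(2)) auto
  moreover have 1: "inj_on (\<lambda>x. restrict (dig (\<lambda>_. C) x) {..<m}) {..<C ^ m}"
  proof (rule inj_onI)
    fix x y assume xy: "x \<in> {..<C ^ m}" "y \<in> {..<C ^ m}"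
      "restrict (dig (\<lambda>_. C) x) {..<m} = restrict (dig (\<lambda>_. C) y) {..<m}"
    show "x = y"
      by (rule digits_unique[where m = m and rad = "\<lambda>_. C"]) (use xy in \<open>auto simp: restrict_def fun_eq_iff, metis\<close>)
  qed
  have 2: "(\<lambda>x. restrict (dig (\<lambda>_. C) x) {..<m}) ` {..<C ^ m} = digit_vectors C m"
  proof safe
    show "restrict (dig (\<lambda>_. C) x) {..<m} \<in> digit_vectors C m" for x
      using assms(1) dig_less[of "\<lambda>_. C"] by (auto simp: digit_vectors_def)
    fix v assume v: "v \<in> digit_vectors C m"
    then obtain x where "x < C ^ m" "\<And>i. i < m \<Longrightarrow> dig (\<lambda>_. C) x i = v i"
      using digits_exist[of m v "\<lambda>_. C"] by (auto simp: digit_vectors_def)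
    with v show "v \<in> (\<lambda>x. restrict (dig (\<lambda>_. C) x) {..<m}) ` {..<C ^ m}"
      by (intro image_eqI[of _ _ x]) (auto simp: digit_vectors_def fun_eq_iff PiE_def extensional_def)
  qed
  ultimately show ?thesis
    using sum.reindex_bij_betw[OF bij_betw_imageI[OF 1 2], of h] by simp
qed

text \<open>If \<open>h\<close> ignores coordinate \<open>i\<close>, all \<open>C\<close> slices of
  the sum have the same value.\<close>

lemma sum_digit_vectors_fixed:
  assumes "i < m" "c < C" "\<And>v x. h (v(i := x)) = h v"
  shows "real C * (\<Sum>v\<in>{v\<in>digit_vectors C m. v i = c}. h v) = (\<Sum>v\<in>digit_vectors C m. h v)"
proof -
  have "(\<Sum>v\<in>digit_vectors C m. h v) = (\<Sum>c'<C. \<Sum>v\<in>{v\<in>digit_vectors C m. v i = c'}. h v)"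
    using assms(1) by (intro sum.group[symmetric]) (auto simp: digit_vectors_def finite_PiE)
  also have "\<dots> = (\<Sum>c'<C. \<Sum>v\<in>{v\<in>digit_vectors C m. v i = c}. h v)"
  proof (rule sum.cong[OF refl])
    fix c' assume c': "c' \<in> {..<C}"
    show "(\<Sum>v\<in>{v\<in>digit_vectors C m. v i = c'}. h v) = (\<Sum>v\<in>{v\<in>digit_vectors C m. v i = c}. h v)"
      by (rule sum.reindex_bij_witness[where i = "\<lambda>v. v(i := c')" and j = "\<lambda>v. v(i := c)"])
         (use assms c' in \<open>auto simp: digit_vectors_def PiE_def Pi_def extensional_def\<close>)
  qed
  finally show ?thesis by simp
qed


section \<open>Tabular greedy\<close>

text \<open>Diminishing returns of a truncated load; submodularity of the schedule value enters in
  this form.\<close>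

lemma min_increment_antimono:
  "0 \<le> a \<Longrightarrow> x \<le> y \<Longrightarrow> min D (a + y) - min D y \<le> min D (a + x) - min D (x::real)"
  by linarith

lemma min_increment_sum:
  assumes "finite S" "\<And>i. i \<in> S \<Longrightarrow> 0 \<le> a i"
  shows "min D (sum a S + x) - min D x \<le> (\<Sum>i\<in>S. min D (a i + x) - min D (x::real))"
  using assms
proof (induction S)
  case (insert i S)
  have "min D (a i + (sum a S + x)) - min D (sum a S + x) \<le> min D (a i + x) - min D x"
    using insert.prems by (intro min_increment_antimono) (auto intro!: sum_nonneg)
  with insert show ?case by (auto simp: add.assoc)
qed simp

locale tabular =
  fixes m C :: nat and E :: "'e set" and D :: "'e \<Rightarrow> real" and \<alpha> :: "nat \<Rightarrow> real"
  assumes C_pos: "0 < C" and fin: "finite E"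
    and D_nonneg: "\<And>e. e \<in> E \<Longrightarrow> 0 \<le> D e" and \<alpha>_nonneg: "\<And>i. i < m \<Longrightarrow> 0 \<le> \<alpha> i"
begin

definition load :: "(nat \<Rightarrow> nat \<Rightarrow> 'e \<Rightarrow> bool) \<Rightarrow> (nat \<Rightarrow> nat) \<Rightarrow> 'e \<Rightarrow> real" where
  "load X v e = (\<Sum>i<m. if X i (v i) e then \<alpha> i else 0)"

definition load_others :: "(nat \<Rightarrow> nat \<Rightarrow> 'e \<Rightarrow> bool) \<Rightarrow> nat \<Rightarrow> (nat \<Rightarrow> nat) \<Rightarrow> 'e \<Rightarrow> real" where
  "load_others X i v e = (\<Sum>j\<in>{..<m} - {i}. if X j (v j) e then \<alpha> j else 0)"

definition total :: "(nat \<Rightarrow> nat \<Rightarrow> 'e \<Rightarrow> bool) \<Rightarrow> real" where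
  "total X = (\<Sum>v\<in>digit_vectors C m. \<Sum>e\<in>E. min (D e) (load X v e))"

text \<open>The increase of \<open>total\<close> caused by edge \<open>e\<close> when it is put into
  the empty entry \<open>(i, c)\<close>: only colour vectors that select this entry are
  affected.\<close>

definition gain :: "(nat \<Rightarrow> nat \<Rightarrow> 'e \<Rightarrow> bool) \<Rightarrow> nat \<Rightarrow> nat \<Rightarrow> 'e \<Rightarrow> real" where
  "gain X i c e = (\<Sum>v\<in>{v\<in>digit_vectors C m. v i = c}.
     min (D e) (\<alpha> i + load_others X i v e) - min (D e) (load_others X i v e))"

definition assignment_value :: "(nat \<Rightarrow> 'e \<Rightarrow> bool) \<Rightarrow> real" where
  "assignment_value Q = (\<Sum>e\<in>E. min (D e) (\<Sum>i<m. if Q i e then \<alpha> i else 0))"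

lemma load_split: "i < m \<Longrightarrow> load X v e = (if X i (v i) e then \<alpha> i else 0) + load_others X i v e"
  unfolding load_def load_others_def by (subst sum.remove[of _ i]) auto

lemma load_others_upd: "load_others X i (v(i := x)) e = load_others X i v e"
  unfolding load_others_def by (intro sum.cong) auto

text \<open>The value is a sum over edges, so the edges put into an empty entry do not interact and
  their gains add up. This is what turns a greedy step into a maximum weight matching
  problem.\<close>

lemma total_update:
  assumes "i < m" "\<And>e. e \<in> E \<Longrightarrow> \<not> X i c e"
    and "\<And>j c' e. e \<in> E \<Longrightarrow> j < m \<Longrightarrow> c' < C \<Longrightarrow> Y j c' e = (if j = i \<and> c' = c then N e else X j c' e)"
  shows "total Y = total X + (\<Sum>e\<in>{e\<in>E. N e}. gain X i c e)"
proof -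
  have V: "v j < C" if "v \<in> digit_vectors C m" "j < m" for v j
    using that by (auto simp: digit_vectors_def)
  have others: "load_others Y i v e = load_others X i v e" if "v \<in> digit_vectors C m" "e \<in> E" for v e
    unfolding load_others_def by (intro sum.cong refl) (use that V assms(3) in auto)
  have "min (D e) (load Y v e) = min (D e) (load X v e) +
      (if v i = c \<and> N e then min (D e) (\<alpha> i + load_others X i v e) - min (D e) (load_others X i v e) else 0)"
    if "v \<in> digit_vectors C m" "e \<in> E" for v e
    using that V[OF that(1) assms(1)] assms by (auto simp: load_split[OF assms(1)] others)
  then have "total Y = (\<Sum>v\<in>digit_vectors C m. \<Sum>e\<in>E. min (D e) (load X v e) +
      (if v i = c \<and> N e then min (D e) (\<alpha> i + load_others X i v e) - min (D e) (load_others X i v e) else 0))"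
    unfolding total_def by (intro sum.cong refl) auto
  also have "\<dots> = total X + (\<Sum>v\<in>digit_vectors C m. \<Sum>e\<in>E.
      (if v i = c \<and> N e then min (D e) (\<alpha> i + load_others X i v e) - min (D e) (load_others X i v e) else 0))"
    by (simp add: sum.distrib total_def)
  also have "(\<Sum>v\<in>digit_vectors C m. \<Sum>e\<in>E.
      (if v i = c \<and> N e then min (D e) (\<alpha> i + load_others X i v e) - min (D e) (load_others X i v e) else 0)) =
      (\<Sum>e\<in>{e\<in>E. N e}. gain X i c e)"
  proof -
    have "(\<Sum>v\<in>digit_vectors C m. if v i = c \<and> N e
        then min (D e) (\<alpha> i + load_others X i v e) - min (D e) (load_others X i v e) else 0) =
        (if N e then gain X i c e else 0)" for e
      by (simp add: gain_def sum.inter_filter finite_digit_vectors)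
    then show ?thesis by (subst sum.swap) (simp add: sum.inter_filter fin)
  qed
  finally show ?thesis .
qed

text \<open>
  Averaged over all colour vectors, adding the assignment \<open>Q\<close> on top of the current one gains at
  least the deficit; by concavity it does not gain more than its parts separately.
\<close>

lemma gain_assignment:
  assumes "c < C"
  shows "(real C ^ m * assignment_value Q - total X) / real C \<le> (\<Sum>i<m. \<Sum>e\<in>{e\<in>E. Q i e}. gain X i c e)"
proof -
  let ?V = "digit_vectors C m"
  have gain: "(\<Sum>v\<in>?V. min (D e) (\<alpha> i + load X v e) - min (D e) (load X v e)) \<le> real C * gain X i c e"
    if i: "i < m" for i e
  proof -
    \<comment> \<open>\<open>load_others\<close> ignores the colour of \<open>i\<close>, so the
      slice with colour \<open>c\<close> stands for a \<open>C\<close>-th part of the sum over all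
      vectors.\<close>
    have "real C * gain X i c e =
        (\<Sum>v\<in>?V. min (D e) (\<alpha> i + load_others X i v e) - min (D e) (load_others X i v e))"
      unfolding gain_def using i assms
      by (intro sum_digit_vectors_fixed) (auto simp: load_others_upd)
    moreover have "load_others X i v e \<le> load X v e" for v
      using \<alpha>_nonneg[OF i] by (simp add: load_split[OF i])
    ultimately show ?thesis using \<alpha>_nonneg[OF i]
      by (auto intro!: sum_mono min_increment_antimono)
  qed
  \<comment> \<open>For one edge and one colour vector: adding all of \<open>Q\<close> on top of the
    load reaches at least the value of \<open>Q\<close>, and by \<open>min_increment_sum\<close> it
    gains at most the sum of the separate increments.\<close>
  have edge: "min (D e) (\<Sum>i<m. if Q i e then \<alpha> i else 0) - min (D e) (load X v e) \<le>
      (\<Sum>i<m. if Q i e then min (D e) (\<alpha> i + load X v e) - min (D e) (load X v e) else 0)" for v e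
  proof -
    let ?S = "{i\<in>{..<m}. Q i e}"
    have "0 \<le> load X v e" unfolding load_def using \<alpha>_nonneg by (intro sum_nonneg) auto
    then have "min (D e) (sum \<alpha> ?S) \<le> min (D e) (sum \<alpha> ?S + load X v e)" by simp
    also have "\<dots> \<le> (\<Sum>i\<in>?S. min (D e) (\<alpha> i + load X v e) - min (D e) (load X v e)) + min (D e) (load X v e)"
      using min_increment_sum[of ?S \<alpha> "D e" "load X v e"] \<alpha>_nonneg by auto
    finally show ?thesis unfolding sum.inter_filter[OF finite_lessThan] by linarith
  qed
  have "real C ^ m * assignment_value Q - total X =
      (\<Sum>v\<in>?V. \<Sum>e\<in>E. min (D e) (\<Sum>i<m. if Q i e then \<alpha> i else 0) - min (D e) (load X v e))"
    by (simp add: assignment_value_def total_def sum_subtractf card_digit_vectors)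
  also have "\<dots> \<le> (\<Sum>v\<in>?V. \<Sum>e\<in>E. \<Sum>i<m. if Q i e then min (D e) (\<alpha> i + load X v e) - min (D e) (load X v e) else 0)"
    by (intro sum_mono edge)
  also have "\<dots> = (\<Sum>e\<in>E. \<Sum>v\<in>?V. \<Sum>i<m. if Q i e then min (D e) (\<alpha> i + load X v e) - min (D e) (load X v e) else 0)"
    by (rule sum.swap)
  also have "\<dots> = (\<Sum>e\<in>E. \<Sum>i<m. \<Sum>v\<in>?V. if Q i e then min (D e) (\<alpha> i + load X v e) - min (D e) (load X v e) else 0)"
    by (intro sum.cong refl sum.swap)
  also have "\<dots> \<le> (\<Sum>e\<in>E. \<Sum>i<m. if Q i e then real C * gain X i c e else 0)"
    by (intro sum_mono) (auto intro!: gain)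
  also have "\<dots> = (\<Sum>i<m. \<Sum>e\<in>E. if Q i e then real C * gain X i c e else 0)"
    by (rule sum.swap)
  also have "\<dots> = real C * (\<Sum>i<m. \<Sum>e\<in>{e\<in>E. Q i e}. gain X i c e)"
    by (simp add: sum_distrib_left sum.inter_filter fin if_distrib cong: if_cong)
  finally show ?thesis using C_pos by (simp add: field_simps)
qed

end

text \<open>The progress of a round is compared with the deficit after the round, because gains are
  measured against the table at its end. Hence \<open>(1 + b) * (P - F') \<le> P - F\<close>, and
  the factor is \<open>1 / (1 + b)\<close> instead of \<open>1 - b\<close>.\<close>

lemma deficit_step:
  fixes P F F' b :: real
  assumes "b * (P - F') \<le> F' - F" "P - F \<le> P * (1 / (1 + b)) ^ c" "0 \<le> b"
  shows "P - F' \<le> P * (1 / (1 + b)) ^ Suc c"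
proof -
  have "(1 + b) * (P - F') \<le> P - F" using assms(1) by (simp add: algebra_simps)
  also note assms(2)
  finally have "P - F' \<le> P * (1 / (1 + b)) ^ c / (1 + b)"
    using assms(3) by (simp add: pos_le_divide_eq mult.commute)
  then show ?thesis by (simp add: power_divide mult.commute)
qed


section \<open>Auctions\<close>

text \<open>
  A matching between \<open>{..<a}\<close> and \<open>{..<b}\<close> is represented by the function sending \<open>v < b\<close> to
  \<open>Suc u\<close> if \<open>v\<close> is matched to \<open>u\<close>, and to \<open>0\<close> if \<open>v\<close> is not matched.
\<close>

definition valid_owner :: "nat \<Rightarrow> nat \<Rightarrow> (nat \<Rightarrow> nat) \<Rightarrow> bool" where
  "valid_owner a b own \<longleftrightarrow> (\<forall>v<b. own v \<le> a) \<and>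
     (\<forall>v<b. \<forall>v'<b. own v = own v' \<longrightarrow> own v \<noteq> 0 \<longrightarrow> v = v')"

definition matched :: "nat \<Rightarrow> nat \<Rightarrow> (nat \<Rightarrow> nat) \<Rightarrow> (nat \<times> nat) set" where
  "matched a b own = {(u, v). u < a \<and> v < b \<and> own v = Suc u}"

lemma matched_subset: "matched a b own \<subseteq> {..<a} \<times> {..<b}"
  by (auto simp: matched_def)

lemma inj_on_fst_matched: "valid_owner a b own \<Longrightarrow> inj_on fst (matched a b own)"
  by (rule inj_onI) (auto simp: matched_def valid_owner_def)

lemma inj_on_snd_matched: "inj_on snd (matched a b own)"
  by (rule inj_onI) (auto simp: matched_def)

text \<open>
  State of an auction with weights \<open>w\<close> in which the price of \<open>v\<close> is \<open>\<eta> * q v\<close>. Bidder \<open>u\<close> is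
  waiting if \<open>st u = 0\<close>, owns an item if \<open>st u = 1\<close>, and has dropped out if \<open>st u = 2\<close>.
\<close>

definition auction_inv ::
  "(nat \<Rightarrow> nat \<Rightarrow> real) \<Rightarrow> real \<Rightarrow> nat \<Rightarrow> nat \<Rightarrow> nat \<Rightarrow> (nat \<Rightarrow> nat) \<Rightarrow> (nat \<Rightarrow> nat) \<Rightarrow> (nat \<Rightarrow> nat) \<Rightarrow> bool" where
  "auction_inv w \<eta> \<rho> a b q own st \<longleftrightarrow> valid_owner a b own \<and>
     (\<forall>v<b. q v \<le> \<rho> \<and> (own v = 0 \<longrightarrow> q v = 0)) \<and>
     (\<forall>u<a. st u = 0 \<or> st u = 1 \<and> (\<exists>v<b. own v = Suc u) \<or>
        st u = 2 \<and> (\<forall>v<b. w u v \<le> \<eta> * q v)) \<and>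
     (\<forall>u<a. \<forall>v<b. own v = Suc u \<longrightarrow> st u = 1 \<and> \<eta> * q v \<le> w u v + \<eta> \<and>
        (\<forall>v'<b. w u v' - \<eta> * q v' \<le> w u v - \<eta> * q v + \<eta>))"

lemma auction_init:
  "auction_inv w \<eta> \<rho> a b q own st" if "\<forall>v<b. q v = 0" "\<forall>v<b. own v = 0" "\<forall>u<a. st u = 0"
  using that by (auto simp: auction_inv_def valid_owner_def)

lemma auction_drop:
  assumes "auction_inv w \<eta> \<rho> a b q own st" "f < a" "st f = 0" "\<forall>v<b. w f v \<le> \<eta> * q v"
  shows "auction_inv w \<eta> \<rho> a b q own (st(f := 2))"
  using assms unfolding auction_inv_def by (auto simp del: Suc_inject)

text \<open>The winning bid raises the price of a best item by \<eta>, so the new owner is within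
  \<eta> of the best profit. This persists because other prices only rise and the price of an owned
  item changes only when its owner is evicted.\<close>

lemma auction_assign:
  assumes inv: "auction_inv w \<eta> \<rho> a b q own st" and f: "f < a" "st f = 0" and v: "v < b"
    and best: "\<forall>v'<b. w f v' - \<eta> * q v' \<le> w f v - \<eta> * q v" "0 < w f v - \<eta> * q v"
    and max: "w f v \<le> \<eta> * \<rho>" "0 \<le> \<eta>"
    and st': "st' = (if own v = 0 then st else st(own v - 1 := 0))(f := 1)"
  shows "auction_inv w \<eta> \<rho> a b (q(v := q v + 1)) (own(v := Suc f)) st'"
proof -
  let ?q = "q(v := q v + 1)" and ?own = "own(v := Suc f)"
  have valid: "valid_owner a b own" using inv by (simp add: auction_inv_def)
  have owned: "st u = 1" "\<eta> * q v' \<le> w u v' + \<eta>"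
      "\<And>v''. v'' < b \<Longrightarrow> w u v'' - \<eta> * q v'' \<le> w u v' - \<eta> * q v' + \<eta>"
    if "u < a" "v' < b" "own v' = Suc u" for u v'
    using inv that by (auto simp: auction_inv_def)
  have not_f: "own v' \<noteq> Suc f" if "v' < b" for v'
    using owned(1)[OF f(1) that] f(2) by auto
  have price: "\<eta> * q v' \<le> \<eta> * ?q v'" for v'
    using max(2) by (auto simp: algebra_simps)
  \<comment> \<open>Nobody bids without a positive profit, which keeps the price below the largest
    weight; this leaves room for one more increment.\<close>
  have "\<eta> * q v < \<eta> * \<rho>" using best(2) max(1) by linarith
  then have "real (q v) < real \<rho>" using max(2) by (auto simp: mult_less_cancel_left)
  then have q: "?q v' \<le> \<rho>" "?own v' = 0 \<Longrightarrow> ?q v' = 0" if "v' < b" for v'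
    using inv that by (auto simp: auction_inv_def)
  have valid': "valid_owner a b ?own"
    unfolding valid_owner_def
  proof (intro conjI allI impI)
    show "?own v' \<le> a" if "v' < b" for v'
      using valid f(1) that by (auto simp: valid_owner_def)
    show "v1 = v2" if "v1 < b" "v2 < b" "?own v1 = ?own v2" "?own v1 \<noteq> 0" for v1 v2
      using that not_f[of v1] not_f[of v2] valid
      by (cases "v1 = v"; cases "v2 = v") (auto simp: valid_owner_def)
  qed
  have status: "st' u = 0 \<or> st' u = 1 \<and> (\<exists>v'<b. ?own v' = Suc u) \<or>
      st' u = 2 \<and> (\<forall>v'<b. w u v' \<le> \<eta> * ?q v')" if u: "u < a" for u
  proof (cases "u = f \<or> own v = Suc u")
    case True
    show ?thesis
    proof (cases "u = f")
      case True
      then have "st' u = 1" "?own v = Suc u" by (simp_all add: st')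
      with v show ?thesis by blast
    next
      case False
      with \<open>u = f \<or> own v = Suc u\<close> show ?thesis by (simp add: st')
    qed
  next
    case False
    then have "st' u = st u" by (auto simp: st')
    moreover have "(\<exists>v'<b. own v' = Suc u) \<Longrightarrow> \<exists>v'<b. ?own v' = Suc u"
      using False by auto
    moreover have "\<forall>v'<b. w u v' \<le> \<eta> * q v' \<Longrightarrow> \<forall>v'<b. w u v' \<le> \<eta> * ?q v'"
      using price order_trans by blast
    moreover have "st u = 0 \<or> st u = 1 \<and> (\<exists>v'<b. own v' = Suc u) \<or> st u = 2 \<and> (\<forall>v'<b. w u v' \<le> \<eta> * q v')"
      using inv u unfolding auction_inv_def by simp
    ultimately show ?thesis by argo
  qed
  have owned': "st' u = 1 \<and> \<eta> * ?q v' \<le> w u v' + \<eta> \<and>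
      (\<forall>v''<b. w u v'' - \<eta> * ?q v'' \<le> w u v' - \<eta> * ?q v' + \<eta>)"
    if u: "u < a" "v' < b" "?own v' = Suc u" for u v'
  proof (cases "v' = v")
    case True
    then have [simp]: "u = f" using u(3) by simp
    have "w f v'' - \<eta> * ?q v'' \<le> w f v - \<eta> * q v" if "v'' < b" for v''
      using best(1) that price[of v''] by (meson diff_left_mono order_trans)
    then show ?thesis using True best(2) by (auto simp: st' algebra_simps)
  next
    case False
    then have o: "own v' = Suc u" using u by simp
    have "u \<noteq> f" using not_f u o by auto
    moreover have "own v \<noteq> Suc u" using valid False o u(2) v by (auto simp: valid_owner_def)
    ultimately have "st' u = 1" using owned(1)[OF u(1,2) o] by (auto simp: st')
    moreover have "w u v'' - \<eta> * ?q v'' \<le> w u v' - \<eta> * q v' + \<eta>" if "v'' < b" for v''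
      using owned(3)[OF u(1,2) o that] price[of v''] by linarith
    ultimately show ?thesis using owned(2)[OF u(1,2) o] False by auto
  qed
  show ?thesis unfolding auction_inv_def using valid' q status owned' by blast
qed

text \<open>A potential that every bid raises by exactly one and that \<open>b * \<rho> + a\<close>
  bounds; it limits the number of bids.\<close>

definition auction_progress :: "nat \<Rightarrow> nat \<Rightarrow> (nat \<Rightarrow> nat) \<Rightarrow> (nat \<Rightarrow> nat) \<Rightarrow> nat" where
  "auction_progress a b q st = (\<Sum>v<b. q v) + card {u. u < a \<and> st u = 2}"

lemma auction_progress_drop:
  assumes "f < a" "st f = 0"
  shows "auction_progress a b q (st(f := 2)) = Suc (auction_progress a b q st)"
proof -
  have "{u. u < a \<and> (st(f := 2)) u = 2} = insert f {u. u < a \<and> st u = 2}" using assms by auto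
  then show ?thesis using assms by (simp add: auction_progress_def)
qed

lemma auction_progress_assign:
  assumes "auction_inv w \<eta> \<rho> a b q own st" "f < a" "st f = 0" "v < b"
    and "st' = (if own v = 0 then st else st(own v - 1 := 0))(f := 1)"
  shows "auction_progress a b (q(v := q v + 1)) st' = Suc (auction_progress a b q st)"
proof -
  \<comment> \<open>The evicted bidder was an owner and not a dropout, so resetting its status does
    not lower the potential.\<close>
  have "st (own v - 1) = 1" if "own v \<noteq> 0"
  proof -
    have "own v - 1 < a" "own v = Suc (own v - 1)"
      using assms(1,4) that by (auto simp: auction_inv_def valid_owner_def)
    with assms(1,4) show ?thesis unfolding auction_inv_def by metis
  qed
  then have "{u. u < a \<and> st' u = 2} = {u. u < a \<and> st u = 2}"
    using assms by auto
  moreover have "(\<Sum>v'<b. (q(v := q v + 1)) v') = Suc (\<Sum>v<b. q v)"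
    using assms(4) by (simp add: sum.remove[of "{..<b}" v])
  ultimately show ?thesis by (simp add: auction_progress_def)
qed

lemma auction_progress_le:
  assumes "auction_inv w \<eta> \<rho> a b q own st"
  shows "auction_progress a b q st \<le> b * \<rho> + a"
proof -
  have "(\<Sum>v<b. q v) \<le> b * \<rho>"
    using assms sum_bounded_above[of "{..<b}" q \<rho>] by (auto simp: auction_inv_def)
  moreover have "card {u. u < a \<and> st u = 2} \<le> a"
    using card_mono[of "{..<a}" "{u. u < a \<and> st u = 2}"] by auto
  ultimately show ?thesis by (simp add: auction_progress_def)
qed

text \<open>The prices and the profits of the bidders form an almost tight dual solution.\<close>

lemma auction_final:
  assumes inv: "auction_inv w \<eta> \<rho> a b q own st" and finished: "\<And>u. u < a \<Longrightarrow> st u \<noteq> 0"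
    and N: "valid_owner a b N" and \<eta>: "0 \<le> \<eta>"
  shows "(\<Sum>(u, v)\<in>matched a b N. w u v) \<le> (\<Sum>(u, v)\<in>matched a b own. w u v) + \<eta> * a"
proof -
  let ?M = "matched a b own" and ?N = "matched a b N"
  have valid: "valid_owner a b own" using inv by (simp add: auction_inv_def)
  have owned: "\<eta> * q v' \<le> w u v' + \<eta>"
      "\<And>v''. v'' < b \<Longrightarrow> w u v'' - \<eta> * q v'' \<le> w u v' - \<eta> * q v' + \<eta>"
    if "u < a" "v' < b" "own v' = Suc u" for u v'
    using inv that by (auto simp: auction_inv_def)
  define it where "it u = (SOME v. v < b \<and> own v = Suc u)" for u
  have it: "it u = v" if "v < b" "own v = Suc u" for u v
    unfolding it_def using that valid by (intro some_equality) (auto simp: valid_owner_def)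
  \<comment> \<open>The summand \<eta> makes \<open>y\<close> dominate the profit of a bidder at
    every item and also makes it nonnegative; it costs \<eta> per owner, which is the error term of
    the conclusion.\<close>
  define y where "y u = (if \<exists>v<b. own v = Suc u then w u (it u) - \<eta> * q (it u) + \<eta> else 0)" for u
  have y0: "0 \<le> y u" if "u < a" for u
    using owned(1)[OF that] by (auto simp: y_def it algebra_simps)
  have dual: "w u v \<le> y u + \<eta> * q v" if "u < a" "v < b" for u v
  proof (cases "\<exists>v<b. own v = Suc u")
    case True
    then obtain v' where v': "v' < b" "own v' = Suc u" by blast
    have "y u = w u v' - \<eta> * q v' + \<eta>" using v' it[OF v'] by (auto simp: y_def)
    with owned(2)[OF that(1) v' that(2)] show ?thesis by simp
  next
    case False
    have "st u = 0 \<or> st u = 1 \<and> (\<exists>v<b. own v = Suc u) \<or> st u = 2 \<and> (\<forall>v<b. w u v \<le> \<eta> * q v)"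
      using inv that(1) unfolding auction_inv_def by simp
    then have "\<forall>v<b. w u v \<le> \<eta> * q v" using False finished[OF that(1)] by blast
    then have "w u v \<le> \<eta> * q v" using that(2) by simp
    then show ?thesis unfolding y_def using False by (subst if_not_P) auto
  qed
  have fst_sub: "fst ` matched a b x \<subseteq> {..<a}" and snd_sub: "snd ` matched a b x \<subseteq> {..<b}" for x
    by (auto simp: matched_def)
  have "(\<Sum>(u, v)\<in>?N. w u v) \<le> (\<Sum>(u, v)\<in>?N. y u + \<eta> * q v)"
    by (intro sum_mono) (auto simp: matched_def intro: dual)
  also have "\<dots> = (\<Sum>p\<in>?N. y (fst p)) + (\<Sum>p\<in>?N. \<eta> * q (snd p))"
    by (simp add: case_prod_beta sum.distrib)
  also have "\<dots> = sum y (fst ` ?N) + (\<Sum>v\<in>snd ` ?N. \<eta> * q v)"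
    by (simp add: sum.reindex[OF inj_on_fst_matched[OF N]] sum.reindex[OF inj_on_snd_matched])
  also have "\<dots> \<le> (\<Sum>u<a. y u) + (\<Sum>v<b. \<eta> * q v)"
    using fst_sub[of N] snd_sub[of N] y0 \<eta> by (intro add_mono sum_mono2) auto
  \<comment> \<open>From here on the dual value is shown to be that of \<open>own\<close> up to the
    error: bidders without an item have \<open>y u = 0\<close>.\<close>
  also have "(\<Sum>u<a. y u) = sum y (fst ` ?M)"
  proof (rule sum.mono_neutral_right)
    show "\<forall>u\<in>{..<a} - fst ` ?M. y u = 0"
    proof
      fix u assume u: "u \<in> {..<a} - fst ` ?M"
      have "\<not> (\<exists>v<b. own v = Suc u)"
      proof
        assume "\<exists>v<b. own v = Suc u"
        then obtain v where "(u, v) \<in> ?M" using u by (auto simp: matched_def)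
        then show False using u by force
      qed
      then show "y u = 0" unfolding y_def by (rule if_not_P)
    qed
  qed (use fst_sub in auto)
  also have "\<dots> = (\<Sum>p\<in>?M. y (fst p))"
    by (simp add: sum.reindex[OF inj_on_fst_matched[OF valid]])
  also have "\<dots> = (\<Sum>(u, v)\<in>?M. w u v - \<eta> * q v + \<eta>)"
    by (intro sum.cong refl) (auto simp: matched_def y_def it)
  \<comment> \<open>Items without an owner still have price 0, which is why the invariant records
    it.\<close>
  also have "(\<Sum>v<b. \<eta> * q v) = (\<Sum>v\<in>snd ` ?M. \<eta> * q v)"
  proof (rule sum.mono_neutral_right)
    show "\<forall>v\<in>{..<b} - snd ` ?M. \<eta> * q v = 0"
    proof
      fix v assume v: "v \<in> {..<b} - snd ` ?M"
      have "own v \<le> a" using valid v by (auto simp: valid_owner_def)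
      have "own v = 0"
      proof (rule ccontr)
        assume "own v \<noteq> 0"
        then have "(own v - 1, v) \<in> ?M" using v \<open>own v \<le> a\<close> by (auto simp: matched_def)
        then show False using v by force
      qed
      then show "\<eta> * q v = 0" using inv v by (auto simp: auction_inv_def)
    qed
  qed (use snd_sub in auto)
  also have "\<dots> = (\<Sum>(u, v)\<in>?M. \<eta> * q v)"
    by (simp add: sum.reindex[OF inj_on_snd_matched] case_prod_beta)
  also have "(\<Sum>(u, v)\<in>?M. w u v - \<eta> * q v + \<eta>) + (\<Sum>(u, v)\<in>?M. \<eta> * q v) =
      (\<Sum>(u, v)\<in>?M. w u v) + \<eta> * card ?M"
    by (simp add: case_prod_beta sum.distrib sum_subtractf)
  also have "card ?M \<le> a"
    using card_inj_on_le[OF inj_on_fst_matched[OF valid] fst_sub] by simp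
  then have "(\<Sum>(u, v)\<in>?M. w u v) + \<eta> * card ?M \<le> (\<Sum>(u, v)\<in>?M. w u v) + \<eta> * a"
    using \<eta> by (intro add_left_mono mult_left_mono) auto
  finally show ?thesis by simp
qed

text \<open>The additive error is at most \<open>wmax / r\<close>. The auction result is itself
  worth at least \<open>(1 - 1 / r) * wmax\<close>, since a single edge may reach
  \<open>wmax\<close>; this makes the error relative.\<close>

lemma auction_approx:
  assumes inv: "auction_inv w \<eta> \<rho> a b q own st" and finished: "\<And>u. u < a \<Longrightarrow> st u \<noteq> 0"
    and N: "valid_owner a b N" and r: "1 \<le> r"
    and w: "\<And>u v. u < a \<Longrightarrow> v < b \<Longrightarrow> w u v \<le> wmax"
    and attained: "wmax = 0 \<or> (\<exists>u<a. \<exists>v<b. w u v = wmax)" "0 \<le> wmax"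
    and \<eta>: "\<eta> = wmax / (real a * real r)"
  shows "(1 - 1 / real r) * (\<Sum>(u, v)\<in>matched a b N. w u v) \<le> (\<Sum>(u, v)\<in>matched a b own. w u v)"
proof -
  let ?W = "\<lambda>N. \<Sum>(u, v)\<in>matched a b N. w u v"
  have \<eta>0: "0 \<le> \<eta>" using attained \<eta> by simp
  \<comment> \<open>Only an inequality: for \<open>a = 0\<close> the division gives
    \<open>\<eta> = 0\<close>.\<close>
  have \<eta>a: "\<eta> * a \<le> wmax / r" using \<eta> attained(2) by simp
  have 1: "?W N \<le> ?W own + wmax / r"
    using auction_final[OF inv finished N \<eta>0] \<eta>a by linarith
  \<comment> \<open>The competitor is the matching consisting of one heaviest edge, or the empty
    matching if \<open>wmax = 0\<close>.\<close>
  have 2: "wmax \<le> ?W own + wmax / r"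
  proof (cases "wmax = 0")
    case True
    have "valid_owner a b (\<lambda>_. 0)" "matched a b (\<lambda>_. 0) = {}"
      by (auto simp: valid_owner_def matched_def)
    then show ?thesis using auction_final[OF inv finished _ \<eta>0] \<eta>a True by fastforce
  next
    case False
    then obtain u v where uv: "u < a" "v < b" "w u v = wmax" using attained by blast
    have "valid_owner a b ((\<lambda>_. 0)(v := Suc u))" "matched a b ((\<lambda>_. 0)(v := Suc u)) = {(u, v)}"
      using uv by (auto simp: valid_owner_def matched_def)
    then show ?thesis using auction_final[OF inv finished _ \<eta>0] \<eta>a uv by fastforce
  qed
  define x where "x = 1 / real r"
  have x: "0 \<le> x" "x \<le> 1" using r by (auto simp: x_def)
  have "(1 - x) * ?W N \<le> (1 - x) * (?W own + x * wmax)"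
    using 1 x by (intro mult_left_mono) (auto simp: x_def)
  also have "\<dots> = (1 - x) * ?W own + x * ((1 - x) * wmax)" by (simp add: algebra_simps)
  also have "\<dots> \<le> (1 - x) * ?W own + x * ?W own"
    using 2 x by (intro add_left_mono mult_left_mono) (auto simp: x_def algebra_simps)
  finally show ?thesis by (simp add: x_def algebra_simps)
qed


section \<open>Numerical estimates\<close>

text \<open>For \<open>x = 1 / r\<close> and \<open>b = (1 - x) * x\<close>, the bound
  \<open>ln (1 + b) \<ge> b - b^2\<close> gives \<open>r * ln (1 + b) \<ge> 1 - 2 * x\<close>,
  because \<open>r * b = 1 - x\<close> and \<open>r * b^2 \<le> x\<close>.\<close>

lemma greedy_factor:
  assumes "2 \<le> r"
  shows "(1 / (1 + (1 - 1 / real r) / real r)) ^ r \<le> 1 / exp 1 + 2 / real r"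
proof -
  define x where "x = 1 / real r"
  define b where "b = (1 - x) * x"
  have x: "0 < x" "x \<le> 1/2" "real r * x = 1" using assms by (auto simp: x_def field_simps)
  have b: "0 \<le> b" "b \<le> x" "b \<le> 1" using x by (auto simp: b_def mult_left_le_one_le intro: order_trans[of _ x])
  have "b * b \<le> x * x" using b by (intro mult_mono) auto
  then have "real r * (b * b) \<le> real r * (x * x)" by (intro mult_left_mono) auto
  also have "\<dots> = x" using x(3) by (simp flip: mult.assoc)
  finally have "real r * (b * b) \<le> x" .
  moreover have "real r * b = 1 - x" using x(3) by (simp add: b_def algebra_simps flip: mult.assoc)
  ultimately have "1 - 2 * x \<le> real r * (b - b\<^sup>2)" by (simp add: algebra_simps power2_eq_square)
  also have "\<dots> \<le> real r * ln (1 + b)"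
    using b by (intro mult_left_mono ln_one_plus_pos_lower_bound) auto
  finally have "exp (1 - 2 * x) \<le> exp (real r * ln (1 + b))" by simp
  also have "\<dots> = (1 + b) ^ r" using b(1) by (simp add: exp_of_nat_mult)
  finally have "1 / (1 + b) ^ r \<le> 1 / exp (1 - 2 * x)"
    using b(1) by (intro divide_left_mono) auto
  also have "\<dots> = exp (2 * x) / exp 1" by (simp add: exp_diff)
  \<comment> \<open>Since \<open>x \<le> 1/2\<close>, the quadratic term is at most
    \<open>2 * x\<close>; dividing the resulting \<open>4 * x\<close> by
    \<open>exp 1 \<ge> 2\<close> leaves \<open>2 * x = 2 / r\<close>.\<close>
  also have "exp (2 * x) \<le> 1 + 2 * x + (2 * x)\<^sup>2" using x by (intro exp_bound) auto
  also have "\<dots> \<le> 1 + 4 * x" using x by (simp add: power2_eq_square)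
  finally have "1 / (1 + b) ^ r \<le> 1 / exp 1 + 4 * x / exp 1" by (simp add: divide_right_mono add_divide_distrib)
  also have "4 * x / exp 1 \<le> 4 * x / 2" using x exp_ge_add_one_self[of 1] by (intro divide_left_mono) auto
  finally show ?thesis by (simp add: b_def x_def power_divide)
qed

section \<open>Counting the guesses and rounding durations to the grid\<close>

lemma power_le_fact_exp: "0 \<le> x \<Longrightarrow> x ^ n \<le> fact n * exp (x::real)"
proof -
  assume x: "0 \<le> x"
  have "(\<Sum>i\<in>{n}. x ^ i /\<^sub>R fact i) \<le> (\<Sum>i. x ^ i /\<^sub>R fact i)"
    using x by (intro sum_le_suminf summable_exp_generic) auto
  then show ?thesis by (simp add: exp_def field_simps)
qed

text \<open>The candidates for index \<open>i\<close> are the multiples of the grid width from 0 up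
  to \<open>r * m div (i + 1) + 1\<close>, the last one being due to rounding up; hence the
  \<open>+ 2\<close>.\<close>

definition radix :: "nat \<Rightarrow> nat \<Rightarrow> nat \<Rightarrow> nat" where
  "radix r m i = r * m div (i + 1) + 2"

text \<open>For \<open>i < m\<close> the ratio \<open>r * m / (i + 1)\<close> is at least 1, so it
  absorbs the \<open>+ 2\<close> at the price of a factor 3. A second factor 3 per position comes
  from \<open>m^m / fact m \<le> exp m \<le> 3^m\<close>.\<close>

lemma prod_radix_le:
  assumes "1 \<le> r" "n \<le> m"
  shows "(\<Prod>i<n. radix r m i) \<le> (9 * r) ^ m"
proof -
  have "(\<Prod>i<n. radix r m i) \<le> (\<Prod>i<m. radix r m i)"
    using assms(2) by (intro dvd_imp_le prod_dvd_prod_subset prod_pos) (auto simp: radix_def)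
  also have "real (\<Prod>i<m. radix r m i) = (\<Prod>i<m. real (radix r m i))" by simp
  also have "\<dots> \<le> (\<Prod>i<m. 3 * real r * real m / real (Suc i))"
  proof (rule prod_mono, safe)
    fix i assume i: "i < m"
    have "1 * 1 \<le> real r * (real m / real (Suc i))" using assms i by (intro mult_mono) auto
    then have "2 \<le> 2 * (real r * real m / real (Suc i))" by (simp only: times_divide_eq_right)
    moreover have "real (r * m div (i + 1)) \<le> real r * real m / real (Suc i)"
      using of_nat_div_le_of_nat[of "r * m" "i + 1", where ?'a = real] by simp
    moreover have "y + 2 \<le> 3 * z" if "2 \<le> 2 * z" "y \<le> z" for y z :: real
      using that by linarith
    ultimately have "real (radix r m i) \<le> 3 * (real r * real m / real (Suc i))"
      unfolding radix_def of_nat_add of_nat_numeral by blast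
    then show "real (radix r m i) \<le> 3 * real r * real m / real (Suc i)"
      by (simp add: mult.assoc)
  qed simp
  also have "\<dots> = (3 * real r * real m) ^ m / fact m"
    by (simp add: prod_dividef fact_prod_Suc lessThan_atLeast0)
  also have "\<dots> = (3 * real r) ^ m * (real m ^ m / fact m)" by (simp add: power_mult_distrib)
  also have "\<dots> \<le> (3 * real r) ^ m * exp (real m)"
    using power_le_fact_exp[of "real m" m] by (intro mult_left_mono) (auto simp: field_simps)
  also have "exp (real m) = exp 1 ^ m" by (simp add: exp_of_nat_mult[of m 1, simplified])
  also have "\<dots> \<le> 3 ^ m" using exp_le by (intro power_mono) auto
  finally have "real (\<Prod>i<n. radix r m i) \<le> (3 * real r) ^ m * 3 ^ m"
    by (simp add: mult_left_mono)
  also have "\<dots> = (3 * real r * 3) ^ m" by (rule power_mult_distrib[symmetric])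
  also have "3 * real r * 3 = real (9 * r)" by simp
  finally show ?thesis unfolding of_nat_power[symmetric] of_nat_le_iff .
qed

text \<open>
  The durations \<open>grid_duration\<close> are pairwise distinct, so that a schedule, being a set of
  configurations, does not lose any of them.
\<close>

definition grid_duration :: "real \<Rightarrow> nat \<Rightarrow> (nat \<Rightarrow> nat) \<Rightarrow> nat \<Rightarrow> real" where
  "grid_duration g m d i = g * (real (d i) + real i / real m)"

lemma grid_duration_nonneg: "0 \<le> g \<Longrightarrow> 0 \<le> grid_duration g m d i"
  by (simp add: grid_duration_def)

text \<open>Multiplied by \<open>m / g\<close>, the durations become the naturals
  \<open>d i * m + i\<close>, whose residues modulo \<open>m\<close> are the indices.\<close>

lemma inj_on_grid_duration:
  assumes "0 < g"
  shows "inj_on (grid_duration g m d) {..<m}"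
proof (rule inj_onI)
  fix i j assume ij: "i \<in> {..<m}" "j \<in> {..<m}" "grid_duration g m d i = grid_duration g m d j"
  then have "real (d i) + real i / real m = real (d j) + real j / real m"
    using assms by (simp add: grid_duration_def)
  with ij have "real (d i * m + i) = real (d j * m + j)" by (simp add: field_simps)
  then have "d i * m + i = d j * m + j" by linarith
  then have "(d i * m + i) mod m = (d j * m + j) mod m" by simp
  with ij show "i = j" by simp
qed

lemma divide_le_Suc_div: "real n / real (Suc k) \<le> real (n div Suc k) + 1"
proof -
  have "n \<le> Suc k * (n div Suc k) + Suc k"
    using mult_div_mod_eq[of "Suc k" n] mod_less_divisor[of "Suc k" n] by linarith
  then have "real n \<le> real (Suc k * (n div Suc k) + Suc k)" by (rule of_nat_mono)
  then have "real n \<le> (real (n div Suc k) + 1) * real (Suc k)" by (simp only: of_nat_add of_nat_mult) argo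
  then show ?thesis by (simp add: pos_divide_le_eq)
qed

text \<open>Shrinking by \<open>1 - 2 / r\<close> frees time \<open>2 * L / r = 2 * m * g\<close>,
  that is \<open>2 * g\<close> for each duration: one \<open>g\<close> pays for rounding up to the
  grid, the other for the offset \<open>g * i / m\<close> that makes the durations distinct.\<close>

lemma round_durations:
  fixes \<beta> :: "nat \<Rightarrow> real"
  assumes r: "2 \<le> r" and L: "0 < L" "sum \<beta> {..<m} \<le> L" and nn: "\<And>i. i < m \<Longrightarrow> 0 \<le> \<beta> i"
    and anti: "\<And>i j. i \<le> j \<Longrightarrow> j < m \<Longrightarrow> \<beta> j \<le> \<beta> i" and m: "0 < m"
    and g: "g = L / (real r * real m)"
  shows "\<exists>d. (\<forall>i<m. d i < radix r m i) \<and> (\<Sum>i<m. grid_duration g m d i) \<le> L \<and>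
    (\<forall>i<m. (1 - 2 / real r) * \<beta> i \<le> grid_duration g m d i)"
proof -
  define t where "t = 1 - 2 / real r"
  have t: "0 \<le> t" "t \<le> 1" using r by (auto simp: t_def)
  have g0: "0 < g" using r L m by (simp add: g)
  define d where "d i = nat \<lceil>t * \<beta> i / g\<rceil>" for i
  have d_ge: "t * \<beta> i \<le> g * real (d i)" if "i < m" for i
  proof -
    have "t * \<beta> i / g \<le> real (d i)" unfolding d_def by linarith
    then show ?thesis using g0 by (simp add: field_simps)
  qed
  have d_le: "g * real (d i) \<le> t * \<beta> i + g" if "i < m" for i
  proof -
    have "0 \<le> t * \<beta> i / g" using nn[OF that] t g0 by simp
    then have "real (d i) \<le> t * \<beta> i / g + 1" unfolding d_def by linarith
    then have "g * real (d i) \<le> g * (t * \<beta> i / g + 1)" using g0 by (intro mult_left_mono) auto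
    then show ?thesis using g0 by (simp add: distrib_left)
  qed
  have "d i < radix r m i" if i: "i < m" for i
  proof -
    \<comment> \<open>The first \<open>Suc i\<close> durations are all at least
      \<open>\<beta> i\<close>, and together they fit into \<open>L\<close>.\<close>
    have "real (Suc i) * \<beta> i = (\<Sum>j<Suc i. \<beta> i)" by simp
    also have "\<dots> \<le> (\<Sum>j<Suc i. \<beta> j)" using anti i by (intro sum_mono) auto
    also have "\<dots> \<le> sum \<beta> {..<m}" using nn i by (intro sum_mono2) auto
    also note L(2)
    finally have "\<beta> i \<le> L / real (Suc i)" by (simp add: field_simps)
    then have "t * \<beta> i \<le> 1 * (L / real (Suc i))" using t nn[OF i] by (intro mult_mono) auto
    then have "t * \<beta> i / g \<le> L / real (Suc i) / g" using g0 by (intro divide_right_mono) auto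
    also have "\<dots> = real (r * m) / real (i + 1)"
    proof -
      have "L / s / (L / p) = p / s" for s p using L(1) by simp
      from this[of "real (Suc i)" "real r * real m"] show ?thesis by (simp add: g)
    qed
    also have "\<dots> \<le> real (r * m div (i + 1)) + 1"
      using divide_le_Suc_div[of "r * m" i] by simp
    finally have "\<lceil>t * \<beta> i / g\<rceil> \<le> int (r * m div (i + 1) + 1)"
      unfolding ceiling_le_iff by simp
    then have "d i \<le> r * m div (i + 1) + 1" unfolding d_def nat_le_iff .
    then show ?thesis by (simp add: radix_def)
  qed
  moreover have "(\<Sum>i<m. grid_duration g m d i) \<le> L"
  proof -
    have "grid_duration g m d i \<le> t * \<beta> i + 2 * g" if "i < m" for i
    proof -
      have "g * (real i / real m) \<le> g * 1" using that g0 by (intro mult_left_mono) auto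
      with d_le[OF that] show ?thesis by (simp add: grid_duration_def distrib_left)
    qed
    then have "(\<Sum>i<m. grid_duration g m d i) \<le> (\<Sum>i<m. t * \<beta> i + 2 * g)" by (intro sum_mono) auto
    also have "\<dots> = t * sum \<beta> {..<m} + 2 * (real m * g)" by (simp add: sum.distrib sum_distrib_left)
    also have "\<dots> \<le> t * L + 2 * (real m * g)" using t L by (intro add_right_mono mult_left_mono) auto
    also have "\<dots> = L" using r m by (simp add: t_def g field_simps)
    finally show ?thesis .
  qed
  moreover have "t * \<beta> i \<le> grid_duration g m d i" if "i < m" for i
    using d_ge[OF that] g0 by (simp add: grid_duration_def distrib_left add_increasing2)
  ultimately show ?thesis unfolding t_def by blast
qed


section \<open>Schedules and owner functions\<close>

text \<open>The schedule value for an indexed family of configurations; unlike in a set, repeated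
  configurations count repeatedly.\<close>

definition load_value :: "nat \<Rightarrow> nat \<Rightarrow> (nat \<Rightarrow> nat \<Rightarrow> real) \<Rightarrow> nat \<Rightarrow> (nat \<Rightarrow> nat \<Rightarrow> nat) \<Rightarrow> (nat \<Rightarrow> real) \<Rightarrow> real" where
  "load_value a b D m own \<alpha> =
     (\<Sum>u<a. \<Sum>v<b. min (D u v) (\<Sum>i<m. if own i v = Suc u then \<alpha> i else 0))"

text \<open>Truncation is concave and vanishes at 0, so scaling the durations by \<open>t\<close>
  loses at most a factor \<open>t\<close>.\<close>

lemma load_value_scale:
  assumes "\<And>u v. u < a \<Longrightarrow> v < b \<Longrightarrow> 0 \<le> D u v" "0 \<le> t" "t \<le> 1"
    and "\<And>i. i < m \<Longrightarrow> t * \<beta> i \<le> \<alpha> i"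
  shows "t * load_value a b D m own \<beta> \<le> load_value a b D m own \<alpha>"
  unfolding load_value_def sum_distrib_left
proof (intro sum_mono)
  fix u v assume uv: "u \<in> {..<a}" "v \<in> {..<b}"
  let ?s = "\<lambda>\<alpha>. \<Sum>i<m. if own i v = Suc u then \<alpha> i else 0"
  have "t * min (D u v) (?s \<beta>) = min (t * D u v) (t * ?s \<beta>)"
    using assms(2) by (simp add: min_mult_distrib_left)
  also have "\<dots> \<le> min (D u v) (?s \<alpha>)"
  proof (rule min.mono)
    show "t * D u v \<le> D u v" using assms(1)[of u v] uv assms(2,3) by (intro mult_left_le_one_le) auto
    show "t * ?s \<beta> \<le> ?s \<alpha>" unfolding sum_distrib_left using assms(4) by (intro sum_mono) auto
  qed
  finally show "t * min (D u v) (?s \<beta>) \<le> min (D u v) (?s \<alpha>)" .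
qed

locale switch =
  fixes I :: "nat switch_instance"
  assumes valid: "valid_instance I"
begin

definition lefts :: "nat list" where "lefts = sorted_list_of_set (left I)"
definition rights :: "nat list" where "rights = sorted_list_of_set (right I)"
definition a :: nat where "a = length lefts"
definition b :: nat where "b = length rights"
definition D :: "nat \<Rightarrow> nat \<Rightarrow> real" where "D u v = demand I (lefts ! u, rights ! v)"

lemma lefts: "distinct lefts" "set lefts = left I" and rights: "distinct rights" "set rights = right I"
  using valid by (auto simp: lefts_def rights_def valid_instance_def)

lemma ab: "a = card (left I)" "b = card (right I)" "a * b = card (edges I)"
  using distinct_card[OF lefts(1)] distinct_card[OF rights(1)] lefts rights
  by (auto simp: a_def b_def edges_def card_cartesian_product)

lemma bij_lefts: "bij_betw (\<lambda>u. lefts ! u) {..<a} (left I)"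
  and bij_rights: "bij_betw (\<lambda>v. rights ! v) {..<b} (right I)"
  using bij_betw_nth[OF lefts(1) refl] bij_betw_nth[OF rights(1) refl] lefts rights
  by (auto simp: a_def b_def)

lemma lefts_in: "u < a \<Longrightarrow> lefts ! u \<in> left I" and rights_in: "v < b \<Longrightarrow> rights ! v \<in> right I"
  using bij_lefts bij_rights by (auto dest: bij_betwE)

lemma lefts_eq_iff: "u < a \<Longrightarrow> u' < a \<Longrightarrow> lefts ! u = lefts ! u' \<longleftrightarrow> u = u'"
  and rights_eq_iff: "v < b \<Longrightarrow> v' < b \<Longrightarrow> rights ! v = rights ! v' \<longleftrightarrow> v = v'"
  using lefts rights by (auto simp: nth_eq_iff_index_eq a_def b_def)

lemma D_nonneg: "u < a \<Longrightarrow> v < b \<Longrightarrow> 0 \<le> D u v"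
  using valid lefts_in rights_in by (auto simp: D_def valid_instance_def edges_def)

lemma sum_edges: "(\<Sum>e\<in>edges I. h e) = (\<Sum>u<a. \<Sum>v<b. h (lefts ! u, rights ! v))"
proof -
  have "(\<Sum>e\<in>edges I. h e) = (\<Sum>x\<in>left I. \<Sum>y\<in>right I. h (x, y))"
    by (simp add: edges_def sum.cartesian_product)
  also have "\<dots> = (\<Sum>u<a. \<Sum>y\<in>right I. h (lefts ! u, y))"
    by (rule sum.reindex_bij_betw[OF bij_lefts, symmetric])
  also have "\<dots> = (\<Sum>u<a. \<Sum>v<b. h (lefts ! u, rights ! v))"
    by (intro sum.cong refl sum.reindex_bij_betw[OF bij_rights, symmetric])
  finally show ?thesis .
qed

definition matching_of :: "(nat \<Rightarrow> nat) \<Rightarrow> (nat \<times> nat) set" where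
  "matching_of own = {(lefts ! (own v - 1), rights ! v) | v. v < b \<and> 0 < own v}"

definition schedule_of :: "nat \<Rightarrow> (nat \<Rightarrow> nat \<Rightarrow> nat) \<Rightarrow> (nat \<Rightarrow> real) \<Rightarrow> nat schedule" where
  "schedule_of m own \<alpha> = (\<lambda>i. (matching_of (own i), \<alpha> i)) ` {..<m}"

lemma matching_of_iff:
  assumes "valid_owner a b own" "u < a" "v < b"
  shows "(lefts ! u, rights ! v) \<in> matching_of own \<longleftrightarrow> own v = Suc u"
proof
  assume "(lefts ! u, rights ! v) \<in> matching_of own"
  then obtain v' where v': "v' < b" "0 < own v'" "lefts ! u = lefts ! (own v' - 1)" "rights ! v = rights ! v'"
    by (auto simp: matching_of_def)
  have "own v' - 1 < a" using assms(1) v'(1,2) by (auto simp: valid_owner_def)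
  then show "own v = Suc u" using v' assms lefts_eq_iff rights_eq_iff by auto
next
  assume "own v = Suc u"
  then show "(lefts ! u, rights ! v) \<in> matching_of own"
    using assms by (auto simp: matching_of_def intro!: exI[of _ v])
qed

lemma is_matching_matching_of:
  assumes "valid_owner a b own"
  shows "is_matching I (matching_of own)"
proof -
  have le: "own v - 1 < a" if "v < b" "0 < own v" for v
    using assms that by (auto simp: valid_owner_def)
  have disj: "left I \<inter> right I = {}" using valid by (simp add: valid_instance_def)
  have "{lefts ! (own v - 1), rights ! v} \<inter> {lefts ! (own v' - 1), rights ! v'} = {}"
    if v: "v < b" "0 < own v" "v' < b" "0 < own v'" "v \<noteq> v'" for v v'
  proof -
    have "own v \<noteq> own v'" using assms v by (auto simp: valid_owner_def)
    then have "lefts ! (own v - 1) \<noteq> lefts ! (own v' - 1)"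
      using v le[OF v(1,2)] le[OF v(3,4)] lefts_eq_iff by auto
    moreover have "rights ! v \<noteq> rights ! v'" using v rights_eq_iff by auto
    ultimately show ?thesis
      using disj lefts_in[OF le[OF v(1,2)]] lefts_in[OF le[OF v(3,4)]] rights_in[OF v(1)] rights_in[OF v(3)]
      by auto
  qed
  note disjoint = this
  show ?thesis unfolding is_matching_def
  proof (intro conjI ballI impI)
    show "matching_of own \<subseteq> edges I"
      using lefts_in[OF le] rights_in by (auto simp: matching_of_def edges_def)
    fix e f assume "e \<in> matching_of own" "f \<in> matching_of own" and ef: "e \<noteq> f"
    then obtain v v' where v: "v < b" "0 < own v" "e = (lefts ! (own v - 1), rights ! v)"
        "v' < b" "0 < own v'" "f = (lefts ! (own v' - 1), rights ! v')"
      unfolding matching_of_def by blast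
    with ef have "v \<noteq> v'" by auto
    from disjoint[OF v(1,2,4,5) this] v(3,6) show "{fst e, snd e} \<inter> {fst f, snd f} = {}" by simp
  qed
qed

text \<open>Injectivity of \<alpha> keeps the \<open>m\<close> pairs distinct even if matchings
  coincide, so that sums over the set are sums over the indices.\<close>

lemma schedule_of:
  assumes own: "\<And>i. i < m \<Longrightarrow> valid_owner a b (own i)" and \<alpha>: "\<And>i. i < m \<Longrightarrow> 0 \<le> \<alpha> i"
    and inj: "inj_on \<alpha> {..<m}" and sum: "(\<Sum>i<m. \<alpha> i) + real m * delay I \<le> window I"
  shows "feasible I (schedule_of m own \<alpha>)"
    and "schedule_value I (schedule_of m own \<alpha>) = load_value a b D m own \<alpha>"
proof -
  have inj': "inj_on (\<lambda>i. (matching_of (own i), \<alpha> i)) A" if "A \<subseteq> {..<m}" for A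
    using inj_on_subset[OF inj that] by (auto simp: inj_on_def)
  have "(\<Sum>(M, \<alpha>)\<in>schedule_of m own \<alpha>. \<alpha> + delay I) = (\<Sum>i<m. \<alpha> i + delay I)"
    unfolding schedule_of_def by (simp add: sum.reindex[OF inj'])
  also have "\<dots> \<le> window I" using sum by (simp add: sum.distrib)
  finally show "feasible I (schedule_of m own \<alpha>)"
    using own \<alpha> is_matching_matching_of
    by (auto simp: feasible_def is_schedule_def schedule_of_def)
  show "schedule_value I (schedule_of m own \<alpha>) = load_value a b D m own \<alpha>"
    unfolding schedule_value_def sum_edges load_value_def
  proof (intro sum.cong refl arg_cong2[where f = min])
    fix u v assume uv: "u \<in> {..<a}" "v \<in> {..<b}"
    then show "demand I (lefts ! u, rights ! v) = D u v" by (simp add: D_def)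
    have "{(M, x). (M, x) \<in> schedule_of m own \<alpha> \<and> (lefts ! u, rights ! v) \<in> M} =
        (\<lambda>i. (matching_of (own i), \<alpha> i)) ` {i\<in>{..<m}. own i v = Suc u}"
      using uv own matching_of_iff by (auto simp: schedule_of_def)
    then have "(\<Sum>(M, x)\<in>{(M, x). (M, x) \<in> schedule_of m own \<alpha> \<and> (lefts ! u, rights ! v) \<in> M}. x) =
        (\<Sum>i\<in>{i\<in>{..<m}. own i v = Suc u}. \<alpha> i)"
      by (simp only:) (subst sum.reindex, auto intro!: inj')
    then show "(\<Sum>(M, x)\<in>{(M, x). (M, x) \<in> schedule_of m own \<alpha> \<and> (lefts ! u, rights ! v) \<in> M}. x) =
        (\<Sum>i<m. if own i v = Suc u then \<alpha> i else 0)"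
      unfolding sum.inter_filter[OF finite_lessThan] .
  qed
qed

text \<open>The converse translation, applied to the schedule with which the output is compared.
  Enumerating it by decreasing duration provides the order that \<open>round_durations\<close> asks
  for.\<close>

lemma feasible_schedule_cases:
  assumes "feasible I S"
  obtains own \<beta> where
    "\<And>i. i < card S \<Longrightarrow> valid_owner a b (own i)" "\<And>i. i < card S \<Longrightarrow> 0 \<le> \<beta> i"
    "\<And>i j. i \<le> j \<Longrightarrow> j < card S \<Longrightarrow> \<beta> j \<le> \<beta> i"
    "sum \<beta> {..<card S} + real (card S) * delay I \<le> window I"
    "schedule_value I S = load_value a b D (card S) own \<beta>"
proof -
  have S: "finite S" "\<And>M x. (M, x) \<in> S \<Longrightarrow> is_matching I M \<and> 0 \<le> x"
    "(\<Sum>(M, x)\<in>S. x + delay I) \<le> window I"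
    using assms by (auto simp: feasible_def is_schedule_def)
  obtain xs0 where xs0: "set xs0 = S" "distinct xs0" using finite_distinct_list[OF S(1)] by blast
  define xs where "xs = sort_key (\<lambda>c. - snd c) xs0"
  have xs: "set xs = S" "distinct xs" "sorted (map (\<lambda>c. - snd c) xs)"
    using xs0 by (auto simp: xs_def)
  have len: "length xs = card S" using xs distinct_card by metis
  define \<beta> where "\<beta> i = snd (xs ! i)" for i
  define M where "M i = fst (xs ! i)" for i
  have bij: "bij_betw (\<lambda>i. (M i, \<beta> i)) {..<card S} S"
    using bij_betw_nth[OF xs(2) refl refl] xs(1) len by (simp add: M_def \<beta>_def)
  have in_S: "(M i, \<beta> i) \<in> S" if "i < card S" for i
    using bij that by (auto dest: bij_betwE)
  define P where "P i v u \<longleftrightarrow> u < a \<and> (lefts ! u, rights ! v) \<in> M i" for i v u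
  \<comment> \<open>In a matching at most one left vertex meets \<open>v\<close>, so the choice is
    unique.\<close>
  define own where "own i v = (if Ex (P i v) then Suc (Eps (P i v)) else 0)" for i v
  have M: "e = f" if "i < card S" "e \<in> M i" "f \<in> M i" "{fst e, snd e} \<inter> {fst f, snd f} \<noteq> {}" for i e f
    using S(2)[OF in_S[OF that(1)]] that unfolding is_matching_def by metis
  have P_unique: "u' = u" if "i < card S" "P i v u'" "P i v u" for i u v u'
    using that M[OF that(1), of "(lefts ! u', rights ! v)" "(lefts ! u, rights ! v)"] lefts_eq_iff
    by (auto simp: P_def)
  have own_Suc: "own i v = Suc u \<longleftrightarrow> (lefts ! u, rights ! v) \<in> M i" if "i < card S" "u < a" "v < b" for i u v
  proof -
    have "own i v = Suc u \<longleftrightarrow> P i v u"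
    proof
      assume "own i v = Suc u"
      then have "Ex (P i v)" "Eps (P i v) = u" by (auto simp: own_def split: if_splits)
      then show "P i v u" using someI_ex by metis
    next
      assume u: "P i v u"
      then have "Eps (P i v) = u" using P_unique[OF that(1)] by (intro some_equality) auto
      then show "own i v = Suc u" using u by (auto simp: own_def)
    qed
    then show ?thesis using that(2) by (simp add: P_def)
  qed
  have own_le: "own i v \<le> a" for i v
  proof (cases "Ex (P i v)")
    case True
    then have "P i v (Eps (P i v))" by (rule someI_ex)
    then have "Eps (P i v) < a" unfolding P_def[of i v "Eps (P i v)"] by blast
    then show ?thesis by (simp add: own_def)
  next
    case False
    then show ?thesis unfolding own_def by (subst if_not_P) auto
  qed
  show ?thesis
  proof (rule that[of own \<beta>])
    fix i assume i: "i < card S"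
    show "0 \<le> \<beta> i" using S(2)[OF in_S[OF i]] by simp
    show "valid_owner a b (own i)" unfolding valid_owner_def
    proof (intro conjI allI impI own_le)
      fix v v' assume v: "v < b" "v' < b" "own i v = own i v'" "own i v \<noteq> 0"
      define u where "u = own i v - 1"
      have u: "own i v = Suc u" "u < a" using v(4) own_le[of i v] by (simp_all add: u_def)
      then have "(lefts ! u, rights ! v) \<in> M i" "(lefts ! u, rights ! v') \<in> M i"
        using own_Suc[OF i u(2) v(1)] own_Suc[OF i u(2) v(2)] v(3) by simp_all
      from M[OF i this] have "(lefts ! u, rights ! v) = (lefts ! u, rights ! v')" by simp
      then show "v = v'" using rights_eq_iff[OF v(1,2)] by simp
    qed
  next
    fix i j assume ij: "i \<le> j" "j < card S"
    show "\<beta> j \<le> \<beta> i"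
      using sorted_nth_mono[OF xs(3) ij(1)] ij len by (simp add: \<beta>_def)
  next
    have "sum \<beta> {..<card S} + real (card S) * delay I = (\<Sum>i<card S. \<beta> i + delay I)"
      by (simp add: sum.distrib)
    also have "\<dots> = (\<Sum>(M, x)\<in>S. x + delay I)"
      using sum.reindex_bij_betw[OF bij, of "\<lambda>(M, x). x + delay I"] by simp
    finally show "sum \<beta> {..<card S} + real (card S) * delay I \<le> window I" using S(3) by simp
  next
    show "schedule_value I S = load_value a b D (card S) own \<beta>"
      unfolding schedule_value_def sum_edges load_value_def
    proof (intro sum.cong refl arg_cong2[where f = min])
      fix u v assume uv: "u \<in> {..<a}" "v \<in> {..<b}"
      then show "demand I (lefts ! u, rights ! v) = D u v" by (simp add: D_def)
      have bij': "bij_betw (\<lambda>i. (M i, \<beta> i)) {i\<in>{..<card S}. own i v = Suc u}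
          {(M, x). (M, x) \<in> S \<and> (lefts ! u, rights ! v) \<in> M}"
      proof (rule bij_betw_imageI)
        show "inj_on (\<lambda>i. (M i, \<beta> i)) {i\<in>{..<card S}. own i v = Suc u}"
          by (rule inj_on_subset[OF bij_betw_imp_inj_on[OF bij]]) auto
        show "(\<lambda>i. (M i, \<beta> i)) ` {i\<in>{..<card S}. own i v = Suc u} =
            {(M, x). (M, x) \<in> S \<and> (lefts ! u, rights ! v) \<in> M}"
        proof safe
          fix i assume i: "i < card S" "own i v = Suc u"
          then show "(M i, \<beta> i) \<in> S" by (intro in_S)
          show "(lefts ! u, rights ! v) \<in> M i" using own_Suc[OF i(1)] i(2) uv by simp
        next
          fix N x assume N: "(N, x) \<in> S" "(lefts ! u, rights ! v) \<in> N"
          then obtain i where i: "i < card S" "N = M i" "x = \<beta> i"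
            using bij_betw_imp_surj_on[OF bij] by blast
          then have "own i v = Suc u" using N own_Suc[OF i(1)] uv by simp
          then show "(N, x) \<in> (\<lambda>i. (M i, \<beta> i)) ` {i \<in> {..<card S}. own i v = Suc u}"
            using i by blast
        qed
      qed
      have "(\<Sum>(M, x)\<in>{(M, x). (M, x) \<in> S \<and> (lefts ! u, rights ! v) \<in> M}. x) =
          (\<Sum>i\<in>{i\<in>{..<card S}. own i v = Suc u}. \<beta> i)"
        using sum.reindex_bij_betw[OF bij', of "\<lambda>(M, x). x"] by simp
      then show "(\<Sum>(M, x)\<in>{(M, x). (M, x) \<in> S \<and> (lefts ! u, rights ! v) \<in> M}. x) =
          (\<Sum>i<card S. if own i v = Suc u then \<beta> i else 0)"
        unfolding sum.inter_filter[OF finite_lessThan] .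
    qed
  qed
qed

end


section \<open>Weakest preconditions\<close>

definition wp :: "nat \<Rightarrow> cmd \<Rightarrow> (machine_state \<Rightarrow> bool) \<Rightarrow> machine_state \<Rightarrow> bool" where
  "wp B c Q s \<longleftrightarrow> ok B c s \<and> Q (sem c s)"

lemma wp_simps:
  "wp B NOP Q s \<longleftrightarrow> Q s"
  "wp B (NSet i e) Q s \<longleftrightarrow> nok B e s \<and> Q (set_nreg i (neval e s) s)"
  "wp B (RSet i x) Q s \<longleftrightarrow> rok B x s \<and> Q (set_rreg i (reval x s) s)"
  "wp B (NPut l d e) Q s \<longleftrightarrow> nok B d s \<and> nok B e s \<and> Q (put_narr l (neval d s) (neval e s) s)"
  "wp B (RPut l d x) Q s \<longleftrightarrow> nok B d s \<and> rok B x s \<and> Q (put_rarr l (neval d s) (reval x s) s)"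
  "wp B (c ;; c') Q s \<longleftrightarrow> wp B c (wp B c' Q) s"
  "wp B (IF p c c') Q s \<longleftrightarrow> bok B p s \<and> (if beval p s then wp B c Q s else wp B c' Q s)"
  by (auto simp: wp_def)

lemma wp_FOR:
  assumes "nok B e s" "neval e s = n" "n \<le> B" "I 0 s"
    and "\<And>j t. j < n \<Longrightarrow> I j t \<Longrightarrow> frame (FOR i e c) s t \<Longrightarrow> wp B c (I (Suc j)) (set_nreg i j t)"
    and "\<And>t. I n t \<Longrightarrow> frame (FOR i e c) s t \<Longrightarrow> Q t"
  shows "wp B (FOR i e c) Q s"
  using for_rule[of B e s n I i c] assms frame_sem unfolding wp_def by meson

text \<open>Rule for subprograms: the specification \<open>P\<close> states only the outputs, and
  the frame supplies everything that is not written.\<close>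

lemma wp_call:
  assumes "wp B c P s" "\<And>t. P t \<Longrightarrow> frame c s t \<Longrightarrow> Q t"
  shows "wp B c Q s"
  using assms frame_sem unfolding wp_def by blast

lemma frame_trans:
  assumes "frame c s t" "frame d t u"
    and "written d \<subseteq> written c"
  shows "frame c s u"
  using assms unfolding frame_def by auto

text \<open>Two nested loops are treated as one loop over the row-major index
  \<open>u * n2 + v\<close>. The invariant is carried across assignments to both counters and so
  must not depend on them.\<close>

lemma wp_FOR_FOR:
  assumes "nreg s x = n1" "nreg s y = n2" "n1 \<le> B" "n2 \<le> B"
    and regs: "i \<noteq> j" "NReg y \<notin> {NReg i, NReg j} \<union> written c" "NReg i \<notin> written c"
    and set_reg: "\<And>k t z. I k t \<Longrightarrow> I k (set_nreg i z t)" "\<And>k t z. I k t \<Longrightarrow> I k (set_nreg j z t)"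
    and "I 0 s"
    and step: "\<And>u v t. u < n1 \<Longrightarrow> v < n2 \<Longrightarrow> I (u * n2 + v) t \<Longrightarrow> nreg t i = u \<Longrightarrow> nreg t j = v \<Longrightarrow>
      frame (FOR i (NV x) (FOR j (NV y) c)) s t \<Longrightarrow> wp B c (I (Suc (u * n2 + v))) t"
    and Q: "\<And>t. I (n1 * n2) t \<Longrightarrow> frame (FOR i (NV x) (FOR j (NV y) c)) s t \<Longrightarrow> Q t"
  shows "wp B (FOR i (NV x) (FOR j (NV y) c)) Q s"
proof (rule wp_FOR[where n = n1 and I = "\<lambda>u. I (u * n2)"], goal_cases)
  case (5 u t)
  let ?t = "set_nreg i u t"
  have frt: "frame (FOR i (NV x) (FOR j (NV y) c)) s ?t"
    using 5(3) by (auto simp: frame_def)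
  show ?case
  proof (rule wp_FOR[where n = n2 and I = "\<lambda>v. I (u * n2 + v)"], goal_cases)
    case 2
    then show ?case using frame_simps(1)[OF frt, of y] assms(2) regs by simp
  next
    case (5 v t')
    have fr: "frame (FOR i (NV x) (FOR j (NV y) c)) s t'"
      by (rule frame_trans[OF frt 5(3)]) auto
    have i: "nreg t' i = u" using frame_simps(1)[OF 5(3), of i] regs by simp
    show ?case unfolding add_Suc_right
    proof (rule step)
      show "frame (FOR i (NV x) (FOR j (NV y) c)) s (set_nreg j v t')"
        using fr by (auto simp: frame_def)
    qed (use 5 \<open>u < n1\<close> set_reg i regs in auto)
  qed (use 5 assms set_reg in \<open>auto simp: add.commute\<close>)
qed (use assms in auto)

definition NMod :: "nexp \<Rightarrow> nexp \<Rightarrow> nexp" where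
  "NMod x y = NMinus x (NTimes (NDiv x y) y)"

lemma NMod_simps [simp]:
  "neval (NMod x y) s = neval x s mod neval y s"
  "nok B (NMod x y) s \<longleftrightarrow> nok B x s \<and> nok B y s \<and> neval x s \<le> B \<and> 0 < neval y s \<and> neval y s \<le> B"
  "nwf (NMod x y) \<longleftrightarrow> nwf x \<and> nwf y"
  by (auto simp: NMod_def minus_div_mult_eq_mod)

abbreviation (input) "RPlus \<equiv> RBin Plus"
abbreviation (input) "RMinus \<equiv> RBin Minus"
abbreviation (input) "RTimes \<equiv> RBin Times"
abbreviation (input) "RDivide \<equiv> RBin Divide"

text \<open>Equality of naturals by truncated subtraction: both differences are 0.\<close>

definition NEq :: "nexp \<Rightarrow> nexp \<Rightarrow> bexp" where
  "NEq x y = NLeq (NPlus (NMinus x y) (NMinus y x)) (NC 0)"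

lemma NEq_simps [simp]:
  "beval (NEq x y) s \<longleftrightarrow> neval x s = neval y s"
  "bok B (NEq x y) s \<longleftrightarrow> nok B x s \<and> nok B y s"
  "bwf (NEq x y) \<longleftrightarrow> nwf x \<and> nwf y"
  by (auto simp: NEq_def)


section \<open>The program\<close>

abbreviation (input) "n_k \<equiv> (3::nat)"
abbreviation (input) "n_a \<equiv> (4::nat)"
abbreviation (input) "n_b \<equiv> (5::nat)"
abbreviation (input) "n_r \<equiv> (6::nat)"
abbreviation (input) "n_m0 \<equiv> (7::nat)"
abbreviation (input) "n_m \<equiv> (8::nat)"
abbreviation (input) "n_guesses \<equiv> (9::nat)"
abbreviation (input) "n_vectors \<equiv> (10::nat)"
abbreviation (input) "n_i \<equiv> (11::nat)"
abbreviation (input) "n_x \<equiv> (12::nat)"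
abbreviation (input) "n_z \<equiv> (13::nat)"
abbreviation (input) "n_c \<equiv> (14::nat)"
abbreviation (input) "n_j \<equiv> (15::nat)"
abbreviation (input) "n_u \<equiv> (16::nat)"
abbreviation (input) "n_v \<equiv> (17::nat)"
abbreviation (input) "n_y \<equiv> (18::nat)"
abbreviation (input) "n_d \<equiv> (19::nat)"
abbreviation (input) "n_dj \<equiv> (20::nat)"
abbreviation (input) "n_bidder \<equiv> (21::nat)"
abbreviation (input) "n_item \<equiv> (22::nat)"
abbreviation (input) "n_o \<equiv> (23::nat)"
abbreviation (input) "n_t \<equiv> (24::nat)"

abbreviation (input) "r_delay \<equiv> (0::nat)"
abbreviation (input) "r_window \<equiv> (1::nat)"
abbreviation (input) "r_best \<equiv> (2::nat)"
abbreviation (input) "r_len \<equiv> (3::nat)"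
abbreviation (input) "r_unit \<equiv> (4::nat)"
abbreviation (input) "r_sum \<equiv> (5::nat)"
abbreviation (input) "r_acc \<equiv> (6::nat)"
abbreviation (input) "r_load \<equiv> (7::nat)"
abbreviation (input) "r_wmax \<equiv> (8::nat)"
abbreviation (input) "r_eta \<equiv> (9::nat)"
abbreviation (input) "r_profit \<equiv> (10::nat)"

abbreviation (input) "Lefts \<equiv> (3::nat)"
abbreviation (input) "Rights \<equiv> (4::nat)"
abbreviation (input) "Table \<equiv> (5::nat)"
abbreviation (input) "Price \<equiv> (6::nat)"
abbreviation (input) "Owner \<equiv> (7::nat)"
abbreviation (input) "Status \<equiv> (8::nat)"
abbreviation (input) "Radix \<equiv> (9::nat)"

abbreviation (input) "Demand \<equiv> (1::nat)"
abbreviation (input) "Duration \<equiv> (2::nat)"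
abbreviation (input) "Weight \<equiv> (3::nat)"

definition edge_exp :: nexp where
  "edge_exp = NPlus (NTimes (NV n_u) (NV n_b)) (NV n_v)"

definition entry_exp :: "nexp \<Rightarrow> nexp \<Rightarrow> nexp" where
  "entry_exp i d = NPlus (NTimes (NPlus (NTimes i (NV n_r)) d) (NV n_b)) (NV n_v)"

definition next_digit :: "nexp \<Rightarrow> cmd" where
  "next_digit e = NSet n_d (NMod (NV n_z) e);; NSet n_z (NDiv (NV n_z) e)"

text \<open>One pass over the digits of the colour vector \<open>n_y\<close> adds up the load of the
  current edge and also keeps the colour of configuration \<open>n_j\<close> in \<open>n_dj\<close>,
  from which \<open>weights_cmd\<close> decides whether the vector counts.\<close>

definition load_cmd :: cmd where
  "load_cmd = RSet r_load (RC 0);; NSet n_z (NV n_y);; FOR n_i (NV n_m) (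
     next_digit (NV n_r);;
     IF (NEq (NGet Table (entry_exp (NV n_i) (NV n_d))) (NPlus (NV n_u) (NC 1)))
       (RSet r_load (RPlus (RV r_load) (RGet Duration (NV n_i)))) NOP;;
     IF (NEq (NV n_i) (NV n_j)) (NSet n_dj (NV n_d)) NOP)"

definition weights_cmd :: cmd where
  "weights_cmd = FOR n_u (NV n_a) (FOR n_v (NV n_b) (
     RSet r_acc (RC 0);;
     FOR n_y (NV n_vectors) (
       load_cmd;;
       IF (NEq (NV n_dj) (NV n_c))
         (RSet r_acc (RPlus (RV r_acc)
           (RMinus (RMin (RGet Demand edge_exp) (RPlus (RGet Duration (NV n_j)) (RV r_load)))
             (RMin (RGet Demand edge_exp) (RV r_load))))) NOP);;
     RPut Weight edge_exp (RV r_acc)))"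

text \<open>The value \<open>n_a\<close> means that nobody is waiting; \<open>n_b\<close> plays the
  same role in \<open>find_item_cmd\<close> when no item is profitable.\<close>

definition find_bidder_cmd :: cmd where
  "find_bidder_cmd = NSet n_bidder (NV n_a);;
     FOR n_u (NV n_a) (IF (NEq (NGet Status (NV n_u)) (NC 0)) (NSet n_bidder (NV n_u)) NOP)"

definition find_item_cmd :: cmd where
  "find_item_cmd = RSet r_profit (RC 0);; NSet n_item (NV n_b);; NSet n_u (NV n_bidder);;
     FOR n_v (NV n_b) (
       RSet r_acc (RMinus (RGet Weight edge_exp) (RTimes (RV r_eta) (ROf (NGet Price (NV n_v)))));;
       IF (RLt (RV r_profit) (RV r_acc)) (RSet r_profit (RV r_acc);; NSet n_item (NV n_v)) NOP)"

definition assign_cmd :: cmd where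
  "assign_cmd = IF (NLt (NV n_item) (NV n_b)) (
       NSet n_o (NGet Owner (NV n_item));;
       IF (NLt (NC 0) (NV n_o)) (NPut Status (NMinus (NV n_o) (NC 1)) (NC 0)) NOP;;
       NPut Status (NV n_bidder) (NC 1);;
       NPut Owner (NV n_item) (NPlus (NV n_bidder) (NC 1));;
       NPut Price (NV n_item) (NPlus (NGet Price (NV n_item)) (NC 1)))
     (NPut Status (NV n_bidder) (NC 2))"

definition bid_cmd :: cmd where
  "bid_cmd = find_bidder_cmd;; IF (NLt (NV n_bidder) (NV n_a)) (find_item_cmd;; assign_cmd) NOP"

definition wmax_cmd :: cmd where
  "wmax_cmd = RSet r_wmax (RC 0);;
     FOR n_u (NV n_a) (FOR n_v (NV n_b)
       (IF (RLt (RV r_wmax) (RGet Weight edge_exp)) (RSet r_wmax (RGet Weight edge_exp)) NOP))"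

definition reset_cmd :: cmd where
  "reset_cmd = FOR n_v (NV n_b) (NPut Price (NV n_v) (NC 0);; NPut Owner (NV n_v) (NC 0));;
     FOR n_u (NV n_a) (NPut Status (NV n_u) (NC 0))"

definition auction_cmd :: cmd where
  "auction_cmd = wmax_cmd;;
     RSet r_eta (RDivide (RV r_wmax) (RTimes (ROf (NV n_a)) (ROf (NV n_r))));;
     reset_cmd;;
     FOR n_t (NPlus (NPlus (NTimes (NV n_b) (NTimes (NV n_a) (NV n_r))) (NV n_a)) (NC 1)) bid_cmd"

definition greedy_cmd :: cmd where
  "greedy_cmd =
     FOR n_t (NTimes (NTimes (NV n_m) (NV n_r)) (NV n_b)) (NPut Table (NV n_t) (NC 0));;
     FOR n_c (NV n_r) (FOR n_j (NV n_m) (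
       weights_cmd;; auction_cmd;;
       FOR n_v (NV n_b) (NPut Table (entry_exp (NV n_j) (NV n_c)) (NGet Owner (NV n_v)))))"

definition value_cmd :: cmd where
  "value_cmd = RSet r_acc (RC 0);; FOR n_u (NV n_a) (FOR n_v (NV n_b) (
     load_cmd;; RSet r_acc (RPlus (RV r_acc) (RMin (RGet Demand edge_exp) (RV r_load)))))"

definition output_cmd :: cmd where
  "output_cmd = NSet 0 (NV n_m);; NSet 1 (NC 0);; NSet n_z (NV n_y);; FOR n_i (NV n_m) (
     next_digit (NV n_r);;
     RPut 0 (NV n_i) (RGet Duration (NV n_i));;
     FOR n_v (NV n_b) (
       NSet n_o (NGet Table (entry_exp (NV n_i) (NV n_d)));;
       IF (NLt (NC 0) (NV n_o)) (
         NPut 0 (NV 1) (NV n_i);;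
         NPut 1 (NV 1) (NGet Lefts (NMinus (NV n_o) (NC 1)));;
         NPut 2 (NV 1) (NGet Rights (NV n_v));;
         NSet 1 (NPlus (NV 1) (NC 1))) NOP))"

definition select_cmd :: cmd where
  "select_cmd = FOR n_y (NV n_vectors) (
     value_cmd;; IF (RLt (RV r_best) (RV r_acc)) (RSet r_best (RV r_acc);; output_cmd) NOP)"

definition durations_cmd :: cmd where
  "durations_cmd = NSet n_z (NV n_x);; RSet r_sum (RC 0);; FOR n_i (NV n_m) (
     next_digit (NGet Radix (NV n_i));;
     RPut Duration (NV n_i) (RTimes (RV r_unit) (RPlus (ROf (NV n_d)) (RDivide (ROf (NV n_i)) (ROf (NV n_m)))));;
     RSet r_sum (RPlus (RV r_sum) (RGet Duration (NV n_i))))"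

definition radix_cmd :: cmd where
  "radix_cmd = NSet n_guesses (NC 1);; NSet n_vectors (NC 1);; FOR n_i (NV n_m) (
     NPut Radix (NV n_i) (NPlus (NDiv (NTimes (NV n_r) (NV n_m)) (NPlus (NV n_i) (NC 1))) (NC 2));;
     NSet n_guesses (NTimes (NV n_guesses) (NGet Radix (NV n_i)));;
     NSet n_vectors (NTimes (NV n_vectors) (NV n_r)))"

definition guess_cmd :: cmd where
  "guess_cmd = durations_cmd;; IF (RLeq (RV r_sum) (RV r_len)) (greedy_cmd;; select_cmd) NOP"

text \<open>If the delays of \<open>n_m\<close> configurations use up the window, all durations are
  0 and the round can be skipped.\<close>

definition round_cmd :: cmd where
  "round_cmd = NSet n_m (NPlus (NV n_m0) (NC 1));;
     RSet r_len (RMinus (RV r_window) (RTimes (ROf (NV n_m)) (RV r_delay)));;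
     IF (RLt (RC 0) (RV r_len)) (
       RSet r_unit (RDivide (RV r_len) (RTimes (ROf (NV n_r)) (ROf (NV n_m))));;
       radix_cmd;;
       FOR n_x (NV n_guesses) guess_cmd) NOP"

text \<open>Input and output share registers and arrays, so the input is first moved out of the way.
  A zero in register 0 makes the current output the empty schedule, whose value is the initial
  \<open>r_best\<close>.\<close>

definition init_cmd :: cmd where
  "init_cmd = NSet n_k (NV 0);; NSet n_a (NV 1);; NSet n_b (NV 2);;
     FOR n_u (NV n_a) (NPut Lefts (NV n_u) (NGet 0 (NV n_u)));;
     FOR n_v (NV n_b) (NPut Rights (NV n_v) (NGet 1 (NV n_v)));;
     FOR n_u (NV n_a) (FOR n_v (NV n_b) (RPut Demand edge_exp (RGet 0 edge_exp)));;
     NSet 0 (NC 0);; NSet 1 (NC 0);; RSet r_best (RC 0)"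

definition main_cmd :: cmd where
  "main_cmd = init_cmd;; FOR n_m0 (NV n_k) round_cmd"


section \<open>Correctness of weights and auctions\<close>

lemma row_major [simp]: "v < b \<Longrightarrow> (u * b + v) div b = u" "v < b \<Longrightarrow> (u * b + v) mod b = (v::nat)"
  by auto

lemma row_major_less: "u < a \<Longrightarrow> v < b \<Longrightarrow> u * b + v < a * (b::nat)"
  by (metis add.commute add_less_cancel_left less_le_trans mult_Suc mult_le_mono1 Suc_leI)

lemma row_major_eq_iff: "v < b \<Longrightarrow> v' < b \<Longrightarrow> u * b + v = u' * b + v' \<longleftrightarrow> u = u' \<and> v = (v'::nat)"
  by (metis row_major)

definition table_load :: "nat \<Rightarrow> nat \<Rightarrow> nat \<Rightarrow> (nat \<Rightarrow> real) \<Rightarrow> (nat \<Rightarrow> nat) \<Rightarrow> nat \<Rightarrow> nat \<Rightarrow> nat \<Rightarrow> real" where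
  "table_load r b m \<alpha> T y u v =
     (\<Sum>i<m. if T ((i * r + dig (\<lambda>_. r) y i) * b + v) = Suc u then \<alpha> i else 0)"

lemma written_load_cmd [simp]:
  "written load_cmd = {NReg n_z, NReg n_i, NReg n_d, NReg n_dj, RReg r_load}"
  by (auto simp: load_cmd_def next_digit_def)

lemma wp_load_cmd:
  assumes "nreg s n_m = m" "nreg s n_r = r" "nreg s n_b = b" "0 < r" "r \<le> B" "b \<le> B" "m \<le> B" "nreg s n_y \<le> B"
  shows "wp B load_cmd (\<lambda>t.
    rreg t r_load = table_load r b m (rarr s Duration) (narr s Table) (nreg s n_y) (nreg s n_u) (nreg s n_v) \<and>
    (nreg s n_j < m \<longrightarrow> nreg t n_dj = dig (\<lambda>_. r) (nreg s n_y) (nreg s n_j))) s"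
proof -
  define I where "I i t \<longleftrightarrow>
    rreg t r_load = table_load r b i (rarr s Duration) (narr s Table) (nreg s n_y) (nreg s n_u) (nreg s n_v) \<and>
    nreg t n_z = quo (\<lambda>_. r) (nreg s n_y) i \<and>
    (nreg s n_j < i \<longrightarrow> nreg t n_dj = dig (\<lambda>_. r) (nreg s n_y) (nreg s n_j))" for i and t :: machine_state
  show ?thesis
    unfolding load_cmd_def wp_simps
  proof (intro conjI wp_FOR[where n = m and I = I], goal_cases)
    case (7 i t)
    note [simp] = frame_simps[OF 7(3)]
    have [simp]: "quo (\<lambda>_. r) (nreg s n_y) i \<le> B" using quo_le assms(8) le_trans by blast
    show ?case using 7(1,2) assms
      by (auto simp: I_def next_digit_def wp_simps entry_exp_def table_load_def dig_def less_Suc_eq)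
  qed (use assms in \<open>auto simp: I_def table_load_def\<close>)
qed


lemma written_weights_cmd [simp]:
  "written weights_cmd = {NReg n_u, NReg n_v, NReg n_y, NReg n_z, NReg n_i, NReg n_d, NReg n_dj, RReg r_acc,
     RReg r_load, RArr Weight}"
  by (auto simp: weights_cmd_def)

definition table_weight ::
  "nat \<Rightarrow> nat \<Rightarrow> nat \<Rightarrow> (nat \<Rightarrow> real) \<Rightarrow> (nat \<Rightarrow> real) \<Rightarrow> (nat \<Rightarrow> nat) \<Rightarrow> nat \<Rightarrow> nat \<Rightarrow> nat \<Rightarrow> nat \<Rightarrow> nat \<Rightarrow> real" where
  "table_weight r b m D \<alpha> T j c n u v = (\<Sum>y<n. if dig (\<lambda>_. r) y j = c
     then min (D (u * b + v)) (\<alpha> j + table_load r b m \<alpha> T y u v) - min (D (u * b + v)) (table_load r b m \<alpha> T y u v)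
     else 0)"

lemma table_weight_0: "table_weight r b m D \<alpha> T j c 0 u v = 0"
  by (simp add: table_weight_def)

lemma wp_weights_cmd:
  assumes "nreg s n_m = m" "nreg s n_r = r" "nreg s n_b = b" "nreg s n_a = a" "nreg s n_vectors = r ^ m"
    and "0 < r" "r \<le> B" "b \<le> B" "a \<le> B" "m \<le> B" "r ^ m \<le> B" "nreg s n_j < m"
  shows "wp B weights_cmd (\<lambda>t. \<forall>u<a. \<forall>v<b. rarr t Weight (u * b + v) =
    table_weight r b m (rarr s Demand) (rarr s Duration) (narr s Table) (nreg s n_j) (nreg s n_c) (r ^ m) u v) s"
proof -
  let ?w = "table_weight r b m (rarr s Demand) (rarr s Duration) (narr s Table) (nreg s n_j) (nreg s n_c)"
  define I where "I n t \<longleftrightarrow> (\<forall>e<n. rarr t Weight e = ?w (r ^ m) (e div b) (e mod b))" for n and t :: machine_state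
  show ?thesis
    unfolding weights_cmd_def
  proof (rule wp_FOR_FOR[where ?n1.0 = a and ?n2.0 = b and I = I], goal_cases)
    case (11 u v t)
    note [simp] = frame_simps[OF 11(6)]
    define J where "J y t' \<longleftrightarrow> rreg t' r_acc = ?w y u v" for y and t' :: machine_state
    show ?case unfolding wp_simps
    proof (intro conjI wp_FOR[where n = "r ^ m" and I = J], goal_cases)
      case (6 y t')
      note [simp] = frame_simps[OF 6(3)]
      show ?case unfolding wp_simps
        by (rule wp_call, rule wp_load_cmd[where m = m and r = r and b = b])
           (use 11 6 assms in \<open>auto simp: J_def edge_exp_def table_weight_def frame_simps wp_simps\<close>)
    qed (use 11 assms in \<open>auto simp: frame_simps I_def J_def edge_exp_def less_Suc_eq table_weight_0\<close>)
  next
    case (12 t)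
    show ?case
    proof (intro allI impI)
      fix u v assume "u < a" "v < b"
      then show "rarr t Weight (u * b + v) = ?w (r ^ m) u v"
        using 12(1) row_major_less by (auto simp: I_def)
    qed
  qed (use assms in \<open>auto simp: I_def\<close>)
qed


lemma written_bid_cmds [simp]:
  "written find_bidder_cmd = {NReg n_bidder, NReg n_u}"
  "written find_item_cmd = {NReg n_item, NReg n_u, NReg n_v, RReg r_profit, RReg r_acc}"
  "written bid_cmd = {NReg n_bidder, NReg n_item, NReg n_u, NReg n_v, NReg n_o, RReg r_profit, RReg r_acc,
     NArr Status, NArr Owner, NArr Price}"
  by (auto simp: find_bidder_cmd_def find_item_cmd_def bid_cmd_def assign_cmd_def)

lemma wp_find_bidder_cmd:
  assumes "nreg s n_a = a" "a \<le> B"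
  shows "wp B find_bidder_cmd (\<lambda>t. nreg t n_bidder < a \<and> narr s Status (nreg t n_bidder) = 0 \<or>
    nreg t n_bidder = a \<and> (\<forall>u<a. narr s Status u \<noteq> 0)) s"
proof -
  define I where "I j t \<longleftrightarrow> nreg t n_bidder < a \<and> narr s Status (nreg t n_bidder) = 0 \<or>
    nreg t n_bidder = a \<and> (\<forall>u<j. narr s Status u \<noteq> 0)" for j and t :: machine_state
  show ?thesis unfolding find_bidder_cmd_def wp_simps
    by (intro conjI wp_FOR[where n = a and I = I])
       (use assms in \<open>auto simp: I_def wp_simps frame_simps less_Suc_eq\<close>)
qed

lemma wp_find_item_cmd:
  assumes "nreg s n_b = b" "b \<le> B"
    and w: "w = (\<lambda>v. rarr s Weight (nreg s n_bidder * b + v) - rreg s r_eta * real (narr s Price v))"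
  shows "wp B find_item_cmd (\<lambda>t. nreg t n_item < b \<and> 0 < w (nreg t n_item) \<and> (\<forall>v<b. w v \<le> w (nreg t n_item)) \<or>
    nreg t n_item = b \<and> (\<forall>v<b. w v \<le> 0)) s"
proof -
  define I where "I j t \<longleftrightarrow> (\<forall>v<j. w v \<le> rreg t r_profit) \<and>
    (nreg t n_item < b \<and> 0 < w (nreg t n_item) \<and> rreg t r_profit = w (nreg t n_item) \<or>
     nreg t n_item = b \<and> rreg t r_profit = 0)" for j and t :: machine_state
  show ?thesis unfolding find_item_cmd_def wp_simps
  proof (intro conjI wp_FOR[where n = b and I = I], goal_cases)
    case (8 j t)
    note [simp] = frame_simps[OF 8(3)]
    have [simp]: "rarr s Weight (nreg s n_bidder * b + j) - rreg s r_eta * real (narr s Price j) = w j"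
      by (simp add: w)
    show ?case using 8(1,2) assms(1,2)
      by (auto simp: I_def wp_simps edge_exp_def less_Suc_eq)
  qed (use assms in \<open>auto simp: I_def\<close>)
qed


text \<open>The two alternatives are what a loop with a fixed number of rounds requires: a round
  either is idle or raises the potential.\<close>

lemma wp_bid_cmd:
  assumes regs: "nreg s n_a = a" "nreg s n_b = b" "a \<le> B" "b \<le> B"
    and w: "w = (\<lambda>u v. rarr s Weight (u * b + v))"
    and inv: "auction_inv w (rreg s r_eta) \<rho> a b (narr s Price) (narr s Owner) (narr s Status)"
    and w_le: "\<And>u v. u < a \<Longrightarrow> v < b \<Longrightarrow> w u v \<le> rreg s r_eta * real \<rho>" and eta: "0 \<le> rreg s r_eta"
  shows "wp B bid_cmd (\<lambda>t. auction_inv w (rreg s r_eta) \<rho> a b (narr t Price) (narr t Owner) (narr t Status) \<and>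
    (if \<forall>u<a. narr s Status u \<noteq> 0 then \<forall>u<a. narr t Status u \<noteq> 0 else
     auction_progress a b (narr t Price) (narr t Status) = Suc (auction_progress a b (narr s Price) (narr s Status)))) s"
    (is "wp B bid_cmd ?Q s")
  unfolding bid_cmd_def wp_simps(6)
proof (rule wp_call[OF wp_find_bidder_cmd[OF regs(1,3)]])
  fix t1 assume t1: "nreg t1 n_bidder < a \<and> narr s Status (nreg t1 n_bidder) = 0 \<or>
    nreg t1 n_bidder = a \<and> (\<forall>u<a. narr s Status u \<noteq> 0)" and fr1: "frame find_bidder_cmd s t1"
  note [simp] = frame_simps[OF fr1]
  define f where "f = nreg t1 n_bidder"
  show "wp B (IF (NLt (NV n_bidder) (NV n_a)) (find_item_cmd;; assign_cmd) NOP) ?Q t1"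
  proof (cases "f < a")
    case False
    then show ?thesis using t1 inv regs by (auto simp: f_def wp_simps)
  next
    case True
    then have f: "f < a" "narr s Status f = 0" using t1 by (auto simp: f_def)
    let ?w = "\<lambda>v. rarr t1 Weight (nreg t1 n_bidder * b + v) - rreg t1 r_eta * real (narr t1 Price v)"
    have wf: "?w v = w f v - rreg s r_eta * real (narr s Price v)" for v
      by (simp add: w f_def)
    have "wp B (find_item_cmd;; assign_cmd) ?Q t1"
      unfolding wp_simps(6)
    proof (rule wp_call[OF wp_find_item_cmd[of t1 b B ?w]], goal_cases)
      case (4 t)
      note [simp] = frame_simps[OF 4(2)]
      define v where "v = nreg t n_item"
      have bid: "nreg t n_bidder = f" by (simp add: f_def)
      from 4(1) consider
          "v < b" "0 < w f v - rreg s r_eta * real (narr s Price v)"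
          "\<forall>v'<b. w f v' - rreg s r_eta * real (narr s Price v') \<le> w f v - rreg s r_eta * real (narr s Price v)"
        | "v = b" "\<forall>v<b. w f v \<le> rreg s r_eta * real (narr s Price v)"
        unfolding wf by (auto simp: v_def)
      then show ?case
      proof cases
        case 1
        let ?st = "(if narr s Owner v = 0 then narr s Status
          else (narr s Status)(narr s Owner v - 1 := 0))(f := 1)"
        have "auction_inv w (rreg s r_eta) \<rho> a b ((narr s Price)(v := narr s Price v + 1))
            ((narr s Owner)(v := Suc f)) ?st"
          by (rule auction_assign[OF inv f 1(1) 1(3) 1(2)]) (use w_le f 1 eta in auto)
        moreover have "auction_progress a b ((narr s Price)(v := narr s Price v + 1)) ?st =
            Suc (auction_progress a b (narr s Price) (narr s Status))"
          by (rule auction_progress_assign[OF inv f 1(1)]) simp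
        ultimately show ?thesis using 1(1) regs bid v_def[symmetric] f
          by (auto simp: assign_cmd_def wp_simps)
      next
        case 2
        have "auction_inv w (rreg s r_eta) \<rho> a b (narr s Price) (narr s Owner) ((narr s Status)(f := 2))"
          using auction_drop[OF inv f 2(2)] .
        moreover note auction_progress_drop[of f a "narr s Status" b "narr s Price", OF f]
        ultimately show ?thesis using 2(1) regs bid v_def[symmetric] f
          by (auto simp: assign_cmd_def wp_simps)
      qed
    qed (use regs in auto)
    then show ?thesis using True regs by (simp add: wp_simps(7) f_def[symmetric])
  qed
qed


lemma written_auction_cmds [simp]:
  "written wmax_cmd = {NReg n_u, NReg n_v, RReg r_wmax}"
  "written reset_cmd = {NReg n_u, NReg n_v, NArr Price, NArr Owner, NArr Status}"
  "written auction_cmd = {NReg n_t, NReg n_bidder, NReg n_item, NReg n_u, NReg n_v, NReg n_o, RReg r_wmax,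
     RReg r_eta, RReg r_profit, RReg r_acc, NArr Status, NArr Owner, NArr Price}"
  by (auto simp: wmax_cmd_def reset_cmd_def auction_cmd_def)

lemma wp_wmax_cmd:
  assumes "nreg s n_a = a" "nreg s n_b = b" "a \<le> B" "b \<le> B"
  shows "wp B wmax_cmd (\<lambda>t. 0 \<le> rreg t r_wmax \<and>
    (\<forall>u<a. \<forall>v<b. rarr s Weight (u * b + v) \<le> rreg t r_wmax) \<and>
    (rreg t r_wmax = 0 \<or> (\<exists>u<a. \<exists>v<b. rarr s Weight (u * b + v) = rreg t r_wmax))) s"
proof -
  define I where "I n t \<longleftrightarrow> 0 \<le> rreg t r_wmax \<and> (\<forall>e<n. rarr s Weight e \<le> rreg t r_wmax) \<and>
    (rreg t r_wmax = 0 \<or> (\<exists>u<a. \<exists>v<b. rarr s Weight (u * b + v) = rreg t r_wmax))"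
    for n and t :: machine_state
  show ?thesis unfolding wmax_cmd_def wp_simps(6) wp_simps(3)
  proof (intro conjI wp_FOR_FOR[where ?n1.0 = a and ?n2.0 = b and I = I], goal_cases)
    case (12 u v t)
    note [simp] = frame_simps[OF 12(6)]
    show ?case using 12(1-5) assms
      by (auto simp: I_def wp_simps edge_exp_def less_Suc_eq)
  qed (use assms in \<open>auto simp: I_def row_major_less\<close>)
qed

lemma wp_reset_cmd:
  assumes "nreg s n_a = a" "nreg s n_b = b" "a \<le> B" "b \<le> B"
  shows "wp B reset_cmd (\<lambda>t. (\<forall>v<b. narr t Price v = 0) \<and> (\<forall>v<b. narr t Owner v = 0) \<and>
    (\<forall>u<a. narr t Status u = 0)) s"
  unfolding reset_cmd_def wp_simps(6)
proof (rule wp_FOR[where n = b and I = "\<lambda>j t. \<forall>v<j. narr t Price v = 0 \<and> narr t Owner v = 0"], goal_cases)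
  case (6 t)
  note [simp] = frame_simps[OF 6(2)]
  show ?case
    by (rule wp_FOR[where n = a and I = "\<lambda>j t. \<forall>u<j. narr t Status u = 0"])
       (use 6(1) assms in \<open>auto simp: wp_simps less_Suc_eq frame_simps\<close>)
qed (use assms in \<open>auto simp: wp_simps less_Suc_eq\<close>)

lemma wp_auction_cmd:
  assumes regs: "nreg s n_a = a" "nreg s n_b = b" "nreg s n_r = r" "0 < r"
    and B: "r \<le> B" "a * r \<le> B" "a \<le> B" "b \<le> B" "b * (a * r) + a + 1 \<le> B"
    and w: "w = (\<lambda>u v. rarr s Weight (u * b + v))"
  shows "wp B auction_cmd (\<lambda>t. valid_owner a b (narr t Owner) \<and> (\<forall>N. valid_owner a b N \<longrightarrow>
    (1 - 1 / real r) * (\<Sum>(u, v)\<in>matched a b N. w u v) \<le> (\<Sum>(u, v)\<in>matched a b (narr t Owner). w u v))) s"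
  unfolding auction_cmd_def wp_simps(6)
proof (rule wp_call[OF wp_wmax_cmd[OF regs(1,2) B(3,4)]], elim conjE)
  fix t1 assume fr1: "frame wmax_cmd s t1" and max: "0 \<le> rreg t1 r_wmax"
    "\<forall>u<a. \<forall>v<b. rarr s Weight (u * b + v) \<le> rreg t1 r_wmax"
    "rreg t1 r_wmax = 0 \<or> (\<exists>u<a. \<exists>v<b. rarr s Weight (u * b + v) = rreg t1 r_wmax)"
  note fr1s = frame_simps[OF fr1]
  define \<eta> where "\<eta> = rreg t1 r_wmax / (real a * real r)"
  let ?t1 = "set_rreg r_eta \<eta> t1"
  let ?loop = "FOR n_t (NPlus (NPlus (NTimes (NV n_b) (NTimes (NV n_a) (NV n_r))) (NV n_a)) (NC 1)) bid_cmd"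
  let ?Q = "\<lambda>t. valid_owner a b (narr t Owner) \<and> (\<forall>N. valid_owner a b N \<longrightarrow>
    (1 - 1 / real r) * (\<Sum>(u, v)\<in>matched a b N. w u v) \<le> (\<Sum>(u, v)\<in>matched a b (narr t Owner). w u v))"
  have \<eta>0: "0 \<le> \<eta>" using max by (simp add: \<eta>_def)
  \<comment> \<open>The price bound is \<open>\<rho> = a * r\<close>, because \<eta> is the largest
    weight divided by \<open>a * r\<close>; \<open>u < a\<close> excludes a zero divisor.\<close>
  have w_le: "w u v \<le> \<eta> * real (a * r)" if "u < a" "v < b" for u v
    using that max regs by (simp add: w \<eta>_def)
  have "wp B reset_cmd (wp B ?loop ?Q) ?t1"
  proof (rule wp_call[OF wp_reset_cmd[of _ a b]], goal_cases)
    case (5 t2)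
    note fr2s = frame_simps[OF 5(2)]
    have t2: "nreg t2 n_a = a" "nreg t2 n_b = b" "nreg t2 n_r = r" "rreg t2 r_eta = \<eta>" "rarr t2 Weight = rarr s Weight"
      using regs by (simp_all add: fr2s fr1s)
    \<comment> \<open>After the last round \<open>n\<close> exceeds the bound of
      \<open>auction_progress_le\<close>, so only the second alternative remains.\<close>
    define I where "I n t \<longleftrightarrow> auction_inv w \<eta> (a * r) a b (narr t Price) (narr t Owner) (narr t Status) \<and>
      (n \<le> auction_progress a b (narr t Price) (narr t Status) \<or> (\<forall>u<a. narr t Status u \<noteq> 0))"
      for n and t :: machine_state
    show ?case
    proof (rule wp_FOR[where n = "b * (a * r) + a + 1" and I = I], goal_cases)
      case 4
      show ?case using 5(1) auction_init by (auto simp: I_def)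
    next
      case (5 j t)
      note [simp] = frame_simps[OF 5(3)]
      show ?case
      proof (rule wp_call[OF wp_bid_cmd[where a = a and b = b and \<rho> = "a * r" and w = w]], goal_cases)
        case (9 t')
        then show ?case using 5(2) t2 by (auto simp: I_def split: if_splits)
      qed (use 5 t2 B w w_le \<eta>0 in \<open>auto simp: I_def\<close>)
    next
      case (6 t)
      have inv: "auction_inv w \<eta> (a * r) a b (narr t Price) (narr t Owner) (narr t Status)"
        using 6(1) by (simp add: I_def)
      have fin: "narr t Status u \<noteq> 0" if "u < a" for u
        using 6(1) auction_progress_le[OF inv] that by (auto simp: I_def)
      show ?case
      proof (intro conjI allI impI)
        show "valid_owner a b (narr t Owner)" using inv by (simp add: auction_inv_def)
        fix N assume N: "valid_owner a b N"
        show "(1 - 1 / real r) * (\<Sum>(u, v)\<in>matched a b N. w u v) \<le> (\<Sum>(u, v)\<in>matched a b (narr t Owner). w u v)"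
          by (rule auction_approx[OF inv fin N, where wmax = "rreg t1 r_wmax"])
             (use max regs in \<open>auto simp: w \<eta>_def\<close>)
      qed
    qed (use t2 B in auto)
  qed (use regs B in \<open>auto simp: fr1s\<close>)
  then show "wp B (RSet r_eta (RDivide (RV r_wmax) (RTimes (ROf (NV n_a)) (ROf (NV n_r)))))
      (wp B reset_cmd (wp B ?loop ?Q)) t1"
    using regs by (simp add: wp_simps(3) fr1s \<eta>_def)
qed


section \<open>Tabular greedy on a flat table\<close>

lemma sum_row_major: "(\<Sum>e<a * b. h (e div b) (e mod b)) = (\<Sum>u<a. \<Sum>v<b. h u (v::nat))"
proof -
  have "(\<Sum>e<a * b. h (e div b) (e mod b)) = (\<Sum>(u, v)\<in>{..<a} \<times> {..<b}. h u v)"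
  proof (rule sum.reindex_bij_witness[where i = "\<lambda>(u, v). u * b + v" and j = "\<lambda>e. (e div b, e mod b)"])
    fix e assume e: "e \<in> {..<a * b}"
    then have "0 < b" by (cases b) auto
    with e show "(e div b, e mod b) \<in> {..<a} \<times> {..<b}"
      by (auto simp: less_mult_imp_div_less)
  qed (auto simp: row_major_less)
  then show ?thesis by (simp add: sum.cartesian_product)
qed

locale flat =
  fixes a b r m :: nat and D \<alpha> :: "nat \<Rightarrow> real"
  assumes r_pos: "0 < r" and D_nonneg: "\<And>u v. u < a \<Longrightarrow> v < b \<Longrightarrow> 0 \<le> D (u * b + v)"
    and \<alpha>_nonneg: "\<And>i. i < m \<Longrightarrow> 0 \<le> \<alpha> i"
begin

sublocale tab: tabular m r "{..<a} \<times> {..<b}" "\<lambda>(u, v). D (u * b + v)" \<alpha>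
  by unfold_locales (use r_pos D_nonneg \<alpha>_nonneg in auto)

definition entry :: "(nat \<Rightarrow> nat) \<Rightarrow> nat \<Rightarrow> nat \<Rightarrow> nat \<times> nat \<Rightarrow> bool" where
  "entry T i c e \<longleftrightarrow> T ((i * r + c) * b + snd e) = Suc (fst e)"

definition vector_value :: "(nat \<Rightarrow> nat) \<Rightarrow> nat \<Rightarrow> real" where
  "vector_value T y = load_value a b (\<lambda>u v. D (u * b + v)) m (\<lambda>i v. T ((i * r + dig (\<lambda>_. r) y i) * b + v)) \<alpha>"

definition owners_value :: "(nat \<Rightarrow> nat \<Rightarrow> nat) \<Rightarrow> real" where
  "owners_value Q = load_value a b (\<lambda>u v. D (u * b + v)) m Q \<alpha>"

lemma vector_value_alt:
  "vector_value T y = (\<Sum>e<a * b. min (D e) (table_load r b m \<alpha> T y (e div b) (e mod b)))"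
proof -
  have "(\<Sum>e<a * b. min (D e) (table_load r b m \<alpha> T y (e div b) (e mod b))) =
      (\<Sum>e<a * b. min (D (e div b * b + e mod b)) (table_load r b m \<alpha> T y (e div b) (e mod b)))"
    by simp
  then show ?thesis
    using sum_row_major[of "\<lambda>u v. min (D (u * b + v)) (table_load r b m \<alpha> T y u v)" b a]
    by (simp add: vector_value_def load_value_def table_load_def)
qed

lemma total_eq: "tab.total (entry T) = (\<Sum>y<r ^ m. vector_value T y)"
proof -
  let ?h = "\<lambda>v. \<Sum>e\<in>{..<a} \<times> {..<b}. min (case e of (u, v) \<Rightarrow> D (u * b + v)) (tab.load (entry T) v e)"
  have "tab.total (entry T) = (\<Sum>y<r ^ m. ?h (dig (\<lambda>_. r) y))"
    unfolding tab.total_def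
    by (rule sum_digits[symmetric, OF r_pos]) (simp add: tab.load_def)
  also have "\<dots> = (\<Sum>y<r ^ m. vector_value T y)"
    by (intro sum.cong refl) (simp add: vector_value_def load_value_def sum.cartesian_product
        tab.load_def entry_def case_prod_beta)
  finally show ?thesis .
qed

lemma assignment_value_eq: "tab.assignment_value (\<lambda>i (u, v). Q i v = Suc u) = owners_value Q"
  by (simp add: tab.assignment_value_def owners_value_def load_value_def sum.cartesian_product case_prod_beta)

text \<open>The program adds \<open>\<alpha> j\<close> to the full load. As entry
  \<open>(j, c)\<close> is still empty, for vectors selecting it this is the load of the other
  configurations, as in \<open>gain\<close>.\<close>

lemma table_weight_eq:
  assumes "j < m" "\<And>v. v < b \<Longrightarrow> T ((j * r + c) * b + v) = 0" "u < a" "v < b"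
  shows "table_weight r b m D \<alpha> T j c (r ^ m) u v = tab.gain (entry T) j c (u, v)"
proof -
  let ?D = "D (u * b + v)"
  let ?g = "\<lambda>d. min ?D (\<alpha> j + tab.load_others (entry T) j d (u, v)) - min ?D (tab.load_others (entry T) j d (u, v))"
  have load: "tab.load_others (entry T) j d (u, v) = tab.load (entry T) d (u, v)" if "d j = c" for d
    using tab.load_split[OF assms(1), of "entry T" d "(u, v)"] that assms(2,4) by (simp add: entry_def)
  have "table_weight r b m D \<alpha> T j c (r ^ m) u v = (\<Sum>y<r ^ m. if dig (\<lambda>_. r) y j = c then ?g (dig (\<lambda>_. r) y) else 0)"
    unfolding table_weight_def
    by (intro sum.cong refl if_cong) (auto simp: load tab.load_def table_load_def entry_def)
  also have "\<dots> = (\<Sum>d\<in>digit_vectors r m. if d j = c then ?g d else 0)"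
  proof (rule sum_digits[OF r_pos, where h = "\<lambda>d. if d j = c then ?g d else 0"])
    fix d d' :: "nat \<Rightarrow> nat" assume d: "\<And>i. i < m \<Longrightarrow> d i = d' i"
    then have "tab.load_others (entry T) j d e = tab.load_others (entry T) j d' e" for e
      unfolding tab.load_others_def by (intro sum.cong) auto
    then show "(if d j = c then ?g d else 0) = (if d' j = c then ?g d' else 0)"
      using d[OF assms(1)] by simp
  qed
  also have "\<dots> = tab.gain (entry T) j c (u, v)"
    by (simp add: tab.gain_def sum.inter_filter finite_digit_vectors)
  finally show ?thesis .
qed

text \<open>The restrictions \<open>c' < r\<close> and \<open>v < b\<close> make the flat index
  unambiguous.\<close>

definition stored :: "(nat \<Rightarrow> nat) \<Rightarrow> nat \<Rightarrow> nat \<Rightarrow> (nat \<Rightarrow> nat) \<Rightarrow> (nat \<Rightarrow> nat) \<Rightarrow> bool" where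
  "stored T j c own T' \<longleftrightarrow> (\<forall>i c' v. c' < r \<longrightarrow> v < b \<longrightarrow>
     T' ((i * r + c') * b + v) = (if i = j \<and> c' = c then own v else T ((i * r + c') * b + v)))"

definition \<beta> :: real where "\<beta> = 1 - 1 / real r"

lemma \<beta>: "0 \<le> \<beta>"
  using r_pos by (simp add: \<beta>_def)

definition all_valid :: "(nat \<Rightarrow> nat \<Rightarrow> nat) \<Rightarrow> bool" where
  "all_valid Q \<longleftrightarrow> (\<forall>i<m. valid_owner a b (Q i))"

definition valid_table :: "(nat \<Rightarrow> nat) \<Rightarrow> bool" where
  "valid_table T \<longleftrightarrow> (\<forall>i<m. \<forall>c<r. valid_owner a b (\<lambda>v. T ((i * r + c) * b + v)))"

text \<open>
  Gains only decrease while the table is filled, so the invariant can bound all entries of the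
  current colour by their gains with respect to the current table.
\<close>

definition round_inv :: "nat \<Rightarrow> (nat \<Rightarrow> nat) \<Rightarrow> nat \<Rightarrow> (nat \<Rightarrow> nat) \<Rightarrow> bool" where
  "round_inv c T0 j T \<longleftrightarrow> valid_table T \<and>
     (\<forall>i<m. \<forall>c'<r. \<forall>v<b. c < c' \<or> c' = c \<and> j \<le> i \<longrightarrow> T ((i * r + c') * b + v) = 0) \<and>
     (\<forall>Q. all_valid Q \<longrightarrow> tab.total (entry T0) +
        \<beta> * (\<Sum>i<j. \<Sum>e\<in>matched a b (Q i). tab.gain (entry T) i c e) \<le> tab.total (entry T))"

text \<open>The comparison is with every \<open>Q\<close>, because the matchings of an optimal
  schedule are unknown to the program.\<close>

definition greedy_inv :: "nat \<Rightarrow> (nat \<Rightarrow> nat) \<Rightarrow> bool" where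
  "greedy_inv c T \<longleftrightarrow> valid_table T \<and>
     (\<forall>i<m. \<forall>c'<r. \<forall>v<b. c \<le> c' \<longrightarrow> T ((i * r + c') * b + v) = 0) \<and>
     (\<forall>Q. all_valid Q \<longrightarrow> real r ^ m * owners_value Q - tab.total (entry T) \<le>
        real r ^ m * owners_value Q * (1 / (1 + \<beta> / real r)) ^ c)"

lemma greedy_init:
  assumes "\<And>k. k < m * r * b \<Longrightarrow> T k = 0"
  shows "greedy_inv 0 T"
proof -
  have zero: "T ((i * r + c) * b + v) = 0" if "i < m" "c < r" "v < b" for i c v
    using that by (intro assms row_major_less)
  then have "valid_table T" by (auto simp: valid_table_def valid_owner_def)
  moreover have "0 \<le> tab.total (entry T)"
    unfolding tab.total_def tab.load_def using D_nonneg \<alpha>_nonneg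
    by (intro sum_nonneg) (auto intro!: sum_nonneg)
  ultimately show ?thesis using zero by (auto simp: greedy_inv_def)
qed

lemma round_start: "greedy_inv c T \<Longrightarrow> round_inv c T 0 T"
  by (auto simp: greedy_inv_def round_inv_def)

lemma matched_filter: "{e \<in> {..<a} \<times> {..<b}. case e of (u, v) \<Rightarrow> N v = Suc u} = matched a b N"
  by (auto simp: matched_def)

text \<open>The entries of \<open>Q\<close> treated earlier are paid for by the invariant, since
  their gains have not grown; entry \<open>j\<close> is paid for by the near-optimal matching
  \<open>own\<close>.\<close>

lemma round_step:
  assumes inv: "round_inv c T0 j T" and j: "j < m" "c < r" and own: "valid_owner a b own"
    and opt: "\<And>N. valid_owner a b N \<Longrightarrow>
      \<beta> * (\<Sum>(u, v)\<in>matched a b N. table_weight r b m D \<alpha> T j c (r ^ m) u v)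
      \<le> (\<Sum>(u, v)\<in>matched a b own. table_weight r b m D \<alpha> T j c (r ^ m) u v)"
    and T': "stored T j c own T'"
  shows "round_inv c T0 (Suc j) T'"
proof -
  have zero: "T ((j * r + c) * b + v) = 0" if "v < b" for v
    using inv j that by (auto simp: round_inv_def)
  have weight: "(\<Sum>(u, v)\<in>matched a b N. table_weight r b m D \<alpha> T j c (r ^ m) u v) =
      (\<Sum>e\<in>matched a b N. tab.gain (entry T) j c e)" for N
    by (intro sum.cong refl) (auto simp: matched_def table_weight_eq[where T = T, OF j(1) zero])
  have entry': "entry T' i c' e = (if i = j \<and> c' = c then own (snd e) = Suc (fst e) else entry T i c' e)"
    if "e \<in> {..<a} \<times> {..<b}" "c' < r" for i c' e
    using T' that by (auto simp: entry_def stored_def)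
  have total: "tab.total (entry T') = tab.total (entry T) + (\<Sum>e\<in>matched a b own. tab.gain (entry T) j c e)"
    using tab.total_update[of j "entry T" c "entry T'" "\<lambda>(u, v). own v = Suc u", unfolded matched_filter]
      j zero entry' by (auto simp: entry_def split: prod.splits)
  \<comment> \<open>Filling an empty entry can only increase loads, so gains decrease by
    concavity.\<close>
  have mono: "tab.gain (entry T') i c e \<le> tab.gain (entry T) i c e" if "i < m" "e \<in> matched a b N" for i e N
  proof -
    have e: "e \<in> {..<a} \<times> {..<b}" using that(2) matched_subset by blast
    have "tab.load_others (entry T) i d e \<le> tab.load_others (entry T') i d e"
      if d: "d \<in> digit_vectors r m" for d
      unfolding tab.load_others_def
    proof (intro sum_mono)
      fix k assume k: "k \<in> {..<m} - {i}"
      then have "d k < r" using d by (auto simp: digit_vectors_def)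
      then show "(if entry T k (d k) e then \<alpha> k else 0) \<le> (if entry T' k (d k) e then \<alpha> k else 0)"
        using \<alpha>_nonneg[of k] k entry'[OF e] zero e by (auto simp: entry_def)
    qed
    then show ?thesis unfolding tab.gain_def
      using \<alpha>_nonneg[OF \<open>i < m\<close>] by (intro sum_mono min_increment_antimono) auto
  qed
  show ?thesis unfolding round_inv_def
  proof (intro conjI allI impI)
    show "valid_table T'" unfolding valid_table_def
    proof (intro allI impI)
      fix i c' assume ic: "i < m" "c' < r"
      show "valid_owner a b (\<lambda>v. T' ((i * r + c') * b + v))"
      proof (cases "i = j \<and> c' = c")
        case True
        then show ?thesis using own T' ic by (simp add: stored_def valid_owner_def)
      next
        case False
        moreover have "valid_owner a b (\<lambda>v. T ((i * r + c') * b + v))"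
          using inv ic by (simp add: round_inv_def valid_table_def)
        ultimately show ?thesis using T' ic by (auto simp: stored_def valid_owner_def)
      qed
    qed
    show "T' ((i * r + c') * b + v) = 0"
      if "i < m" "c' < r" "v < b" "c < c' \<or> c' = c \<and> Suc j \<le> i" for i c' v
      using inv T' that by (auto simp: stored_def round_inv_def)
    fix Q assume Q: "all_valid Q"
    have "tab.total (entry T0) + \<beta> * (\<Sum>i<Suc j. \<Sum>e\<in>matched a b (Q i). tab.gain (entry T') i c e)
        \<le> tab.total (entry T0) + \<beta> * (\<Sum>i<Suc j. \<Sum>e\<in>matched a b (Q i). tab.gain (entry T) i c e)"
      using \<beta> j mono by (intro add_left_mono mult_left_mono sum_mono) auto
    also have "\<dots> = tab.total (entry T0) + \<beta> * (\<Sum>i<j. \<Sum>e\<in>matched a b (Q i). tab.gain (entry T) i c e) +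
        \<beta> * (\<Sum>e\<in>matched a b (Q j). tab.gain (entry T) j c e)"
      by (simp add: distrib_left)
    also have "\<dots> \<le> tab.total (entry T) + \<beta> * (\<Sum>e\<in>matched a b (Q j). tab.gain (entry T) j c e)"
      using inv Q by (simp add: round_inv_def)
    also have "\<dots> \<le> tab.total (entry T')"
      using opt[of "Q j"] Q j by (simp add: total weight all_valid_def)
    finally show "tab.total (entry T0) + \<beta> * (\<Sum>i<Suc j. \<Sum>e\<in>matched a b (Q i). tab.gain (entry T') i c e)
        \<le> tab.total (entry T')" .
  qed
qed

text \<open>After all \<open>m\<close> entries of a colour, the gains of \<open>Q\<close> in the
  invariant are those bounded below by \<open>gain_assignment\<close> in terms of the current
  deficit. With the loss \<beta> of the auction, \<open>deficit_step\<close> applies for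
  \<open>b = \<beta> / r\<close>.\<close>

lemma round_end:
  assumes "round_inv c T0 m T" "greedy_inv c T0" "c < r"
  shows "greedy_inv (Suc c) T"
  unfolding greedy_inv_def
proof (intro conjI allI impI)
  show "valid_table T" using assms by (simp add: round_inv_def)
  show "T ((i * r + c') * b + v) = 0" if "i < m" "c' < r" "v < b" "Suc c \<le> c'" for i c' v
    using assms that by (auto simp: round_inv_def)
  fix Q assume Q: "all_valid Q"
  let ?P = "real r ^ m * owners_value Q"
  show "?P - tab.total (entry T) \<le> ?P * (1 / (1 + \<beta> / real r)) ^ Suc c"
  proof (rule deficit_step)
    have "\<beta> / real r * (?P - tab.total (entry T)) = \<beta> * ((?P - tab.total (entry T)) / real r)" by simp
    also have "\<dots> \<le> \<beta> * (\<Sum>i<m. \<Sum>e\<in>matched a b (Q i). tab.gain (entry T) i c e)"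
      using tab.gain_assignment[OF assms(3), of "\<lambda>i (u, v). Q i v = Suc u" "entry T"] \<beta>
      by (intro mult_left_mono) (simp_all add: matched_filter assignment_value_eq)
    also have "\<dots> \<le> tab.total (entry T) - tab.total (entry T0)"
      using assms(1) Q by (auto simp: round_inv_def)
    finally show "\<beta> / real r * (?P - tab.total (entry T)) \<le> tab.total (entry T) - tab.total (entry T0)" .
    show "?P - tab.total (entry T0) \<le> ?P * (1 / (1 + \<beta> / real r)) ^ c"
      using assms(2) Q by (auto simp: greedy_inv_def)
  qed (use \<beta> in simp)
qed

text \<open>\<open>total\<close> is the sum over \<open>r ^ m\<close> vectors, so an upper bound on
  each of them bounds the average.\<close>

lemma greedy_end:
  assumes inv: "greedy_inv r T" and r: "2 \<le> r" and Q: "all_valid Q"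
    and best: "\<And>y. y < r ^ m \<Longrightarrow> vector_value T y \<le> x"
  shows "(1 - 1 / exp 1 - 2 / real r) * owners_value Q \<le> x"
proof -
  let ?q = "(1 / (1 + \<beta> / real r)) ^ r"
  have nonneg: "0 \<le> owners_value Q"
    unfolding owners_value_def load_value_def using D_nonneg \<alpha>_nonneg
    by (intro sum_nonneg) (auto intro!: sum_nonneg)
  have "real r ^ m * ((1 - ?q) * owners_value Q) \<le> tab.total (entry T)"
    using inv Q by (auto simp: greedy_inv_def algebra_simps)
  also have "\<dots> \<le> real r ^ m * x"
    unfolding total_eq using sum_mono[of "{..<r ^ m}" "vector_value T" "\<lambda>_. x"] best by simp
  finally have "(1 - ?q) * owners_value Q \<le> x" using r_pos by simp
  moreover have "(1 - 1 / exp 1 - 2 / real r) * owners_value Q \<le> (1 - ?q) * owners_value Q"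
    using greedy_factor[OF r] nonneg by (intro mult_right_mono) (auto simp: \<beta>_def)
  ultimately show ?thesis by simp
qed

end


section \<open>Correctness of the search\<close>

lemma written_next_digit [simp]:
  "written (next_digit e) = {NReg n_d, NReg n_z}"
  by (auto simp: next_digit_def)

lemma written_greedy_cmd [simp]:
  "written greedy_cmd = {NReg n_t, NReg n_c, NReg n_j, NReg n_u, NReg n_v, NReg n_y, NReg n_z, NReg n_i,
     NReg n_d, NReg n_dj, NReg n_bidder, NReg n_item, NReg n_o, RReg r_acc, RReg r_load, RReg r_wmax, RReg
     r_eta, RReg r_profit, NArr Table, NArr Status, NArr Owner, NArr Price, RArr Weight}"
  by (auto simp: greedy_cmd_def)

lemma written_value_cmd [simp]:
  "written value_cmd = {NReg n_u, NReg n_v, NReg n_z, NReg n_i, NReg n_d, NReg n_dj, RReg r_acc, RReg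
     r_load}"
  by (auto simp: value_cmd_def)

lemma written_output_cmd [simp]:
  "written output_cmd = {NReg 0, NReg 1, NReg n_z, NReg n_i, NReg n_d, NReg n_v, NReg n_o, NArr 0, NArr 1,
     NArr 2, RArr 0}"
  by (auto simp: output_cmd_def next_digit_def)

lemma written_select_cmd [simp]:
  "written select_cmd = {NReg n_y, NReg n_u, NReg n_v, NReg n_z, NReg n_i, NReg n_d, NReg n_dj, NReg n_o,
     NReg 0, NReg 1, RReg r_acc, RReg r_load, RReg r_best, NArr 0, NArr 1, NArr 2, RArr 0}"
  by (auto simp: select_cmd_def)

lemma output_schedule_cong:
  assumes "nreg t 0 = nreg s 0" "nreg t 1 = nreg s 1" "narr t 0 = narr s 0" "narr t 1 = narr s 1"
    "narr t 2 = narr s 2" "rarr t 0 = rarr s 0"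
  shows "output_schedule t = output_schedule s"
  unfolding output_schedule_def assms ..

locale bounded = flat +
  fixes B :: nat
  assumes B: "a \<le> B" "b \<le> B" "r \<le> B" "m \<le> B" "r ^ m \<le> B" "a * r \<le> B" "b * (a * r) + a + 1 \<le> B" "m * r * b \<le> B"
begin

definition env :: "machine_state \<Rightarrow> bool" where
  "env s \<longleftrightarrow> nreg s n_a = a \<and> nreg s n_b = b \<and> nreg s n_r = r \<and> nreg s n_m = m \<and> nreg s n_vectors = r ^ m \<and>
     rarr s Demand = D \<and> rarr s Duration = \<alpha>"

lemma wp_greedy_cmd:
  assumes env: "env s"
  shows "wp B greedy_cmd (\<lambda>t. greedy_inv r (narr t Table)) s"
  unfolding greedy_cmd_def wp_simps(6)
proof (rule wp_FOR[where n = "m * r * b" and I = "\<lambda>j t. \<forall>k<j. narr t Table k = 0"], goal_cases)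
  case (6 t1)
  note fr1 = frame_simps[OF 6(2)]
  show ?case
  proof (rule wp_FOR[where n = r and I = "\<lambda>c t. greedy_inv c (narr t Table)"], goal_cases)
    case 4
    show ?case using 6(1) by (intro greedy_init) auto
  next
    case (5 c t2)
    note fr2 = frame_simps[OF 5(3)]
    show ?case
    proof (rule wp_FOR[where n = m and I = "\<lambda>j t. round_inv c (narr t2 Table) j (narr t Table)"], goal_cases)
      case 4
      show ?case using 5(2) by (simp add: round_start)
    next
      case (5 j t3)
      note fr3 = frame_simps[OF 5(3)]
      let ?s = "set_nreg n_j j t3"
      have s: "env ?s" "nreg ?s n_j = j" "nreg ?s n_c = c" "narr ?s Table = narr t3 Table"
        using env by (simp_all add: env_def fr1 fr2 fr3)
      let ?w = "table_weight r b m D \<alpha> (narr t3 Table) j c (r ^ m)"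
      have "wp B weights_cmd (\<lambda>t. \<forall>u<a. \<forall>v<b. rarr t Weight (u * b + v) = ?w u v) ?s"
        using wp_weights_cmd[of ?s m r b a B] s B r_pos 5(1) by (simp add: env_def)
      then show ?case unfolding wp_simps(6)
      proof (rule wp_call)
        fix t4 assume t4: "\<forall>u<a. \<forall>v<b. rarr t4 Weight (u * b + v) = ?w u v" and "frame weights_cmd ?s t4"
        note fr4 = frame_simps[OF this(2)]
        define w where "w = (\<lambda>u v. rarr t4 Weight (u * b + v))"
        have w: "(\<Sum>(u, v)\<in>matched a b N. w u v) = (\<Sum>(u, v)\<in>matched a b N. ?w u v)" for N
          using t4 by (intro sum.cong refl) (auto simp: w_def matched_def)
        show "wp B auction_cmd (wp B (FOR n_v (NV n_b) (NPut Table (entry_exp (NV n_j) (NV n_c)) (NGet Owner (NV n_v))))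
          (\<lambda>t. round_inv c (narr t2 Table) (Suc j) (narr t Table))) t4"
        proof (rule wp_call[OF wp_auction_cmd[of t4 a b r B w]], goal_cases)
          case (11 t5)
          note fr5 = frame_simps[OF 11(2)]
          have step: "round_inv c (narr t2 Table) (Suc j) T'" if "stored (narr t3 Table) j c (narr t5 Owner) T'" for T'
            by (rule round_step[OF 5(2) \<open>j < m\<close> \<open>c < r\<close> _ _ that]) (use 11(1) w in \<open>auto simp: \<beta>_def\<close>)
          define I where "I k t \<longleftrightarrow> (\<forall>i c' v. c' < r \<longrightarrow> v < b \<longrightarrow> narr t Table ((i * r + c') * b + v) =
             (if i = j \<and> c' = c \<and> v < k then narr t5 Owner v else narr t3 Table ((i * r + c') * b + v)))"
            for k and t :: machine_state
          have t5: "nreg t5 n_b = b" "nreg t5 n_j = j" "nreg t5 n_c = c" "nreg t5 n_r = r" "narr t5 Table = narr t3 Table"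
            using env by (simp_all add: env_def fr1 fr2 fr3 fr4 fr5)
          show ?case
          proof (rule wp_FOR[where n = b and I = I], goal_cases)
            case (5 v t6)
            note fr6 = frame_simps[OF 5(3)]
            \<comment> \<open>Distinct triples have distinct positions, so storing the new matching
              leaves all other entries intact.\<close>
            have "(i * r + c') * b + v' = (j * r + c) * b + v \<longleftrightarrow> i = j \<and> c' = c \<and> v' = v"
              if "c' < r" "v' < b" for i c' v'
              using that \<open>c < r\<close> \<open>v < b\<close> by (simp add: row_major_eq_iff)
            then show ?case using 5(1,2) t5 B
              by (auto simp: wp_simps entry_exp_def fr6 I_def less_Suc_eq)
          next
            case (6 t6)
            then show ?case by (intro step) (auto simp: stored_def I_def)
          qed (use t5 B in \<open>auto simp: I_def\<close>)
        qed (use env B r_pos in \<open>auto simp: env_def fr1 fr2 fr3 fr4 w_def\<close>)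
      qed
    next
      case (6 t3)
      then show ?case using round_end \<open>greedy_inv c (narr t2 Table)\<close> \<open>c < r\<close> by blast
    qed (use env B in \<open>auto simp: env_def fr1 fr2\<close>)
  qed (use env B in \<open>auto simp: env_def fr1\<close>)
qed (use env B in \<open>auto simp: env_def less_Suc_eq wp_simps\<close>)

lemma wp_value_cmd:
  assumes env: "env s" and y: "nreg s n_y < r ^ m"
  shows "wp B value_cmd (\<lambda>t. rreg t r_acc = vector_value (narr s Table) (nreg s n_y)) s"
proof -
  define I where "I n t \<longleftrightarrow> rreg t r_acc =
    (\<Sum>e<n. min (D e) (table_load r b m \<alpha> (narr s Table) (nreg s n_y) (e div b) (e mod b)))"
    for n and t :: machine_state
  show ?thesis unfolding value_cmd_def wp_simps(6) wp_simps(3)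
  proof (intro conjI wp_FOR_FOR[where ?n1.0 = a and ?n2.0 = b and I = I], goal_cases)
    case (12 u v t)
    note fr = frame_simps[OF 12(6)]
    show ?case unfolding wp_simps
      by (rule wp_call, rule wp_load_cmd[where m = m and r = r and b = b])
         (use 12 env B y r_pos in \<open>auto simp: env_def fr I_def edge_exp_def frame_simps\<close>)
  qed (use env B in \<open>auto simp: env_def I_def vector_value_alt\<close>)
qed

definition vector_schedule :: "(nat \<Rightarrow> nat) \<Rightarrow> (nat \<Rightarrow> nat) \<Rightarrow> (nat \<Rightarrow> nat) \<Rightarrow> nat \<Rightarrow> nat schedule" where
  "vector_schedule lf rt T y = (\<lambda>i. ({(lf (T ((i * r + dig (\<lambda>_. r) y i) * b + v) - 1), rt v) | v.
     v < b \<and> 0 < T ((i * r + dig (\<lambda>_. r) y i) * b + v)}, \<alpha> i)) ` {..<m}"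

lemma wp_output_cmd:
  assumes env: "env s" and y: "nreg s n_y < r ^ m"
  shows "wp B output_cmd (\<lambda>t. output_schedule t =
    vector_schedule (narr s Lefts) (narr s Rights) (narr s Table) (nreg s n_y)) s"
proof -
  define y where "y = nreg s n_y"
  define ow where "ow i v = narr s Table ((i * r + dig (\<lambda>_. r) y i) * b + v)" for i v
  \<comment> \<open>The order of the output list is irrelevant; its set of triples is easier to
    maintain.\<close>
  define triples where "triples t = (\<lambda>k. (narr t 0 k, narr t 1 k, narr t 2 k)) ` {..<nreg t 1}" for t :: machine_state
  define new where "new i n = {(i, narr s Lefts (ow i v - 1), narr s Rights v) | v. v < n \<and> 0 < ow i v}" for i n
  define I where "I i t \<longleftrightarrow> nreg t 0 = m \<and> nreg t n_z = quo (\<lambda>_. r) y i \<and> (\<forall>i'<i. rarr t 0 i' = \<alpha> i') \<and>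
    triples t = (\<Union>i'<i. new i' b)" for i and t :: machine_state
  have quo: "quo (\<lambda>_. r) y i \<le> B" for i
    using quo_le[of "\<lambda>_. r" y i] assms(2) B(5) unfolding y_def by linarith
  show ?thesis unfolding output_cmd_def wp_simps(6) wp_simps(2)
  proof (intro conjI wp_FOR[where n = m and I = I], goal_cases)
    case (8 i t1)
    note fr1 = frame_simps[OF 8(3)]
    let ?t = "set_nreg n_z (quo (\<lambda>_. r) y (Suc i)) (set_nreg n_d (dig (\<lambda>_. r) y i) (set_nreg n_i i t1))"
    define t2 where "t2 = put_rarr 0 i (\<alpha> i) ?t"
    define J where "J v t \<longleftrightarrow> triples t = (\<Union>i'<i. new i' b) \<union> new i v" for v and t :: machine_state
    have "wp B (FOR n_v (NV n_b) (
       NSet n_o (NGet Table (entry_exp (NV n_i) (NV n_d)));;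
       IF (NLt (NC 0) (NV n_o)) (
         NPut 0 (NV 1) (NV n_i);;
         NPut 1 (NV 1) (NGet Lefts (NMinus (NV n_o) (NC 1)));;
         NPut 2 (NV 1) (NGet Rights (NV n_v));;
         NSet 1 (NPlus (NV 1) (NC 1))) NOP)) (I (Suc i)) t2"
    proof (rule wp_FOR[where n = b and I = J], goal_cases)
      case (5 v t3)
      note fr3 = frame_simps[OF 5(3)]
      have o: "narr t3 Table ((i * r + dig (\<lambda>_. r) y i) * b + v) = ow i v"
        by (simp add: fr3 t2_def fr1 ow_def)
      have new_Suc: "new i (Suc v) = (if 0 < ow i v
          then insert (i, narr s Lefts (ow i v - 1), narr s Rights v) (new i v) else new i v)"
        by (auto simp: new_def less_Suc_eq)
      \<comment> \<open>Writing happens at the position just behind the list, so the earlier triples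
        survive.\<close>
      have trip: "triples (set_nreg 1 (nreg t' 1 + 1) (put_narr 2 (nreg t' 1) z3 (put_narr 1 (nreg t' 1) z2 (put_narr 0 (nreg t' 1) z1 t')))) =
          insert (z1, z2, z3) (triples t')" for t' z1 z2 z3
      proof -
        have "(\<lambda>k. (((narr t' 0)(n := z1)) k, ((narr t' 1)(n := z2)) k, ((narr t' 2)(n := z3)) k)) ` {..<n} =
            (\<lambda>k. (narr t' 0 k, narr t' 1 k, narr t' 2 k)) ` {..<n}" for n
          by (intro image_cong) auto
        then show ?thesis by (simp add: triples_def lessThan_Suc)
      qed
      have trip': "triples (set_nreg n_o z (set_nreg n_v z' t')) = triples t'" for t' z z'
        by (simp add: triples_def)
      show ?case
      proof (cases "0 < ow i v")
        case True
        then show ?thesis using 5(2) env B o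
          trip[of "set_nreg n_o (ow i v) (set_nreg n_v v t3)" "narr s Rights v" "narr s Lefts (ow i v - 1)" i]
          by (simp add: wp_simps entry_exp_def fr3 t2_def fr1 env_def J_def new_Suc trip')
      next
        case False
        then show ?thesis using 5(2) env B o
          by (simp add: wp_simps entry_exp_def fr3 t2_def fr1 env_def J_def new_Suc trip')
      qed
    next
      case (6 t3)
      note fr3 = frame_simps[OF 6(2)]
      show ?case using 6(1) 8(2)
        by (auto simp: I_def J_def fr3 t2_def less_Suc_eq)
    next
      case 4
      then show ?case using 8(2) by (simp add: I_def J_def new_def t2_def triples_def)
    qed (use env B in \<open>auto simp: env_def t2_def fr1\<close>)
    then show ?case using 8(2) env quo r_pos B(3)
      by (simp add: wp_simps next_digit_def t2_def fr1 env_def I_def dig_def)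
  next
    case (9 t)
    have mem: "(c, x, x') \<in> triples t \<longleftrightarrow> (\<exists>k<nreg t 1. narr t 0 k = c \<and> narr t 1 k = x \<and> narr t 2 k = x')" for c x x'
      by (auto simp: triples_def)
    have "{(narr t 1 k, narr t 2 k) | k. k < nreg t 1 \<and> narr t 0 k = c} =
        {(narr s Lefts (ow c v - 1), narr s Rights v) | v. v < b \<and> 0 < ow c v}" if "c < m" for c
    proof -
      have "{(narr t 1 k, narr t 2 k) | k. k < nreg t 1 \<and> narr t 0 k = c} = {(x, x'). (c, x, x') \<in> triples t}"
        unfolding mem by auto
      also have "\<dots> = {(x, x'). (c, x, x') \<in> new c b}"
        using 9(1) that by (auto simp: I_def new_def)
      also have "\<dots> = {(narr s Lefts (ow c v - 1), narr s Rights v) | v. v < b \<and> 0 < ow c v}"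
        by (auto simp: new_def)
      finally show ?thesis .
    qed
    then show ?case using 9(1)
      unfolding output_schedule_def vector_schedule_def
      by (intro image_cong) (auto simp: I_def ow_def y_def)
  qed (use env B in \<open>auto simp: env_def I_def triples_def y_def\<close>)
qed

text \<open>\<open>P\<close> is any relation between a schedule and a claimed value; keeping it
  abstract separates the search for a maximum from the meaning of the schedules.\<close>

lemma wp_select_cmd:
  assumes env: "env s"
    and P: "\<And>y. y < r ^ m \<Longrightarrow>
      P (vector_schedule (narr s Lefts) (narr s Rights) (narr s Table) y) (vector_value (narr s Table) y)"
    and out: "P (output_schedule s) (rreg s r_best)"
  shows "wp B select_cmd (\<lambda>t. P (output_schedule t) (rreg t r_best) \<and> rreg s r_best \<le> rreg t r_best \<and>
    (\<forall>y<r ^ m. vector_value (narr s Table) y \<le> rreg t r_best)) s"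
  unfolding select_cmd_def
proof (rule wp_FOR[where n = "r ^ m" and I = "\<lambda>n t. P (output_schedule t) (rreg t r_best) \<and>
    rreg s r_best \<le> rreg t r_best \<and> (\<forall>y<n. vector_value (narr s Table) y \<le> rreg t r_best)"], goal_cases)
  case (5 y t)
  note fr = frame_simps[OF 5(3)]
  let ?t = "set_nreg n_y y t"
  have envt: "env ?t" using env by (simp add: env_def fr)
  show ?case unfolding wp_simps(6)
  proof (rule wp_call[OF wp_value_cmd[OF envt]])
    show "nreg ?t n_y < r ^ m" using 5(1) by simp
    fix t1 assume t1: "rreg t1 r_acc = vector_value (narr ?t Table) (nreg ?t n_y)" and fr1: "frame value_cmd ?t t1"
    note fr1 = frame_simps[OF fr1]
    have acc: "rreg t1 r_acc = vector_value (narr s Table) y" using t1 by (simp add: fr)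
    show "wp B (IF (RLt (RV r_best) (RV r_acc)) (RSet r_best (RV r_acc);; output_cmd) NOP)
       (\<lambda>t. P (output_schedule t) (rreg t r_best) \<and> rreg s r_best \<le> rreg t r_best \<and>
         (\<forall>y'<Suc y. vector_value (narr s Table) y' \<le> rreg t r_best)) t1"
    proof (cases "rreg t1 r_best < rreg t1 r_acc")
      case True
      let ?t1 = "set_rreg r_best (rreg t1 r_acc) t1"
      have env1: "env ?t1" using envt by (simp add: env_def fr1)
      have "wp B output_cmd (\<lambda>t. P (output_schedule t) (rreg t r_best) \<and> rreg s r_best \<le> rreg t r_best \<and>
         (\<forall>y'<Suc y. vector_value (narr s Table) y' \<le> rreg t r_best)) ?t1"
      proof (rule wp_call[OF wp_output_cmd[OF env1]], goal_cases)
        case (2 t2)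
        note fr2 = frame_simps[OF 2(2)]
        show ?case using 2(1) P[OF 5(1)] 5(2) True acc
          by (auto simp: fr2 fr1 fr less_Suc_eq)
      qed (use 5(1) in \<open>simp add: fr1\<close>)
      then show ?thesis using True by (simp add: wp_simps)
    next
      case False
      have "output_schedule t1 = output_schedule t"
        by (rule output_schedule_cong) (simp_all add: fr1)
      then show ?thesis using False 5(2) acc by (auto simp: wp_simps less_Suc_eq fr1)
    qed
  qed
qed (use env B out in \<open>auto simp: env_def\<close>)

end


section \<open>Enumeration of the guessed durations for a given number of configurations\<close>

lemma written_durations_cmd [simp]:
  "written durations_cmd = {NReg n_z, NReg n_i, NReg n_d, RReg r_sum, RArr Duration}"
  by (auto simp: durations_cmd_def)

lemma written_radix_cmd [simp]:
  "written radix_cmd = {NReg n_guesses, NReg n_vectors, NReg n_i, NArr Radix}"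
  by (auto simp: radix_cmd_def)

lemma written_round_cmds [simp]:
  "written guess_cmd = {NReg 0, NReg 1, NReg n_z, NReg n_i, NReg n_d, NReg n_t, NReg n_c, NReg n_j, NReg
     n_u, NReg n_v, NReg n_y, NReg n_dj, NReg n_bidder, NReg n_item, NReg n_o, RReg r_sum, RReg r_acc, RReg
     r_load, RReg r_wmax, RReg r_eta, RReg r_profit, RReg r_best, NArr 0, NArr 1, NArr 2, NArr Table, NArr
     Status, NArr Owner, NArr Price, RArr 0, RArr Duration, RArr Weight}"
  "written round_cmd = {NReg 0, NReg 1, NReg n_m, NReg n_guesses, NReg n_vectors, NReg n_x, NReg n_z, NReg
     n_i, NReg n_d, NReg n_t, NReg n_c, NReg n_j, NReg n_u, NReg n_v, NReg n_y, NReg n_dj, NReg n_bidder,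
     NReg n_item, NReg n_o, RReg r_len, RReg r_unit, RReg r_sum, RReg r_acc, RReg r_load, RReg r_wmax, RReg
     r_eta, RReg r_profit, RReg r_best, NArr 0, NArr 1, NArr 2, NArr Radix, NArr Table, NArr Status, NArr
     Owner, NArr Price, RArr 0, RArr Duration, RArr Weight}"
  by (auto simp: guess_cmd_def round_cmd_def)

lemma radix_le: "r * m + 2 \<le> B \<Longrightarrow> radix r m i \<le> B"
  using div_le_dividend[of "r * m" "i + 1"] unfolding radix_def by linarith

lemma wp_durations_cmd:
  assumes "nreg s n_m = m" "m \<le> B" "nreg s n_x \<le> B" "r * m + 2 \<le> B" and rad: "\<And>i. i < m \<Longrightarrow> narr s Radix i = radix r m i"
    and \<delta>: "\<delta> = grid_duration (rreg s r_unit) m (dig (radix r m) (nreg s n_x))"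
  shows "wp B durations_cmd (\<lambda>t. (\<forall>i<m. rarr t Duration i = \<delta> i) \<and> rreg t r_sum = (\<Sum>i<m. \<delta> i)) s"
proof -
  define I where "I n t \<longleftrightarrow> nreg t n_z = quo (radix r m) (nreg s n_x) n \<and>
    (\<forall>i<n. rarr t Duration i = \<delta> i) \<and> rreg t r_sum = (\<Sum>i<n. \<delta> i)" for n and t :: machine_state
  have quo: "quo (radix r m) (nreg s n_x) i \<le> B" for i
    using quo_le[of "radix r m" "nreg s n_x" i] assms(3) by linarith
  show ?thesis unfolding durations_cmd_def wp_simps(6) wp_simps(2) wp_simps(3)
  proof (intro conjI wp_FOR[where n = m and I = I], goal_cases)
    case (7 i t)
    note fr = frame_simps[OF 7(3)]
    have "0 < radix r m i" by (simp add: radix_def)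
    then show ?case using 7(1,2) quo assms(1,2) radix_le[OF assms(4), of i]
      by (auto simp: I_def wp_simps next_digit_def fr rad \<delta> grid_duration_def dig_def less_Suc_eq)
  qed (use assms in \<open>auto simp: I_def\<close>)
qed

lemma wp_radix_cmd:
  assumes "nreg s n_m = m" "nreg s n_r = r" "m \<le> B" "r \<le> B" "r * m + 2 \<le> B"
  shows "wp B radix_cmd (\<lambda>t. (\<forall>i<m. narr t Radix i = radix r m i) \<and>
    nreg t n_guesses = (\<Prod>i<m. radix r m i) \<and> nreg t n_vectors = r ^ m) s"
proof -
  define I where "I n t \<longleftrightarrow> (\<forall>i<n. narr t Radix i = radix r m i) \<and>
    nreg t n_guesses = (\<Prod>i<n. radix r m i) \<and> nreg t n_vectors = r ^ n" for n and t :: machine_state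
  show ?thesis unfolding radix_cmd_def wp_simps(6) wp_simps(2)
  proof (intro conjI wp_FOR[where n = m and I = I], goal_cases)
    case (7 i t)
    note fr = frame_simps[OF 7(3)]
    show ?case using 7(1,2) radix_le[OF assms(5), of i] assms
      by (auto simp: I_def wp_simps fr radix_def less_Suc_eq)
  qed (use assms in \<open>auto simp: I_def\<close>)
qed

lemma load_value_cong:
  assumes "\<And>u v. u < a \<Longrightarrow> v < b \<Longrightarrow> D u v = D' u v" "\<And>i. i < m \<Longrightarrow> \<alpha> i = \<alpha>' i"
  shows "load_value a b D m Q \<alpha> = load_value a b D' m Q \<alpha>'"
  unfolding load_value_def using assms by (intro sum.cong arg_cong2[where f = min] refl) auto

context switch
begin

text \<open>A lower bound on the value suffices. Feasibility is included, so the current output is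
  legal throughout the search.\<close>

definition at_least :: "nat schedule \<Rightarrow> real \<Rightarrow> bool" where
  "at_least S x \<longleftrightarrow> feasible I S \<and> x \<le> schedule_value I S"

definition slack :: "nat \<Rightarrow> real" where
  "slack m = window I - real m * delay I"

definition guessed_durations :: "nat \<Rightarrow> nat \<Rightarrow> nat \<Rightarrow> nat \<Rightarrow> real" where
  "guessed_durations r m x = grid_duration (slack m / (real r * real m)) m (dig (radix r m) x)"

text \<open>The effect of having tried guess \<open>x\<close>: if its durations fit,
  \<open>best\<close> competes with every choice of matchings for them, up to the greedy
  factor.\<close>

definition covers :: "nat \<Rightarrow> nat \<Rightarrow> nat \<Rightarrow> real \<Rightarrow> bool" where
  "covers r m x best \<longleftrightarrow> ((\<Sum>i<m. guessed_durations r m x i) \<le> slack m \<longrightarrow>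
     (\<forall>Q. (\<forall>i<m. valid_owner a b (Q i)) \<longrightarrow>
       (1 - 1 / exp 1 - 2 / real r) * load_value a b D m Q (guessed_durations r m x) \<le> best))"

lemma covers_mono: "covers r m x best \<Longrightarrow> best \<le> best' \<Longrightarrow> covers r m x best'"
  unfolding covers_def by (meson order_trans)

end

text \<open>The bounds that involve \<open>r\<close> are demanded only for
  \<open>0 < m \<le> k\<close>. For \<open>k = 0\<close> the time must not depend on \<epsilon>, so
  \<open>r\<close> may exceed \<open>B\<close>, and no round is executed.\<close>

locale algorithm = switch +
  fixes k r B :: nat
  assumes r2: "2 \<le> r" and B0: "k \<le> B" "a \<le> B" "b \<le> B"
    and B: "\<And>m. 0 < m \<Longrightarrow> m \<le> k \<Longrightarrow> r \<le> B \<and> r ^ m \<le> B \<and> a * r \<le> B \<and> b * (a * r) + a + 1 \<le> B \<and>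
      m * r * b \<le> B \<and> r * m + 2 \<le> B \<and> (\<Prod>i<m. radix r m i) \<le> B"
begin

definition env :: "machine_state \<Rightarrow> bool" where
  "env s \<longleftrightarrow> nreg s n_k = k \<and> nreg s n_a = a \<and> nreg s n_b = b \<and> nreg s n_r = r \<and>
     rreg s r_delay = delay I \<and> rreg s r_window = window I \<and>
     (\<forall>u<a. narr s Lefts u = lefts ! u) \<and> (\<forall>v<b. narr s Rights v = rights ! v) \<and>
     (\<forall>u<a. \<forall>v<b. rarr s Demand (u * b + v) = D u v)"

lemma wp_guess_cmd:
  assumes env: "env s" and m: "0 < m" "m \<le> k" "nreg s n_m = m" "nreg s n_vectors = r ^ m"
    and L: "0 < slack m" "rreg s r_len = slack m" "rreg s r_unit = slack m / (real r * real m)"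
    and x: "nreg s n_x = x" "x < (\<Prod>i<m. radix r m i)" and rad: "\<And>i. i < m \<Longrightarrow> narr s Radix i = radix r m i"
    and out: "at_least (output_schedule s) (rreg s r_best)"
  shows "wp B guess_cmd (\<lambda>t. at_least (output_schedule t) (rreg t r_best) \<and> rreg s r_best \<le> rreg t r_best \<and>
    covers r m x (rreg t r_best)) s"
proof -
  have mB: "m \<le> B" "x \<le> B" "r * m + 2 \<le> B" using m x B0 B[OF m(1,2)] by auto
  define \<delta> where "\<delta> = guessed_durations r m x"
  define unit where "unit = slack m / (real r * real m)"
  have unit: "0 < unit" using L(1) r2 m(1) by (simp add: unit_def)
  have \<delta>: "\<delta> = grid_duration (rreg s r_unit) m (dig (radix r m) (nreg s n_x))"
    using L x by (simp add: \<delta>_def guessed_durations_def)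
  have \<delta>0: "0 \<le> \<delta> i" for i
    using unit by (simp add: \<delta>_def guessed_durations_def grid_duration_nonneg unit_def[symmetric])
  have xB: "nreg s n_x \<le> B" using x mB by simp
  show ?thesis unfolding guess_cmd_def wp_simps(6)
  proof (rule wp_call[OF wp_durations_cmd[OF m(3) mB(1) xB mB(3) rad \<delta>]], assumption, elim conjE)
    fix t1 assume dur: "\<forall>i<m. rarr t1 Duration i = \<delta> i" and sum: "rreg t1 r_sum = (\<Sum>i<m. \<delta> i)"
      and "frame durations_cmd s t1"
    note fr1 = frame_simps[OF this(3)]
    let ?Q = "\<lambda>t. at_least (output_schedule t) (rreg t r_best) \<and> rreg s r_best \<le> rreg t r_best \<and>
      covers r m x (rreg t r_best)"
    have out1: "at_least (output_schedule t1) (rreg t1 r_best)"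
      using out output_schedule_cong[of t1 s] by (simp add: fr1)
    show "wp B (IF (RLeq (RV r_sum) (RV r_len)) (greedy_cmd;; select_cmd) NOP) ?Q t1"
    proof (cases "(\<Sum>i<m. \<delta> i) \<le> slack m")
      case False
      then show ?thesis using sum out1 L by (simp add: wp_simps fr1 covers_def \<delta>_def)
    next
      case True
      have Dem: "rarr t1 Demand (u * b + v) = D u v" if "u < a" "v < b" for u v
        using env that by (simp add: fr1 env_def)
      interpret bd: bounded a b r m "rarr t1 Demand" "rarr t1 Duration" B
        by unfold_locales (use r2 Dem D_nonneg dur \<delta>0 B0 mB B[OF m(1,2)] in auto)
      have env1: "bd.env t1" using env m unfolding bd.env_def by (simp add: env_def fr1)
      have "wp B greedy_cmd (wp B select_cmd ?Q) t1"
      proof (rule wp_call[OF bd.wp_greedy_cmd[OF env1]])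
        fix t2 assume inv: "bd.greedy_inv r (narr t2 Table)" and "frame greedy_cmd t1 t2"
        note fr2 = frame_simps[OF this(2)]
        have env2: "bd.env t2" using env1 unfolding bd.env_def by (simp add: fr2)
        have out2: "at_least (output_schedule t2) (rreg t2 r_best)"
          using out1 output_schedule_cong[of t2 t1] by (simp add: fr2)
        have "at_least (bd.vector_schedule (narr t2 Lefts) (narr t2 Rights) (narr t2 Table) y)
            (bd.vector_value (narr t2 Table) y)" for y
        proof -
          define own where "own i v = narr t2 Table ((i * r + dig (\<lambda>_. r) y i) * b + v)" for i v
          have own: "valid_owner a b (own i)" if "i < m" for i
            using inv that dig_less[of "\<lambda>_. r" i y] r2
            unfolding bd.greedy_inv_def bd.valid_table_def own_def[abs_def] by simp
          have matching: "{(narr t2 Lefts (own i v - 1), narr t2 Rights v) | v. v < b \<and> 0 < own i v} =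
              matching_of (own i)" if "i < m" for i
          proof -
            have "narr t2 Lefts (own i v - 1) = lefts ! (own i v - 1)" "narr t2 Rights v = rights ! v"
              if "v < b" "0 < own i v" for v
              using that own[OF \<open>i < m\<close>] env by (auto simp: valid_owner_def env_def fr1 fr2)
            then show ?thesis unfolding matching_of_def setcompr_eq_image by (intro image_cong) auto
          qed
          have sched: "bd.vector_schedule (narr t2 Lefts) (narr t2 Rights) (narr t2 Table) y = schedule_of m own \<delta>"
            unfolding bd.vector_schedule_def schedule_of_def own_def[symmetric]
            using matching dur by (intro image_cong) auto
          have val: "bd.vector_value (narr t2 Table) y = load_value a b D m own \<delta>"
            unfolding bd.vector_value_def own_def[symmetric]
            using Dem dur by (intro load_value_cong) auto
          \<comment> \<open>This is where the offsets in \<open>grid_duration\<close> pay off: the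
            output is a set of exactly \<open>m\<close> configurations.\<close>
          have inj: "inj_on \<delta> {..<m}"
            using inj_on_grid_duration[OF unit] by (simp add: \<delta>_def guessed_durations_def unit_def)
          have "(\<Sum>i<m. \<delta> i) + real m * delay I \<le> window I" using True by (simp add: slack_def)
          from schedule_of[OF own \<delta>0 inj this] show ?thesis
            unfolding sched val at_least_def by simp
        qed
        from bd.wp_select_cmd[OF env2 this out2] show "wp B select_cmd ?Q t2"
        proof (rule wp_call, elim conjE)
          fix t3 assume t3: "at_least (output_schedule t3) (rreg t3 r_best)" "rreg t2 r_best \<le> rreg t3 r_best"
            "\<forall>y<r ^ m. bd.vector_value (narr t2 Table) y \<le> rreg t3 r_best"
          have "(1 - 1 / exp 1 - 2 / real r) * load_value a b D m Q \<delta> \<le> rreg t3 r_best"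
            if "\<forall>i<m. valid_owner a b (Q i)" for Q
          proof -
            have "bd.owners_value Q = load_value a b D m Q \<delta>"
              unfolding bd.owners_value_def using Dem dur by (intro load_value_cong) auto
            moreover have "bd.all_valid Q" using that unfolding bd.all_valid_def .
            ultimately show ?thesis using bd.greedy_end[OF inv r2, of Q "rreg t3 r_best"] t3(3) by simp
          qed
          with t3 show "?Q t3" by (simp add: covers_def \<delta>_def fr2 fr1)
        qed
      qed
      then show ?thesis using True sum L by (simp add: wp_simps fr1)
    qed
  qed
qed

lemma wp_round_cmd:
  assumes env: "env s" and m: "nreg s n_m0 < k" and out: "at_least (output_schedule s) (rreg s r_best)"
  shows "wp B round_cmd (\<lambda>t. at_least (output_schedule t) (rreg t r_best) \<and> rreg s r_best \<le> rreg t r_best \<and>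
    (0 < slack (Suc (nreg s n_m0)) \<longrightarrow> (\<forall>x<\<Prod>i<Suc (nreg s n_m0). radix r (Suc (nreg s n_m0)) i.
      covers r (Suc (nreg s n_m0)) x (rreg t r_best)))) s"
proof -
  define m where "m = Suc (nreg s n_m0)"
  have mk: "0 < m" "m \<le> k" using assms(2) by (auto simp: m_def)
  have mB: "m \<le> B" using mk B0 by simp
  let ?Q = "\<lambda>t. at_least (output_schedule t) (rreg t r_best) \<and> rreg s r_best \<le> rreg t r_best \<and>
    (0 < slack m \<longrightarrow> (\<forall>x<\<Prod>i<m. radix r m i. covers r m x (rreg t r_best)))"
  let ?s1 = "set_rreg r_len (slack m) (set_nreg n_m m s)"
  have out_s: "output_schedule ?s1 = output_schedule s" by (rule output_schedule_cong) simp_all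
  let ?loop = "RSet r_unit (RDivide (RV r_len) (RTimes (ROf (NV n_r)) (ROf (NV n_m))));;
       radix_cmd;; FOR n_x (NV n_guesses) guess_cmd"
  have loop: "wp B ?loop ?Q ?s1" if L: "0 < slack m"
  proof -
    let ?s2 = "set_rreg r_unit (slack m / (real r * real m)) ?s1"
    have "wp B radix_cmd (wp B (FOR n_x (NV n_guesses) guess_cmd) ?Q) ?s2"
    proof (rule wp_call[OF wp_radix_cmd[of _ m r]], goal_cases)
      case (6 t1)
      note fr1 = frame_simps[OF 6(2)]
      have env1: "env t1" using env by (simp add: env_def fr1)
      have out1: "output_schedule t1 = output_schedule s"
        by (rule output_schedule_cong) (simp_all add: fr1)
      let ?I = "\<lambda>n t. at_least (output_schedule t) (rreg t r_best) \<and> rreg s r_best \<le> rreg t r_best \<and>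
        (\<forall>x<n. covers r m x (rreg t r_best))"
      show ?case
      proof (rule wp_FOR[where n = "\<Prod>i<m. radix r m i" and I = ?I], goal_cases)
        case (5 x t)
        note fr = frame_simps[OF 5(3)]
        let ?t = "set_nreg n_x x t"
        have envt: "env ?t" using env1 by (simp add: env_def fr)
        have outt: "output_schedule ?t = output_schedule t"
          by (rule output_schedule_cong) simp_all
        show ?case
          by (rule wp_call[OF wp_guess_cmd[OF envt mk]])
             (use 5(1,2) 6(1) L in \<open>auto simp: fr fr1 outt less_Suc_eq intro: covers_mono\<close>)
      next
        case 4
        show ?case using out out1 by (simp add: fr1)
      qed (use 6(1) B[OF mk] in auto)
    qed (use env B[OF mk] mB in \<open>auto simp: env_def\<close>)
    then show ?thesis using env by (simp add: wp_simps env_def)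
  qed
  have "wp B round_cmd ?Q s"
    unfolding round_cmd_def
    using loop env out out_s by (simp add: wp_simps env_def slack_def m_def)
  then show ?thesis unfolding m_def .
qed

end


section \<open>The whole program and its approximation guarantee\<close>

context algorithm
begin

lemma wp_init_cmd:
  assumes "nreg s 0 = k" "nreg s 1 = a" "nreg s 2 = b" "nreg s n_r = r" "rreg s r_delay = delay I"
    "rreg s r_window = window I" "\<And>u. u < a \<Longrightarrow> narr s 0 u = lefts ! u" "\<And>v. v < b \<Longrightarrow> narr s 1 v = rights ! v"
    and dem: "\<And>u v. u < a \<Longrightarrow> v < b \<Longrightarrow> rarr s 0 (u * b + v) = D u v"
  shows "wp B init_cmd (\<lambda>t. env t \<and> nreg t 0 = 0 \<and> rreg t r_best = 0) s"
proof -
  have "wp B (FOR n_u (NV n_a) (NPut Lefts (NV n_u) (NGet 0 (NV n_u)));;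
     FOR n_v (NV n_b) (NPut Rights (NV n_v) (NGet 1 (NV n_v)));;
     FOR n_u (NV n_a) (FOR n_v (NV n_b) (RPut Demand edge_exp (RGet 0 edge_exp)));;
     NSet 0 (NC 0);; NSet 1 (NC 0);; RSet r_best (RC 0)) (\<lambda>t. env t \<and> nreg t 0 = 0 \<and> rreg t r_best = 0)
     (set_nreg n_b b (set_nreg n_a a (set_nreg n_k k s)))"
    unfolding wp_simps(6)
  proof (rule wp_FOR[where n = a and I = "\<lambda>j t. \<forall>u<j. narr t Lefts u = lefts ! u"], goal_cases)
    case (5 j t)
    note fr = frame_simps[OF 5(3)]
    show ?case using 5(1,2) assms by (auto simp: wp_simps fr less_Suc_eq)
  next
    case (6 t1)
    note fr1 = frame_simps[OF 6(2)]
    show ?case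
    proof (rule wp_FOR[where n = b and I = "\<lambda>j t. \<forall>v<j. narr t Rights v = rights ! v"], goal_cases)
      case (5 j t)
      note fr = frame_simps[OF 5(3)]
      show ?case using 5(1,2) assms by (auto simp: wp_simps fr fr1 less_Suc_eq)
    next
      case (6 t2)
      note fr2 = frame_simps[OF 6(2)]
      show ?case
      proof (rule wp_FOR_FOR[where ?n1.0 = a and ?n2.0 = b and
            I = "\<lambda>n t. \<forall>e<n. rarr t Demand e = rarr s 0 e"], goal_cases)
        case (11 u v t)
        note fr = frame_simps[OF 11(6)]
        show ?case using 11(1-5) assms B0
          by (auto simp: wp_simps fr fr1 fr2 edge_exp_def less_Suc_eq)
      next
        case (12 t3)
        note fr3 = frame_simps[OF 12(2)]
        have "rarr t3 Demand (u * b + v) = D u v" if "u < a" "v < b" for u v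
          using 12(1) dem[OF that] row_major_less[OF that] by simp
        then show ?case
          using assms \<open>\<forall>u<a. narr t1 Lefts u = lefts ! u\<close> 6(1)
          by (simp add: wp_simps env_def fr3 fr2 fr1)
      qed (use assms B0 in \<open>auto simp: fr1 fr2\<close>)
    qed (use assms B0 in \<open>auto simp: fr1\<close>)
  qed (use assms B0 in auto)
  then show ?thesis
    unfolding init_cmd_def using assms(1-3) by (simp add: wp_simps(2,6))
qed

definition covers_all :: "nat \<Rightarrow> real \<Rightarrow> bool" where
  "covers_all n best \<longleftrightarrow> (\<forall>m. 0 < m \<longrightarrow> m \<le> n \<longrightarrow> 0 < slack m \<longrightarrow>
     (\<forall>x<\<Prod>i<m. radix r m i. covers r m x best))"

lemma feasible_empty: "feasible I {}"
  using valid by (simp add: feasible_def is_schedule_def valid_instance_def)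

lemma schedule_value_empty: "schedule_value I {} = 0"
  using valid by (auto simp: schedule_value_def valid_instance_def intro!: sum.neutral)

lemma wp_main_cmd:
  "wp B main_cmd (\<lambda>t. at_least (output_schedule t) (rreg t r_best) \<and> 0 \<le> rreg t r_best \<and>
    covers_all k (rreg t r_best)) (set_nreg n_r r (input_state k I))"
  unfolding main_cmd_def wp_simps(6)
proof (rule wp_call[OF wp_init_cmd], goal_cases)
  case (9 u v)
  then have "u * b + v < length (List.product lefts rights)"
    using row_major_less by (simp add: a_def b_def)
  moreover from this have "List.product lefts rights ! (u * b + v) = (lefts ! u, rights ! v)"
    using 9 by (simp add: product_nth b_def[symmetric])
  ultimately show ?case
    by (simp add: input_state_def Let_def lefts_def[symmetric] rights_def[symmetric] array_of_def D_def)
next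
  case (10 t)
  then have env: "env t" and out0: "nreg t 0 = 0" and best0: "rreg t r_best = 0" by auto
  let ?I = "\<lambda>n t. env t \<and> at_least (output_schedule t) (rreg t r_best) \<and> 0 \<le> rreg t r_best \<and>
    covers_all n (rreg t r_best)"
  show ?case
  proof (rule wp_FOR[where n = k and I = ?I], goal_cases)
    case 4
    have "output_schedule t = {}" using out0 by (simp add: output_schedule_def)
    then show ?case using env best0 feasible_empty schedule_value_empty
      by (simp add: at_least_def covers_all_def)
  next
    case (5 j t1)
    let ?s = "set_nreg n_m0 j t1"
    have s: "env ?s" "nreg ?s n_m0 < k" "at_least (output_schedule ?s) (rreg ?s r_best)"
      using 5(1,2) output_schedule_cong[of ?s t1] by (simp_all add: env_def)
    show ?case
    proof (rule wp_call[OF wp_round_cmd[OF s]], elim conjE, goal_cases)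
      case (1 t2)
      note fr2 = frame_simps[OF 1(1)]
      have "env t2" using s(1) by (simp add: env_def fr2)
      moreover have "covers_all (Suc j) (rreg t2 r_best)"
        unfolding covers_all_def
      proof (intro allI impI)
        fix m x assume m: "0 < m" "m \<le> Suc j" "0 < slack m" "x < (\<Prod>i<m. radix r m i)"
        show "covers r m x (rreg t2 r_best)"
        proof (cases "m = Suc j")
          case True
          then show ?thesis using 1 m by simp
        next
          case False
          then have "covers r m x (rreg t1 r_best)" using 5(2) m by (simp add: covers_all_def)
          then show ?thesis using 1 by (auto intro: covers_mono)
        qed
      qed
      ultimately show ?case using 1 5(2) by auto
    qed
  qed (use env B0 in \<open>auto simp: env_def\<close>)
qed (use valid in \<open>auto simp: input_state_def Let_def lefts_def[symmetric] rights_def[symmetric] array_of_def a_def b_def\<close>)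

text \<open>One of the guesses dominates \<open>t = 1 - 2 / r\<close> times the durations of
  \<open>S\<close>, and the greedy factor \<open>q\<close> applies to that guess. The assumption on
  \<open>r\<close> gives \<open>q \<ge> 0\<close>, needed to multiply the two estimates.\<close>

lemma covers_all_approx:
  assumes cov: "covers_all k best" "0 \<le> best" and S: "feasible I S" "card S \<le> k"
    and r: "2 / real r \<le> 1 - 1 / exp 1"
  shows "(1 - 1 / exp 1 - 4 / real r) * schedule_value I S \<le> best"
proof -
  define m where "m = card S"
  define t where "t = 1 - 2 / real r"
  define q where "q = 1 - 1 / exp 1 - 2 / real r"
  have t: "0 \<le> t" "t \<le> 1" using r2 by (auto simp: t_def)
  have "0 \<le> 1 / exp (1::real)" "0 \<le> 2 / real r" by simp_all
  then have q: "0 \<le> q" "q \<le> 1" using r unfolding q_def by linarith+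
  obtain own \<beta> where own: "\<And>i. i < m \<Longrightarrow> valid_owner a b (own i)" and \<beta>: "\<And>i. i < m \<Longrightarrow> 0 \<le> \<beta> i"
    "\<And>i j. i \<le> j \<Longrightarrow> j < m \<Longrightarrow> \<beta> j \<le> \<beta> i" "sum \<beta> {..<m} + real m * delay I \<le> window I"
    and val: "schedule_value I S = load_value a b D m own \<beta>"
    using feasible_schedule_cases[OF S(1)] unfolding m_def by metis
  have sum_le: "sum \<beta> {..<m} \<le> slack m" using \<beta>(3) by (simp add: slack_def)
  have V0: "0 \<le> load_value a b D m own \<beta>"
    unfolding load_value_def using D_nonneg \<beta>(1) by (intro sum_nonneg) (auto intro!: sum_nonneg)
  have "q * (t * load_value a b D m own \<beta>) \<le> best"
  proof (cases "0 < m \<and> 0 < slack m")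
    case True
    then obtain d where d: "\<forall>i<m. d i < radix r m i"
        "(\<Sum>i<m. grid_duration (slack m / (real r * real m)) m d i) \<le> slack m"
        "\<forall>i<m. t * \<beta> i \<le> grid_duration (slack m / (real r * real m)) m d i"
      using round_durations[OF r2 _ sum_le \<beta>(1,2) _ refl] unfolding t_def by blast
    obtain x where x: "x < (\<Prod>i<m. radix r m i)" "\<forall>i<m. dig (radix r m) x i = d i"
      using digits_exist[of m d "radix r m"] d(1) by blast
    have eq: "guessed_durations r m x i = grid_duration (slack m / (real r * real m)) m d i" if "i < m" for i
      using x(2) that by (simp add: guessed_durations_def grid_duration_def)
    have "covers r m x best"
      using cov(1) True x(1) S(2) by (simp add: covers_all_def m_def)
    then have "q * load_value a b D m own (guessed_durations r m x) \<le> best"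
      using own d(2) eq unfolding covers_def q_def by simp
    moreover have "t * load_value a b D m own \<beta> \<le> load_value a b D m own (guessed_durations r m x)"
      using D_nonneg t d(3) eq by (intro load_value_scale) auto
    ultimately show ?thesis using q by (meson mult_left_mono order_trans)
  next
    case False
    \<comment> \<open>Without configurations or without transmission time, nothing is sent, and
      \<open>0 \<le> best\<close> is enough.\<close>
    have "\<beta> i = 0" if "i < m" for i
    proof -
      have "sum \<beta> {..<m} = 0" using False sum_le sum_nonneg[of "{..<m}" \<beta>] \<beta>(1) that by fastforce
      then show ?thesis using that \<beta>(1) sum_nonneg_eq_0_iff[of "{..<m}" \<beta>] by simp
    qed
    then have "load_value a b D m own \<beta> = 0"
      unfolding load_value_def using D_nonneg by (intro sum.neutral ballI) (auto cong: if_cong)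
    then show ?thesis using cov(2) by simp
  qed
  \<comment> \<open>As \<open>q \<le> 1\<close>, the factor \<open>t\<close> costs at most another
    \<open>2 / r\<close>.\<close>
  moreover have "1 - 1 / exp 1 - 4 / real r \<le> q * t"
  proof -
    have "q * (2 / real r) \<le> 1 * (2 / real r)" using q by (intro mult_right_mono) auto
    then show ?thesis by (simp add: t_def q_def algebra_simps)
  qed
  then have "(1 - 1 / exp 1 - 4 / real r) * load_value a b D m own \<beta> \<le> (q * t) * load_value a b D m own \<beta>"
    using V0 by (rule mult_right_mono)
  ultimately show ?thesis unfolding val by (simp add: mult.assoc)
qed

end

section \<open>The approximation theorem\<close>

lemma wf_main_cmd: "wf_cmd main_cmd"
  by (simp add: main_cmd_def init_cmd_def round_cmd_def guess_cmd_def radix_cmd_def durations_cmd_def select_cmd_def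
      output_cmd_def value_cmd_def greedy_cmd_def auction_cmd_def reset_cmd_def wmax_cmd_def bid_cmd_def assign_cmd_def
      find_item_cmd_def find_bidder_cmd_def weights_cmd_def load_cmd_def next_digit_def entry_exp_def edge_exp_def
      temp_def)


lemma le_mult_pos: "0 < y \<Longrightarrow> x \<le> x * (y::nat)" "0 < y \<Longrightarrow> x \<le> y * (x::nat)"
  by (cases y; simp)+

text \<open>The instance size absorbs the dimensions, the power absorbs whatever depends on
  \<open>r\<close> and \<open>m\<close>, and mixed products split accordingly. The base 9 serves
  \<open>prod_radix_le\<close> and also gives \<open>Suc k \<le> 9 ^ k\<close>.\<close>

lemma (in switch) algorithm_bound:
  assumes "2 \<le> r"
  shows "algorithm I k r (instance_size I * (9 * r) ^ k)"
proof unfold_locales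
  let ?n = "instance_size I" and ?X = "(9 * r) ^ k"
  have n: "?n = a + b + a * b + 2" by (simp only: instance_size_def ab[symmetric])
  have X: "0 < ?X" using assms by simp
  have nB: "x \<le> ?n * ?X" if "x \<le> ?n" for x
    by (rule le_trans[OF that], rule le_mult_pos(1)) (rule X)
  have XB: "x \<le> ?n * ?X" if "x \<le> ?X" for x
    by (rule le_trans[OF that], rule le_mult_pos(2)) (simp add: n)
  have k9: "Suc k \<le> 9 ^ k" by (induction k) auto
  show "2 \<le> r" by fact
  show "a \<le> ?n * ?X" "b \<le> ?n * ?X" by (rule nB, simp add: n)+
  show "k \<le> ?n * ?X"
  proof (rule XB)
    have "k \<le> 9 ^ k" using k9 by simp
    also have "\<dots> \<le> ?X" using assms by (intro power_mono) auto
    finally show "k \<le> ?X" .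
  qed
  fix m assume m: "0 < m" "m \<le> k"
  then have k: "0 < k" by simp
  have rk: "r \<le> r ^ k" using self_le_power[of r k] assms k by simp
  have kX: "Suc k * r \<le> ?X"
    using mult_le_mono[OF k9 rk] by (simp add: power_mult_distrib)
  have mr: "r * m + 2 \<le> ?X"
  proof -
    have "r * m + 2 \<le> r * k + r" using m assms by (intro add_mono mult_left_mono) auto
    also have "\<dots> = Suc k * r" by simp
    finally show ?thesis using kX by simp
  qed
  \<comment> \<open>The number of auction rounds is estimated by twice \<open>?n * r\<close>, hence
    the 2.\<close>
  have r2X: "2 * r \<le> ?X" using kX k mult_le_mono1[of 2 "Suc k" r] by linarith
  show "r \<le> ?n * ?X \<and> r ^ m \<le> ?n * ?X \<and> a * r \<le> ?n * ?X \<and> b * (a * r) + a + 1 \<le> ?n * ?X \<and>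
      m * r * b \<le> ?n * ?X \<and> r * m + 2 \<le> ?n * ?X \<and> (\<Prod>i<m. radix r m i) \<le> ?n * ?X"
  proof (intro conjI)
    show "r \<le> ?n * ?X" using r2X by (intro XB) simp
    have "r ^ m \<le> (9 * r) ^ m" by (intro power_mono) auto
    also have "\<dots> \<le> ?X" using m assms by (intro power_increasing) auto
    finally show "r ^ m \<le> ?n * ?X" by (rule XB)
    have "a \<le> ?n" "b \<le> ?n" by (simp_all add: n)
    moreover have "r \<le> ?X" "m * r \<le> ?X" using r2X mr by (simp_all add: mult.commute)
    ultimately show "a * r \<le> ?n * ?X" "m * r * b \<le> ?n * ?X"
      using mult_le_mono[of a ?n r ?X] mult_le_mono[of b ?n "m * r" ?X] by (simp_all only: mult.commute)
    have "b * (a * r) + a + 1 \<le> ?n * r + ?n * r"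
    proof -
      have "a * b * r \<le> ?n * r" by (rule mult_le_mono1) (simp add: n)
      then have "b * (a * r) \<le> ?n * r" by (simp only: ac_simps)
      moreover have "a + 1 \<le> ?n * r" using n le_mult_pos(1)[of r ?n] assms by simp
      ultimately show ?thesis by linarith
    qed
    also have "\<dots> = ?n * (2 * r)" by simp
    also have "\<dots> \<le> ?n * ?X" using r2X by (rule mult_le_mono2)
    finally show "b * (a * r) + a + 1 \<le> ?n * ?X" .
    show "r * m + 2 \<le> ?n * ?X" using mr by (rule XB)
    have "(\<Prod>i<m. radix r m i) \<le> (9 * r) ^ m" using assms by (intro prod_radix_le) auto
    also have "\<dots> \<le> ?X" using m assms by (intro power_increasing) auto
    finally show "(\<Prod>i<m. radix r m i) \<le> ?n * ?X" by (rule XB)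
  qed
qed

lemma opt_nonneg: "valid_instance I \<Longrightarrow> 0 \<le> opt k I"
proof -
  assume I: "valid_instance I"
  have "feasible I {}" "schedule_value I {} = 0"
    using I by (auto simp: feasible_def is_schedule_def valid_instance_def schedule_value_def intro!: sum.neutral)
  then have "0 \<in> schedule_value I ` {S. feasible I S \<and> card S \<le> k}"
    by (intro image_eqI[of _ _ "{}"]) auto
  then show ?thesis unfolding opt_def using opt_set_bdd_above by (rule cSup_upper)
qed

lemma opt_le:
  assumes "valid_instance I" "0 < q" "\<And>S. feasible I S \<Longrightarrow> card S \<le> k \<Longrightarrow> q * schedule_value I S \<le> x"
  shows "q * opt k I \<le> x"
proof -
  have "opt k I \<le> x / q"
    unfolding opt_def using opt_set_nonempty[OF assms(1)]
    by (rule cSup_least) (use assms(2,3) in \<open>auto simp: pos_le_divide_eq mult.commute\<close>)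
  then show ?thesis using assms(2) by (simp add: pos_le_divide_eq mult.commute)
qed

text \<open>From \<open>1/\<epsilon> > 3/2\<close> and \<open>45 \<le> (3/2)^10\<close> one gets
  \<open>9 * r \<le> 45/\<epsilon> \<le> (1/\<epsilon>)^11\<close>; this is the origin of the
  exponent 11.\<close>

lemma bound_by_eps_power:
  fixes \<epsilon> :: real
  assumes "0 < \<epsilon>" "\<epsilon> < 2 / 3" "real r \<le> 5 / \<epsilon>" "1 \<le> n"
  shows "real (n * (9 * r) ^ k) \<le> (real n / \<epsilon> ^ k) ^ 11"
proof -
  define y where "y = 1 / \<epsilon>"
  have y: "3 / 2 \<le> y" using assms(1,2) by (simp add: y_def field_simps)
  have "(45::real) \<le> (3 / 2) ^ 10" by (simp add: power_divide)
  also have "\<dots> \<le> y ^ 10" using y by (intro power_mono) auto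
  finally have "45 * y \<le> y ^ 10 * y" using y by (intro mult_right_mono) auto
  moreover have "9 * real r \<le> 45 * y" using assms(3) by (simp add: y_def)
  ultimately have "9 * real r \<le> y ^ 11" by (simp add: power_Suc2[symmetric])
  then have "(9 * real r) ^ k \<le> (y ^ 11) ^ k" by (intro power_mono) auto
  also have "\<dots> = (y ^ k) ^ 11" by (simp flip: power_mult add: mult.commute)
  finally have "real n * (9 * real r) ^ k \<le> real n ^ 11 * (y ^ k) ^ 11"
    using assms(4) self_le_power[of "real n" 11] by (intro mult_mono) auto
  also have "\<dots> = (real n / \<epsilon> ^ k) ^ 11"
    by (simp add: y_def power_divide power_mult_distrib)
  finally show ?thesis by simp
qed

theorem theorem5:
  "\<exists>q :: real poly. \<forall>\<epsilon> :: real. \<epsilon> > 0 \<longrightarrow>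
     (\<exists>p :: program. \<forall>(k :: nat) (I :: nat switch_instance). valid_instance I \<longrightarrow>
        terminates p (input_state k I) \<and>
        (\<forall>S\<in>set_pmf (returned_schedule p k I). feasible I S) \<and>
        measure_pmf.expectation (returned_schedule p k I) (schedule_value I)
          \<ge> (1 - 1 / exp 1 - \<epsilon>) * opt k I \<and>
        real (running_time p (input_state k I)) \<le> poly q (real (instance_size I) / \<epsilon> ^ k))"
proof -
  \<comment> \<open>The 6 steps load the constant \<open>r\<close> into its register before
    \<open>main_cmd\<close>.\<close>
  have "poly_bounded (\<lambda>B. ctime B main_cmd + 6)"
    by (intro poly_bounded_add ctime_poly poly_bounded_const)
  then obtain K d where K: "\<And>B. B \<ge> 1 \<Longrightarrow> ctime B main_cmd + 6 \<le> K * B ^ d"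
    unfolding poly_bounded_def by blast
  \<comment> \<open>\<open>K\<close> and \<open>d\<close> belong to \<open>main_cmd\<close>, which
    does not mention \<epsilon>. The summand 1 covers the one-instruction program for large
    \<epsilon>, where \<open>n / \<epsilon>^k\<close> may be arbitrarily small.\<close>
  define q :: "real poly" where "q = 1 + monom (real K) (11 * d)"
  show ?thesis
  proof (intro exI[of _ q] allI impI, goal_cases)
    case \<epsilon>: (1 \<epsilon>)
    show ?case
    proof (cases "\<epsilon> < 1 - 1 / exp 1")
      case False
      let ?p = "Instr (NConst 0 0)"
      show ?thesis
      proof (intro exI[of _ ?p] allI impI, goal_cases)
        case I: (1 k I)
        have "achieves ?p (input_state k I) 1 (\<lambda>t. output_schedule t = {})"
          by (rule achieves_Instr) (auto simp: output_schedule_def)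
        then obtain s where s: "terminates ?p (input_state k I)" "running_time ?p (input_state k I) \<le> 1"
            "final_state ?p (input_state k I) = return_pmf s" "output_schedule s = {}"
          by (rule achieves_final)
        have ret: "returned_schedule ?p k I = return_pmf {}"
          using s by (simp add: returned_schedule_def)
        have empty: "feasible I {}" "schedule_value I {} = 0"
          using I by (auto simp: feasible_def is_schedule_def valid_instance_def schedule_value_def intro!: sum.neutral)
        have "(1 - 1 / exp 1 - \<epsilon>) * opt k I \<le> 0"
          using False opt_nonneg[OF I] by (intro mult_nonpos_nonneg) auto
        moreover have "1 \<le> poly q (real (instance_size I) / \<epsilon> ^ k)"
          using \<epsilon> by (simp add: q_def poly_monom)
        ultimately show ?case
          using s(1,2) empty unfolding ret by auto
      qed
    next
      case True
      \<comment> \<open>From \<open>exp 1 \<le> 3\<close>; the bound 2/3 on \<epsilon> gives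
        \<open>r \<ge> 6\<close> and keeps 1/\<epsilon> above 3/2.\<close>
      have "1 / exp 1 \<ge> (1 / 3 :: real)" using exp_le by (intro divide_left_mono) auto
      then have \<epsilon>': "\<epsilon> < 2 / 3" using True by linarith
      define r where "r = nat \<lceil>4 / \<epsilon>\<rceil>"
      have "4 / \<epsilon> \<le> real r" unfolding r_def by linarith
      then have r_ge: "4 / real r \<le> \<epsilon>" using \<epsilon>
        by (metis divide_le_eq divide_pos_pos less_le_trans mult.commute zero_less_numeral)
      have "real r \<le> 4 / \<epsilon> + 1" unfolding r_def using \<epsilon> by (simp add: of_nat_nat)
      also have "\<dots> \<le> 5 / \<epsilon>" using \<epsilon> \<epsilon>' by (simp add: field_simps)
      finally have r_le: "real r \<le> 5 / \<epsilon>" .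
      have "6 \<le> 4 / \<epsilon>" using \<epsilon> \<epsilon>' by (simp add: field_simps)
      with \<open>4 / \<epsilon> \<le> real r\<close> have r2: "2 \<le> r" by linarith
      \<comment> \<open>The accuracy enters the program only as this constant, so one program serves
        all \<open>k\<close> and all instances.\<close>
      let ?c = "NSet n_r (NC r);; main_cmd"
      let ?p = "compile temp ?c"
      show ?thesis
      proof (intro exI[of _ ?p] allI impI, goal_cases)
        case I: (1 k I)
        let ?n = "instance_size I" and ?s = "input_state k I"
        define B where "B = ?n * (9 * r) ^ k"
        interpret switch I using I by unfold_locales
        interpret algorithm I k r B unfolding B_def by (rule algorithm_bound[OF r2])
        have n: "1 \<le> ?n" by (simp add: instance_size_def)
        have B1: "1 \<le> B" using n r2 by (simp add: B_def Suc_le_eq)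
        have wp: "ok B main_cmd (set_nreg n_r r ?s)"
          "at_least (output_schedule (sem ?c ?s)) (rreg (sem ?c ?s) r_best)"
          "0 \<le> rreg (sem ?c ?s) r_best" "covers_all k (rreg (sem ?c ?s) r_best)"
          using wp_main_cmd by (auto simp: wp_def)
        have "achieves ?p ?s (ctime B ?c)
            (\<lambda>t. same temp temp (sem ?c ?s) t \<and> (\<forall>i. temp \<le> i \<and> i < temp \<longrightarrow> nreg t i = nreg ?s i))"
          by (rule compile_correct) (use wp(1) wf_main_cmd in \<open>auto simp: same_refl temp_def\<close>)
        then obtain s where s: "terminates ?p ?s" "running_time ?p ?s \<le> ctime B ?c"
            "final_state ?p ?s = return_pmf s" "same temp temp (sem ?c ?s) s"
          by (rule achieves_final) auto
        have out: "output_schedule s = output_schedule (sem ?c ?s)"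
          using s(4) by (intro output_schedule_cong) (auto simp: same_def temp_def)
        then have ret: "returned_schedule ?p k I = return_pmf (output_schedule (sem ?c ?s))"
          using s(3) by (simp add: returned_schedule_def)
        have "(1 - 1 / exp 1 - \<epsilon>) * opt k I \<le> rreg (sem ?c ?s) r_best"
        proof (rule opt_le[OF I])
          show "0 < 1 - 1 / exp 1 - \<epsilon>" using True by simp
          fix S assume S: "feasible I S" "card S \<le> k"
          have "0 \<le> schedule_value I S"
            unfolding schedule_value_def
            using I S(1) by (intro sum_nonneg) (auto simp: valid_instance_def feasible_def is_schedule_def intro!: sum_nonneg)
          then have "(1 - 1 / exp 1 - \<epsilon>) * schedule_value I S \<le> (1 - 1 / exp 1 - 4 / real r) * schedule_value I S"
            using r_ge by (intro mult_right_mono) auto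
          also have "\<dots> \<le> rreg (sem ?c ?s) r_best"
          proof (rule covers_all_approx[OF wp(4,3) S])
            have "2 / real r \<le> 4 / real r" by (rule divide_right_mono) auto
            then show "2 / real r \<le> 1 - 1 / exp 1" using r_ge True by linarith
          qed
          finally show "(1 - 1 / exp 1 - \<epsilon>) * schedule_value I S \<le> rreg (sem ?c ?s) r_best" .
        qed
        moreover have "real (running_time ?p ?s) \<le> poly q (real ?n / \<epsilon> ^ k)"
        proof -
          have "running_time ?p ?s \<le> ctime B main_cmd + 6" using s(2) by simp
          also have "\<dots> \<le> K * B ^ d" by (rule K[OF B1])
          finally have "real (running_time ?p ?s) \<le> real (K * B ^ d)" by (rule of_nat_mono)
          also have "\<dots> = real K * real B ^ d" by simp
          also have "\<dots> \<le> real K * ((real ?n / \<epsilon> ^ k) ^ 11) ^ d"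
            using bound_by_eps_power[OF \<epsilon> \<epsilon>' r_le n, of k] unfolding B_def
            by (intro mult_left_mono power_mono) auto
          also have "\<dots> \<le> poly q (real ?n / \<epsilon> ^ k)"
            by (simp add: q_def poly_monom flip: power_mult)
          finally show ?thesis .
        qed
        ultimately show ?case
          using s(1) wp(2) unfolding ret at_least_def by auto
      qed
    qed
  qed
qed


end
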